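(* Let $\gamma\ge0$, let $K=(-L,L)^2$ with homogeneous Neumann or periodic boundary conditions, and let $u$ be a (gradient flow) solution of $$\frac{\partial u}{\partial t}=\gamma\Delta u+\mathrm{div}\left(\frac{u_{x_1}}{|u_{x_1}|},\frac{u_{x_2}}{|u_{x_2}|}\right)\quad\text{in }K$$ with initial datum in $L^2(K)$. Let $t>0$ and $x_0\in K$ be such that $u(\cdot,t)$ has a minimum at $x_0$, and suppose in addition that $u(\cdot,t)$ is a convex function different from a constant in a neighborhood $N\subset K$ of the set $\{x\in K: u(x,t)=u(x_0,t)\}$. Then the set $$M=\{x: u(x,t)=u(x_0,t)\}\cap N$$ is a closed set (relative to $N$) with nonempty interior.
   Context: The case $\gamma=0$ is the anisotropic total variation flow; the case $\gamma>0$ is its regularization by linear diffusion. The equation is understood as the gradient flow in $L^2(K)$ of the convex lower semicontinuous functional $\Phi$ defined as follows. For $\gamma>0$: $\Phi(u)=\int_K\frac\gamma2|\nabla u|^2+|u_{x_1}|+|u_{x_2}|\,dx$ if $u\in H^1(K)$, and $+\infty$ otherwise. For $\gamma=0$: $\Phi(u)=\sup\{\int_K u\,\mathrm{div}\,z\,dx: z\in C^1_c(K;\mathbb{R}^2),\ \max(|z_1|,|z_2|)\le1\}\in[0,\infty]$. In the periodic case these functionals are taken on the torus $\mathbb{R}^2/(2L\mathbb{Z})^2$ (with $H^1$ and $C^1_c$ the spaces of the torus). The solution with initial datum $u_0\in L^2(K)$ is the unique $u\in C([0,\infty);L^2(K))$, Lipschitz on $[\delta,\infty)$ for each $\delta>0$,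 with $u(0)=u_0$ and $-\frac{d^+u}{dt}(t)\in\partial\Phi(u(t))$ for all $t>0$ ($\partial\Phi$ the $L^2$-subdifferential, $d^+/dt$ the right derivative). The neighborhood $N$ is open and convex (as required for speaking of a convex function on it), and on $N$ the function $u(\cdot,t)$ is identified with its continuous representative. *)

theory Defs
  imports "HOL-Analysis.Analysis"
begin

datatype boundary_condition = Neumann | Periodic

definition square :: "real \<Rightarrow> (real ^ 2) set" where
  "square L = {x. \<forall>i. - L < x $ i \<and> x $ i < L}"

text \<open>
  Elements of \<open>L\<^sup>2(K)\<close> are represented by functions, not by equivalence classes. All notions
  below depend on these functions only up to equality almost everywhere on \<open>K\<close>. A function on
  the torus \<open>\<real>\<^sup>2/(2L\<int>)\<^sup>2\<close> is represented by its restriction to the fundamental domain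
  \<open>K = square L\<close>, so \<open>L\<^sup>2\<close> of the torus and \<open>L\<^sup>2(K)\<close> coincide.
\<close>

definition L2 :: "real \<Rightarrow> (real ^ 2 \<Rightarrow> real) set" where
  "L2 L = {f. f \<in> borel_measurable (lebesgue_on (square L)) \<and>
              integrable (lebesgue_on (square L)) (\<lambda>x. (f x)\<^sup>2)}"

definition L2_inner :: "real \<Rightarrow> (real ^ 2 \<Rightarrow> real) \<Rightarrow> (real ^ 2 \<Rightarrow> real) \<Rightarrow> real" where
  "L2_inner L f g = (LINT x|lebesgue_on (square L). f x * g x)"

definition L2_norm :: "real \<Rightarrow> (real ^ 2 \<Rightarrow> real) \<Rightarrow> real" where
  "L2_norm L f = sqrt (LINT x|lebesgue_on (square L). (f x)\<^sup>2)"

definition partial :: "2 \<Rightarrow> (real ^ 2 \<Rightarrow> real) \<Rightarrow> real ^ 2 \<Rightarrow> real" where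
  "partial i f x = frechet_derivative f (at x) (axis i 1)"

definition divergence :: "(real ^ 2 \<Rightarrow> real ^ 2) \<Rightarrow> real ^ 2 \<Rightarrow> real" where
  "divergence z x = (\<Sum>i\<in>UNIV. partial i (\<lambda>y. z y $ i) x)"

definition C1 :: "(real ^ 2 \<Rightarrow> real) set" where
  "C1 = {f. f differentiable_on UNIV \<and> (\<forall>i. continuous_on UNIV (partial i f))}"

text \<open>
  \<open>C\<^sup>1\<^sub>c\<close> of the domain: for Neumann conditions the \<open>C\<^sup>1\<close> functions with compact support in \<open>K\<close>
  (extended by zero to the plane), for periodic conditions the \<open>C\<^sup>1\<close> functions on the compact
  torus, that is, the doubly \<open>2L\<close>-periodic \<open>C\<^sup>1\<close> functions on the plane.
\<close>

fun test_functions :: "boundary_condition \<Rightarrow> real \<Rightarrow> (real ^ 2 \<Rightarrow> real) set" where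
  "test_functions Neumann L =
     {\<phi> \<in> C1. compact (closure {x. \<phi> x \<noteq> 0}) \<and> closure {x. \<phi> x \<noteq> 0} \<subseteq> square L}"
| "test_functions Periodic L = {\<phi> \<in> C1. \<forall>x i. \<phi> (x + axis i (2 * L)) = \<phi> x}"

definition has_weak_gradient ::
  "boundary_condition \<Rightarrow> real \<Rightarrow> (real ^ 2 \<Rightarrow> real) \<Rightarrow> (real ^ 2 \<Rightarrow> real ^ 2) \<Rightarrow> bool" where
  "has_weak_gradient bc L u g \<longleftrightarrow>
     (\<forall>i. (\<lambda>x. g x $ i) \<in> L2 L) \<and>
     (\<forall>\<phi> \<in> test_functions bc L. \<forall>i. L2_inner L u (partial i \<phi>) = - L2_inner L (\<lambda>x. g x $ i) \<phi>)"

definition H1 :: "boundary_condition \<Rightarrow> real \<Rightarrow> (real ^ 2 \<Rightarrow> real) set" where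
  "H1 bc L = {u \<in> L2 L. \<exists>g. has_weak_gradient bc L u g}"

text \<open>Weak gradients are unique up to null sets, so the choice made here is immaterial below.\<close>

definition weak_gradient ::
  "boundary_condition \<Rightarrow> real \<Rightarrow> (real ^ 2 \<Rightarrow> real) \<Rightarrow> real ^ 2 \<Rightarrow> real ^ 2" where
  "weak_gradient bc L u = (SOME g. has_weak_gradient bc L u g)"

definition dirichlet_tv_energy ::
  "boundary_condition \<Rightarrow> real \<Rightarrow> real \<Rightarrow> (real ^ 2 \<Rightarrow> real) \<Rightarrow> ereal" where
  "dirichlet_tv_energy bc L \<gamma> u =
     (if u \<in> H1 bc L
      then ereal (LINT x|lebesgue_on (square L).
             \<gamma> / 2 * (norm (weak_gradient bc L u x))\<^sup>2
             + \<bar>weak_gradient bc L u x $ 1\<bar> + \<bar>weak_gradient bc L u x $ 2\<bar>)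
      else \<infinity>)"

definition anisotropic_tv ::
  "boundary_condition \<Rightarrow> real \<Rightarrow> (real ^ 2 \<Rightarrow> real) \<Rightarrow> ereal" where
  "anisotropic_tv bc L u =
     (SUP z \<in> {z. (\<forall>i. (\<lambda>x. z x $ i) \<in> test_functions bc L) \<and>
                  (\<forall>x. max \<bar>z x $ 1\<bar> \<bar>z x $ 2\<bar> \<le> 1)}.
        ereal (LINT x|lebesgue_on (square L). u x * divergence z x))"

definition energy ::
  "boundary_condition \<Rightarrow> real \<Rightarrow> real \<Rightarrow> (real ^ 2 \<Rightarrow> real) \<Rightarrow> ereal" where
  "energy bc L \<gamma> u = (if \<gamma> > 0 then dirichlet_tv_energy bc L \<gamma> u else anisotropic_tv bc L u)"

definition L2_subdifferential ::
  "real \<Rightarrow> ((real ^ 2 \<Rightarrow> real) \<Rightarrow> ereal) \<Rightarrow> (real ^ 2 \<Rightarrow> real) \<Rightarrow> (real ^ 2 \<Rightarrow> real) set" where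
  "L2_subdifferential L \<Phi> u =
     {\<xi> \<in> L2 L. u \<in> L2 L \<and> \<bar>\<Phi> u\<bar> \<noteq> \<infinity> \<and>
        (\<forall>v \<in> L2 L. \<Phi> u + ereal (L2_inner L \<xi> (\<lambda>x. v x - u x)) \<le> \<Phi> v)}"

definition has_L2_right_derivative ::
  "real \<Rightarrow> (real \<Rightarrow> real ^ 2 \<Rightarrow> real) \<Rightarrow> (real ^ 2 \<Rightarrow> real) \<Rightarrow> real \<Rightarrow> bool" where
  "has_L2_right_derivative L u w t \<longleftrightarrow> w \<in> L2 L \<and>
     ((\<lambda>h. L2_norm L (\<lambda>x. (u (t + h) x - u t x) / h - w x)) \<longlongrightarrow> 0) (at_right 0)"

definition gradient_flow_solution ::
  "boundary_condition \<Rightarrow> real \<Rightarrow> real \<Rightarrow> (real ^ 2 \<Rightarrow> real) \<Rightarrow> (real \<Rightarrow> real ^ 2 \<Rightarrow> real) \<Rightarrow> bool"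
where
  "gradient_flow_solution bc L \<gamma> u0 u \<longleftrightarrow>
     (\<forall>t\<ge>0. u t \<in> L2 L) \<and>
     (\<forall>t\<ge>0. ((\<lambda>s. L2_norm L (\<lambda>x. u s x - u t x)) \<longlongrightarrow> 0) (at t within {0..})) \<and>
     (\<forall>\<delta>>0. \<exists>C. \<forall>s\<ge>\<delta>. \<forall>t\<ge>\<delta>. L2_norm L (\<lambda>x. u s x - u t x) \<le> C * \<bar>s - t\<bar>) \<and>
     (AE x in lebesgue_on (square L). u 0 x = u0 x) \<and>
     (\<forall>t>0. \<exists>w. has_L2_right_derivative L u w t \<and>
               (\<lambda>x. - w x) \<in> L2_subdifferential L (energy bc L \<gamma>) (u t))"

end

theory Submission imports Defs begin

text \<open>
  Let \<open>m\<close> be the minimum of \<open>w = u(\<cdot>, t)\<close> and let \<open>\<xi> = - d\<^sup>+u/dt(t)\<close>, a square integrable subgradient of the energy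
  at \<open>w\<close>. Since \<open>w\<close> is convex on \<open>N\<close>, the set \<open>M = {x \<in> N. w x \<le> m}\<close> is convex, and a convex set with empty interior
  is a null set. So the point is that \<open>{w = m}\<close> has positive measure.

  Suppose that it is a null set. For a level \<open>c = m + \<epsilon>\<close> compare \<open>w\<close> with its truncation \<open>max w c = w + f\<close>, where
  \<open>f = max (c - w) 0\<close>. Truncation removes at least the anisotropic total variation of \<open>f\<close> from the energy, so the
  subgradient inequality gives \<open>TV f \<le> - \<langle>\<xi>, f\<rangle>\<close>. By the Cauchy-Schwarz inequality the right-hand side is at most the
  \<open>L\<^sup>2\<close> norm of \<open>\<xi>\<close> on \<open>{w < c}\<close> times the \<open>L\<^sup>2\<close> norm of \<open>f\<close>, and the first factor tends to 0 with \<open>\<epsilon>\<close> because the sets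
  \<open>{w < c}\<close> shrink to the null set \<open>{w = m}\<close>. On the other hand, in two dimensions the Sobolev inequality bounds the
  \<open>L\<^sup>2\<close> norm of \<open>f\<close> by \<open>TV f\<close> plus a multiple of the mean of \<open>f\<close>, and the mean is again a small multiple of the \<open>L\<^sup>2\<close> norm
  when \<open>{w < c}\<close> is small. Two is the critical exponent, so both estimates have the same homogeneity, and for small
  \<open>\<epsilon>\<close> they are compatible only if \<open>f = 0\<close>, that is, \<open>w \<ge> m + \<epsilon>\<close> almost everywhere. This contradicts the continuity
  of \<open>w\<close> at \<open>x\<^sub>0\<close> (\<open>null_minimum_set_gap\<close> and the theorem).

  Throughout, total variation is measured by \<open>L\<^sup>1\<close> norms of increments \<open>u(x + h e\<^sub>i) - u(x)\<close> as \<open>h \<rightarrow> 0\<close>. For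
  increments the splitting under truncation is a pointwise identity of real numbers (\<open>incr_max_split\<close>), and the Sobolev
  inequality becomes an inequality for finite double arrays (\<open>discrete_sobolev\<close>, \<open>sobolev_square\<close>). Increments are
  tied to the energies by duality with test functions: \<open>incr_variation_le\<close> and \<open>incr_tendsto_test\<close> for the total
  variation defined as a supremum, \<open>difference_quotient_L1_tendsto\<close> and \<open>weak_derivative_max\<close> for weak gradients.
  The two boundary conditions differ only in the points that may be shifted, in the place where a shifted point
  lands, and in the class of test functions.
\<close>

section \<open>Translations in \<open>L\<^sup>1\<close>\<close>

lemma lebesgue_distr_translation:
  "distr lebesgue lebesgue (\<lambda>x. a + x) = (lebesgue :: 'a::euclidean_space measure)"
proof -
  have "lebesgue = density (distr lebesgue lebesgue (\<lambda>x::'a. a + (\<Sum>j\<in>Basis. (1 * (x \<bullet> j)) *\<^sub>R j)))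
                     (\<lambda>_. (\<Prod>j\<in>(Basis::'a set). \<bar>1::real\<bar>))"
    by (rule lebesgue_affine_euclidean) auto
  then show ?thesis
    by (simp add: euclidean_representation density_1 flip: one_ennreal_def)
qed

lemma lebesgue_measurable_translation:
  "(\<lambda>x. a + x) \<in> lebesgue \<rightarrow>\<^sub>M (lebesgue :: 'a::euclidean_space measure)"
  using lebesgue_affine_measurable[of "\<lambda>_::'a. 1::real" a]
  by (simp add: euclidean_representation)

lemma integrable_translation:
  fixes f :: "'a::euclidean_space \<Rightarrow> real"
  assumes "integrable lebesgue f"
  shows "integrable lebesgue (\<lambda>x. f (x + a))"
  unfolding add.commute[of _ a]
  by (rule integrable_distr[OF lebesgue_measurable_translation]) (simp add: lebesgue_distr_translation assms)

lemma integral_translation: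
  fixes f :: "'a::euclidean_space \<Rightarrow> real"
  assumes "f \<in> borel_measurable lebesgue"
  shows "(LINT x|lebesgue. f (x + a)) = (LINT x|lebesgue. f x)"
  unfolding add.commute[of _ a] using integral_distr[OF lebesgue_measurable_translation assms]
  by (simp add: lebesgue_distr_translation)

lemma borel_measurable_translation:
  fixes f :: "'a::euclidean_space \<Rightarrow> real"
  assumes "f \<in> borel_measurable lebesgue"
  shows "(\<lambda>x. f (x + a)) \<in> borel_measurable lebesgue"
  unfolding add.commute[of _ a]
  using measurable_compose[OF lebesgue_measurable_translation[of a] assms] by simp

lemma lebesgue_measurable_continuous:
  fixes f :: "'a::euclidean_space \<Rightarrow> real"
  assumes "continuous_on UNIV f"
  shows "f \<in> borel_measurable lebesgue"
  using assms by (intro measurable_completion) (simp add: borel_measurable_continuous_onI)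

text \<open>
  Lebesgue measurable functions are almost everywhere limits of continuous ones; clipping the approximations at
  \<open>\<plusminus>B\<close> keeps the limit.
\<close>

lemma bounded_approx_continuous:
  fixes f :: "'a::euclidean_space \<Rightarrow> real"
  assumes "f \<in> borel_measurable lebesgue" and "\<And>x. \<bar>f x\<bar> \<le> B"
  obtains g where "\<And>n::nat. continuous_on UNIV (g n)" "\<And>n x. \<bar>g n x\<bar> \<le> B"
    "AE x in lebesgue. (\<lambda>n. g n x) \<longlonglongrightarrow> f x"
proof -
  have "f measurable_on UNIV"
    using assms(1) by (intro lebesgue_measurable_imp_measurable_on_real) auto
  then obtain N g where N: "negligible N" and g: "\<And>n::nat. continuous_on UNIV (g n)"
    and lim: "\<And>x. x \<notin> N \<Longrightarrow> (\<lambda>n. g n x) \<longlonglongrightarrow> f x"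
    unfolding measurable_on_def by auto
  have B: "0 \<le> B" using assms(2)[of undefined] by linarith
  show thesis
  proof
    show "continuous_on UNIV (\<lambda>x. max (-B) (min B (g n x)))" for n
      by (intro continuous_intros g)
    show "\<bar>max (-B) (min B (g n x))\<bar> \<le> B" for n x using B by auto
    have "(\<lambda>n. max (-B) (min B (g n x))) \<longlonglongrightarrow> f x" if "x \<notin> N" for x
    proof -
      have "(\<lambda>n. max (-B) (min B (g n x))) \<longlonglongrightarrow> max (-B) (min B (f x))"
        by (intro tendsto_intros lim that)
      moreover have "max (-B) (min B (f x)) = f x" using assms(2)[of x] by auto
      ultimately show ?thesis by simp
    qed
    moreover have "AE x in lebesgue. x \<notin> N"
      using N by (simp add: negligible_iff_null_sets AE_not_in)
    ultimately show "AE x in lebesgue. (\<lambda>n. max (-B) (min B (g n x))) \<longlonglongrightarrow> f x"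
      by (auto elim: eventually_mono)
  qed
qed

text \<open>
  Clipping \<open>f\<close> in value and in space makes it bounded with bounded support, so that the almost everywhere approximation
  of the clipped function by continuous functions, multiplied by a fixed cut-off, is dominated.
\<close>

lemma L1_approx_continuous:
  fixes f :: "'a::euclidean_space \<Rightarrow> real"
  assumes f: "integrable lebesgue f" and "e > 0"
  obtains g R B where "continuous_on UNIV g" "\<And>x. \<bar>g x\<bar> \<le> B" "\<And>x. norm x > R \<Longrightarrow> g x = 0"
    "integrable lebesgue g" "(LINT x|lebesgue. \<bar>f x - g x\<bar>) < e"
proof -
  have fm[measurable]: "f \<in> borel_measurable lebesgue" using f by auto
  \<comment> \<open>\<open>F k\<close> is \<open>f\<close> clipped at height \<open>k\<close> and radius \<open>k\<close>, \<open>\<theta>\<close> the cut-off around that ball.\<close>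
  define F where "F k x = indicat_real (cball 0 (real k)) x * max (- real k) (min (real k) (f x))" for k x
  have Fm[measurable]: "F k \<in> borel_measurable lebesgue" for k
    unfolding F_def by (intro borel_measurable_times borel_measurable_indicator borel_measurable_max
        borel_measurable_min fm) auto
  have "(\<lambda>k. LINT x|lebesgue. \<bar>f x - F k x\<bar>) \<longlonglongrightarrow> (LINT x|(lebesgue :: 'a measure). 0)"
  proof (rule integral_dominated_convergence[where w="\<lambda>x. \<bar>f x\<bar>"])
    show "integrable lebesgue (\<lambda>x. \<bar>f x\<bar>)" using f by auto
    show "AE x in lebesgue. norm \<bar>f x - F k x\<bar> \<le> \<bar>f x\<bar>" for k
      by (intro AE_I2) (auto simp: F_def indicator_def)
    show "AE x in lebesgue. (\<lambda>k. \<bar>f x - F k x\<bar>) \<longlonglongrightarrow> 0"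
    proof (intro AE_I2 tendsto_eventually)
      fix x
      obtain n :: nat where n: "max (norm x) \<bar>f x\<bar> \<le> n" using real_arch_simple by blast
      show "\<forall>\<^sub>F k in sequentially. \<bar>f x - F k x\<bar> = 0"
        using eventually_ge_at_top[of n]
      proof eventually_elim
        case (elim k)
        then have "norm x \<le> k" "\<bar>f x\<bar> \<le> k" using n by auto
        then show ?case by (auto simp: F_def)
      qed
    qed
  qed auto
  then have "\<forall>\<^sub>F k in sequentially. (LINT x|lebesgue. \<bar>f x - F k x\<bar>) < e/2"
    using \<open>e > 0\<close> by (intro order_tendstoD(2)) auto
  then obtain k where k: "(LINT x|lebesgue. \<bar>f x - F k x\<bar>) < e/2"
    by (auto simp: eventually_sequentially)
  have Fb: "\<bar>F k x\<bar> \<le> k" for x by (auto simp: F_def indicator_def)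
  obtain g :: "nat \<Rightarrow> 'a \<Rightarrow> real" where g: "\<And>n. continuous_on UNIV (g n)" "\<And>n x. \<bar>g n x\<bar> \<le> real k"
    "AE x in lebesgue. (\<lambda>n. g n x) \<longlonglongrightarrow> F k x"
    by (rule bounded_approx_continuous[OF Fm Fb]) (rule that)
  have gm[measurable]: "g n \<in> borel_measurable lebesgue" for n
    by (rule lebesgue_measurable_continuous[OF g(1)])
  define \<theta> where "\<theta> x = max 0 (min 1 (real k + 1 - norm x))" for x :: 'a
  have \<theta>c: "continuous_on UNIV \<theta>" unfolding \<theta>_def by (intro continuous_intros)
  have \<theta>m[measurable]: "\<theta> \<in> borel_measurable lebesgue"
    by (rule lebesgue_measurable_continuous[OF \<theta>c])
  define w where "w x = real k * indicat_real (cball 0 (real k + 1)) (x::'a)" for x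
  have wi: "integrable lebesgue w" unfolding w_def
    by (intro integrable_mult_right integrable_real_indicator)
       (auto simp: emeasure_lborel_cball_finite[unfolded infinity_ennreal_def])
  have bd: "\<bar>\<theta> x * g n x\<bar> \<le> w x" for n x
  proof (cases "norm x \<le> real k + 1")
    case True
    have "\<bar>\<theta> x * g n x\<bar> \<le> 1 * real k"
      unfolding abs_mult by (intro mult_mono g(2)) (auto simp: \<theta>_def)
    then show ?thesis using True by (simp add: w_def)
  qed (auto simp: \<theta>_def w_def)
  have gi: "integrable lebesgue (\<lambda>x. \<theta> x * g n x)" for n
    by (intro Bochner_Integration.integrable_bound[OF wi] AE_I2)
       (auto intro!: order_trans[OF bd abs_ge_self])
  have Fw: "\<bar>F k x\<bar> \<le> w x" for x by (auto simp: F_def w_def indicator_def)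
  have Fi: "integrable lebesgue (F k)"
    by (intro Bochner_Integration.integrable_bound[OF wi] AE_I2)
       (auto intro!: order_trans[OF Fw abs_ge_self])
  have "(\<lambda>n. LINT x|lebesgue. \<bar>F k x - \<theta> x * g n x\<bar>) \<longlonglongrightarrow> (LINT x|(lebesgue :: 'a measure). 0)"
  proof (rule integral_dominated_convergence[where w="\<lambda>x. 2 * w x"])
    show "integrable lebesgue (\<lambda>x. 2 * w x)" using wi by auto
    show "AE x in lebesgue. norm \<bar>F k x - \<theta> x * g n x\<bar> \<le> 2 * w x" for n
    proof (intro AE_I2)
      fix x :: 'a
      show "norm \<bar>F k x - \<theta> x * g n x\<bar> \<le> 2 * w x"
        using Fw[of x] bd[of x n] by auto
    qed
    show "AE x in lebesgue. (\<lambda>n. \<bar>F k x - \<theta> x * g n x\<bar>) \<longlonglongrightarrow> 0"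
      using g(3)
    proof eventually_elim
      case (elim x)
      have "(\<lambda>n. \<bar>F k x - \<theta> x * g n x\<bar>) \<longlonglongrightarrow> \<bar>F k x - \<theta> x * F k x\<bar>"
        by (intro tendsto_intros elim)
      moreover have "F k x - \<theta> x * F k x = 0"
        by (auto simp: F_def \<theta>_def indicator_def)
      ultimately show ?case by simp
    qed
  qed auto
  then have "\<forall>\<^sub>F n in sequentially. (LINT x|lebesgue. \<bar>F k x - \<theta> x * g n x\<bar>) < e/2"
    using \<open>e > 0\<close> by (intro order_tendstoD(2)) auto
  then obtain n where n: "(LINT x|lebesgue. \<bar>F k x - \<theta> x * g n x\<bar>) < e/2"
    by (auto simp: eventually_sequentially)
  show thesis
  proof
    show "continuous_on UNIV (\<lambda>x. \<theta> x * g n x)" by (intro continuous_intros \<theta>c g)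
    show "\<bar>\<theta> x * g n x\<bar> \<le> k" for x
      using order_trans[OF bd[of x n]] by (auto simp: w_def indicator_def)
    show "norm x > real k + 1 \<Longrightarrow> \<theta> x * g n x = 0" for x by (simp add: \<theta>_def)
    show "integrable lebesgue (\<lambda>x. \<theta> x * g n x)" by (rule gi)
    have "(LINT x|lebesgue. \<bar>f x - \<theta> x * g n x\<bar>) \<le>
        (LINT x|lebesgue. \<bar>f x - F k x\<bar> + \<bar>F k x - \<theta> x * g n x\<bar>)"
      using f gi Fi by (intro integral_mono) auto
    also have "\<dots> = (LINT x|lebesgue. \<bar>f x - F k x\<bar>) + (LINT x|lebesgue. \<bar>F k x - \<theta> x * g n x\<bar>)"
      using f gi Fi by (intro Bochner_Integration.integral_add) auto
    also have "\<dots> < e" using k n by simp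
    finally show "(LINT x|lebesgue. \<bar>f x - \<theta> x * g n x\<bar>) < e" .
  qed
qed

text \<open>
  Every smallness statement for increments below goes back to this fact. It holds for continuous functions of bounded
  support by dominated convergence, and the error of an \<open>L\<^sup>1\<close> approximation is invariant under translation.
\<close>

lemma L1_translation_continuous:
  fixes f :: "'a::euclidean_space \<Rightarrow> real"
  assumes f: "integrable lebesgue f"
  shows "((\<lambda>a. LINT x|lebesgue. \<bar>f (x + a) - f x\<bar>) \<longlongrightarrow> 0) (nhds 0)"
proof (rule tendstoI)
  fix e :: real assume "e > 0"
  have pos: "e / 3 > 0" using \<open>e > 0\<close> by simp
  obtain g :: "'a \<Rightarrow> real" and R B :: real where g: "continuous_on UNIV g" "\<And>x. \<bar>g x\<bar> \<le> B"
      "\<And>x. norm x > R \<Longrightarrow> g x = 0" "integrable lebesgue g" "(LINT x|lebesgue. \<bar>f x - g x\<bar>) < e/3"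
    by (rule L1_approx_continuous[OF f pos]) (rule that)
  have gm[measurable]: "g \<in> borel_measurable lebesgue" using g(4) by auto
  have fm[measurable]: "f \<in> borel_measurable lebesgue" using f by auto
  have B: "0 \<le> B" using g(2)[of undefined] by linarith
  have "((\<lambda>a. LINT x|lebesgue. \<bar>g (x + a) - g x\<bar>) \<longlongrightarrow> 0) (nhds 0)"
  proof -
    have "((\<lambda>a. LINT x|lebesgue. \<bar>g (x + a) - g x\<bar>) \<longlongrightarrow> 0) (at 0)"
      unfolding tendsto_at_iff_sequentially
    proof safe
      fix a :: "nat \<Rightarrow> 'a" assume a: "a \<longlonglongrightarrow> 0"
      then obtain r where r: "\<And>n. norm (a n) \<le> r"
        by (meson BseqE convergentI convergent_imp_Bseq)
      define w where "w x = 2 * B * indicat_real (cball 0 (R + r)) (x::'a)" for x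
      have wi: "integrable lebesgue w" unfolding w_def
        by (intro integrable_mult_right integrable_real_indicator)
           (auto simp: emeasure_lborel_cball_finite[unfolded infinity_ennreal_def])
      have "(\<lambda>n. LINT x|lebesgue. \<bar>g (x + a n) - g x\<bar>) \<longlonglongrightarrow> (LINT x|(lebesgue::'a measure). 0)"
      proof (rule integral_dominated_convergence[OF _ _ wi])
        show "(\<lambda>x. \<bar>g (x + a n) - g x\<bar>) \<in> borel_measurable lebesgue" for n
          using borel_measurable_translation[OF gm, of "a n"] by auto
        show "AE x in lebesgue. norm \<bar>g (x + a n) - g x\<bar> \<le> w x" for n
        proof (intro AE_I2)
          fix x :: 'a
          show "norm \<bar>g (x + a n) - g x\<bar> \<le> w x"
          proof (cases "norm x \<le> R + r")
            case True then show ?thesis using g(2)[of x] g(2)[of "x + a n"] by (auto simp: w_def)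
          next
            case False
            have "norm x \<le> norm (x + a n) + norm (a n)"
              using norm_triangle_ineq4[of "x + a n" "a n"] by simp
            moreover have "0 \<le> r" using r[of 0] norm_ge_zero order_trans by blast
            ultimately have "norm x > R" "norm (x + a n) > R" using False r[of n] by auto
            then show ?thesis using g(3) B by (auto simp: w_def)
          qed
        qed
        show "AE x in lebesgue. (\<lambda>n. \<bar>g (x + a n) - g x\<bar>) \<longlonglongrightarrow> 0"
        proof (intro AE_I2)
          fix x :: 'a
          have "isCont g x" using g(1) by (simp add: continuous_on_eq_continuous_at)
          moreover have "(\<lambda>n. x + a n) \<longlonglongrightarrow> x" using tendsto_add[OF tendsto_const a, of x] by simp
          ultimately have "(\<lambda>n. g (x + a n)) \<longlonglongrightarrow> g x" by (rule isCont_tendsto_compose)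
          then have "(\<lambda>n. \<bar>g (x + a n) - g x\<bar>) \<longlonglongrightarrow> \<bar>g x - g x\<bar>" by (intro tendsto_intros)
          then show "(\<lambda>n. \<bar>g (x + a n) - g x\<bar>) \<longlonglongrightarrow> 0" by simp
        qed
      qed auto
      then show "((\<lambda>a. LINT x|lebesgue. \<bar>g (x + a) - g x\<bar>) \<circ> a) \<longlonglongrightarrow> 0"
        by (simp add: o_def)
    qed
    then show ?thesis
      using tendsto_at_iff_tendsto_nhds[of "\<lambda>a. LINT x|lebesgue. \<bar>g (x + a) - g x\<bar>" "0::'a"] by simp
  qed
  then have "\<forall>\<^sub>F a in nhds 0. (LINT x|lebesgue. \<bar>g (x + a) - g x\<bar>) < e/3"
    using \<open>e > 0\<close> by (intro order_tendstoD(2)) auto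
  then show "\<forall>\<^sub>F a in nhds 0. dist (LINT x|lebesgue. \<bar>f (x + a) - f x\<bar>) 0 < e"
  proof eventually_elim
    case (elim a)
    have fa: "integrable lebesgue (\<lambda>x. f (x + a))" and ga: "integrable lebesgue (\<lambda>x. g (x + a))"
      using integrable_translation f g(4) by auto
    have "(LINT x|lebesgue. \<bar>f (x + a) - f x\<bar>) \<le>
      (LINT x|lebesgue. \<bar>f (x + a) - g (x + a)\<bar> + (\<bar>g (x + a) - g x\<bar> + \<bar>f x - g x\<bar>))"
      using f g(4) fa ga by (intro integral_mono) auto
    also have "\<dots> = (LINT x|lebesgue. \<bar>f (x + a) - g (x + a)\<bar>)
        + ((LINT x|lebesgue. \<bar>g (x + a) - g x\<bar>) + (LINT x|lebesgue. \<bar>f x - g x\<bar>))"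
      using f g(4) fa ga by (simp add: Bochner_Integration.integral_add)
    also have "(LINT x|lebesgue. \<bar>f (x + a) - g (x + a)\<bar>) = (LINT x|lebesgue. \<bar>f x - g x\<bar>)"
      by (rule integral_translation[where f="\<lambda>x. \<bar>f x - g x\<bar>"]) auto
    finally have "(LINT x|lebesgue. \<bar>f (x + a) - f x\<bar>) < e" using g(5) elim by linarith
    moreover have "0 \<le> (LINT x|lebesgue. \<bar>f (x + a) - f x\<bar>)" by simp
    ultimately show ?case by simp
  qed
qed

section \<open>A Sobolev inequality on the square\<close>

lemma square_eq_box: "square L = box (vec (- L)) (vec L)"
  by (auto simp: square_def mem_box_cart)

lemma square_open: "open (square L)"
  by (simp only: square_eq_box open_box)

lemma prod_UNIV_2: "prod f (UNIV :: 2 set) = f 1 * f 2"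
  by (simp add: UNIV_2)

text \<open>
  An entry differs from any other one by at most the sum of the successive differences; average over the other one.
\<close>

lemma discrete_sup_bound:
  fixes b :: "nat \<Rightarrow> real"
  assumes "j < N"
  shows "b j \<le> (\<Sum>i<N. b i) / N + (\<Sum>i<N-1. \<bar>b (Suc i) - b i\<bar>)"
proof -
  let ?V = "\<Sum>i<N-1. \<bar>b (Suc i) - b i\<bar>"
  have *: "\<bar>b q - b p\<bar> \<le> ?V" if "p \<le> q" "q < N" for p q
  proof -
    have "b q - b p = (\<Sum>i=p..<q. b (Suc i) - b i)"
      using sum_Suc_diff'[OF that(1), of b] by simp
    then have "\<bar>b q - b p\<bar> \<le> (\<Sum>i=p..<q. \<bar>b (Suc i) - b i\<bar>)"
      by (simp add: sum_abs)
    also have "\<dots> \<le> ?V"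
      using that by (intro sum_mono2) auto
    finally show ?thesis .
  qed
  have "b j - b i \<le> ?V" if "i < N" for i
    using *[of i j] *[of j i] that assms by (cases "i \<le> j") auto
  then have "(\<Sum>i<N. b j - b i) \<le> (\<Sum>i<N. ?V)"
    by (intro sum_mono) auto
  then have "N * b j \<le> (\<Sum>i<N. b i) + N * ?V"
    by (simp add: sum_subtractf)
  then show ?thesis using assms by (simp add: field_simps)
qed

text \<open>
  The argument of Gagliardo and Nirenberg for arrays: by the previous lemma an entry is bounded by a quantity depending on
  its second index only, and by one depending on its first index only, so the sum of the products of the two factorises.
\<close>

lemma discrete_sobolev:
  fixes a :: "nat \<Rightarrow> nat \<Rightarrow> real"
  assumes nn: "\<And>j k. 0 \<le> a j k"
  shows "(\<Sum>j<N. \<Sum>k<N. (a j k)\<^sup>2) \<le>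
     ((\<Sum>j<N. \<Sum>k<N. a j k) / N + (\<Sum>k<N. \<Sum>j<N-1. \<bar>a (Suc j) k - a j k\<bar>)) *
     ((\<Sum>j<N. \<Sum>k<N. a j k) / N + (\<Sum>j<N. \<Sum>k<N-1. \<bar>a j (Suc k) - a j k\<bar>))"
proof -
  define A where "A k = (\<Sum>j<N. a j k) / N + (\<Sum>j<N-1. \<bar>a (Suc j) k - a j k\<bar>)" for k
  define B where "B j = (\<Sum>k<N. a j k) / N + (\<Sum>k<N-1. \<bar>a j (Suc k) - a j k\<bar>)" for j
  have "(\<Sum>j<N. \<Sum>k<N. (a j k)\<^sup>2) \<le> (\<Sum>j<N. \<Sum>k<N. B j * A k)"
  proof (intro sum_mono)
    fix j k assume "j \<in> {..<N}" "k \<in> {..<N}"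
    then have "a j k \<le> A k" "a j k \<le> B j"
      using discrete_sup_bound[of j N "\<lambda>j. a j k"] discrete_sup_bound[of k N "a j"]
      by (auto simp: A_def B_def)
    then show "(a j k)\<^sup>2 \<le> B j * A k"
      unfolding power2_eq_square using nn[of j k] by (intro mult_mono) auto
  qed
  also have "\<dots> = sum B {..<N} * sum A {..<N}"
    by (simp add: sum_product)
  also have "\<dots> = sum A {..<N} * sum B {..<N}" by (rule mult.commute)
  also have "sum A {..<N} = (\<Sum>j<N. \<Sum>k<N. a j k) / N + (\<Sum>k<N. \<Sum>j<N-1. \<bar>a (Suc j) k - a j k\<bar>)"
    unfolding A_def sum.distrib sum_divide_distrib[symmetric] by (subst sum.swap) simp
  also have "sum B {..<N} = (\<Sum>j<N. \<Sum>k<N. a j k) / N + (\<Sum>j<N. \<Sum>k<N-1. \<bar>a j (Suc k) - a j k\<bar>)"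
    unfolding B_def sum.distrib sum_divide_distrib[symmetric] by simp
  finally show ?thesis .
qed

text \<open>
  The cells of a grid of mesh \<open>h\<close> with origin at the corner \<open>(-L, -L)\<close>. They are half-open so that they are disjoint and
  translation by \<open>h\<close> along an axis carries a cell exactly onto its neighbour; the edges \<open>x\<^sub>i = -L\<close> that are thereby added
  to the open square are null sets.
\<close>

definition cell :: "real \<Rightarrow> real \<Rightarrow> nat \<times> nat \<Rightarrow> (real ^ 2) set" where
  "cell L h p = {x. - L + real (fst p) * h \<le> x $ 1 \<and> x $ 1 < - L + real (Suc (fst p)) * h \<and>
                    - L + real (snd p) * h \<le> x $ 2 \<and> x $ 2 < - L + real (Suc (snd p)) * h}"

lemma measure_cell:
  assumes "h > 0"
  shows "cell L h p \<in> lmeasurable" "measure lebesgue (cell L h p) = h\<^sup>2"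
proof -
  define a b :: "real ^ 2" where "a = (\<chi> i. if i = 1 then - L + real (fst p) * h else - L + real (snd p) * h)"
    and "b = (\<chi> i. if i = 1 then - L + real (Suc (fst p)) * h else - L + real (Suc (snd p)) * h)"
  have le: "a $ i \<le> b $ i" for i using assms by (auto simp: a_def b_def algebra_simps)
  have sub: "box a b \<subseteq> cell L h p" "cell L h p \<subseteq> cbox a b"
    by (auto simp: a_def b_def cell_def mem_box_cart forall_2)
  have neg: "negligible (cbox a b - cell L h p)"
    using negligible_subset[OF negligible_frontier_interval[of a b]] sub(1) by blast
  show "cell L h p \<in> lmeasurable"
    using fmeasurable.Diff[OF lmeasurable_cbox[of a b] negligible_imp_measurable[OF neg]]
    unfolding double_diff[OF sub(2) subset_refl] .
  have "measure lebesgue (cell L h p) = measure lebesgue (cbox a b)"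
    using neg sub(2) by (intro measure_negligible_symdiff) (auto simp: Un_absorb1 Diff_eq_empty_iff[THEN iffD2])
  also have "\<dots> = measure lborel (cbox a b)" by simp
  also have "\<dots> = (\<Prod>i\<in>UNIV. b $ i - a $ i)"
    using le by (subst content_cbox_cart) (auto simp: interval_ne_empty_cart)
  also have "\<dots> = h\<^sup>2"
    by (simp add: prod_UNIV_2 a_def b_def algebra_simps power2_eq_square)
  finally show "measure lebesgue (cell L h p) = h\<^sup>2" .
qed

lemma integrable_indicator_mult:
  assumes "A \<in> sets M" "integrable M (f :: _ \<Rightarrow> real)"
  shows "integrable M (\<lambda>x. indicat_real A x * f x)"
  using integrable_mult_indicator[OF assms] by simp

lemma integral_indicator_mult_sum:
  assumes "finite P" "disjoint_family_on C P" "\<And>p. p \<in> P \<Longrightarrow> C p \<in> sets M"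
    and "integrable M (g :: _ \<Rightarrow> real)"
  shows "(\<Sum>p\<in>P. LINT x|M. indicat_real (C p) x * g x) = (LINT x|M. indicat_real (\<Union>p\<in>P. C p) x * g x)"
proof -
  have "(\<Sum>p\<in>P. LINT x|M. indicat_real (C p) x * g x) = (LINT x|M. (\<Sum>p\<in>P. indicat_real (C p) x * g x))"
    using assms by (intro Bochner_Integration.integral_sum[symmetric])
      (auto intro: integrable_indicator_mult)
  also have "\<dots> = (LINT x|M. indicat_real (\<Union>p\<in>P. C p) x * g x)"
    by (simp add: indicator_UN_disjoint[OF assms(1,2)] sum_distrib_right)
  finally show ?thesis .
qed

lemma cell_index_unique:
  assumes h: "(h::real) > 0" and "c + real m * h \<le> y" "y < c + real (Suc m) * h"
    and "c + real n * h \<le> y" "y < c + real (Suc n) * h"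
  shows "m = n"
proof -
  have "real m * h < real (Suc n) * h" "real n * h < real (Suc m) * h" using assms by linarith+
  then show ?thesis using h by (simp del: of_nat_Suc)
qed

lemma cell_index_exists:
  assumes h: "(h::real) > 0" and "c \<le> y" "y < c + real N * h"
  obtains m where "m < N" "c + real m * h \<le> y" "y < c + real (Suc m) * h"
proof
  define m where "m = nat \<lfloor>(y - c) / h\<rfloor>"
  have nn: "0 \<le> (y - c) / h" using assms by simp
  then have r: "real m = of_int \<lfloor>(y - c) / h\<rfloor>" by (simp add: m_def)
  have "real m \<le> (y - c) / h" "(y - c) / h < real m + 1" unfolding r by linarith+
  then show 1: "c + real m * h \<le> y" "y < c + real (Suc m) * h"
    using h by (auto simp: field_simps)
  have "real m * h < real N * h" using 1 assms by linarith
  then show "m < N" using h by simp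
qed

lemma disjoint_cells: "h > 0 \<Longrightarrow> disjoint_family_on (cell L h) P"
proof -
  assume h: "h > 0"
  have "p = q" if "x \<in> cell L h p" "x \<in> cell L h q" for x p q
  proof -
    have "fst p = fst q" by (rule cell_index_unique[OF h, of "-L" _ "x $ 1"]) (use that in \<open>auto simp: cell_def\<close>)
    moreover have "snd p = snd q" by (rule cell_index_unique[OF h, of "-L" _ "x $ 2"]) (use that in \<open>auto simp: cell_def\<close>)
    ultimately show ?thesis by (simp add: prod_eq_iff)
  qed
  then show ?thesis by (auto simp: disjoint_family_on_def)
qed

lemma Union_cells:
  assumes "h > 0"
  shows "(\<Union>p\<in>{..<m}\<times>{..<n}. cell L h p) =
     {x. - L \<le> x $ 1 \<and> x $ 1 < - L + real m * h \<and> - L \<le> x $ 2 \<and> x $ 2 < - L + real n * h}" (is "?U = ?R")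
proof
  show "?U \<subseteq> ?R"
  proof
    fix x assume "x \<in> ?U"
    then obtain j k where jk: "j < m" "k < n" "x \<in> cell L h (j,k)" by auto
    have "real (Suc j) * h \<le> real m * h" "real (Suc k) * h \<le> real n * h"
      using jk assms by (auto intro!: mult_right_mono)
    moreover have "0 \<le> real j * h" "0 \<le> real k * h" using assms by auto
    ultimately show "x \<in> ?R" using jk(3) unfolding cell_def mem_Collect_eq fst_conv snd_conv by linarith
  qed
  show "?R \<subseteq> ?U"
  proof
    fix x assume x: "x \<in> ?R"
    obtain j where j: "j < m" "- L + real j * h \<le> x $ 1" "x $ 1 < - L + real (Suc j) * h"
      by (rule cell_index_exists[OF assms, of "-L" "x $ 1" m]) (use x in auto)
    obtain k where k: "k < n" "- L + real k * h \<le> x $ 2" "x $ 2 < - L + real (Suc k) * h"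
      by (rule cell_index_exists[OF assms, of "-L" "x $ 2" n]) (use x in auto)
    show "x \<in> ?U" using j k by (intro UN_I[of "(j,k)"]) (auto simp: cell_def)
  qed
qed

lemma AE_coordinate_neq: "AE x in lebesgue. (x :: real ^ 2) $ i \<noteq> c"
proof -
  have "negligible {x :: real ^ 2. x \<bullet> axis i 1 = c}"
    by (rule negligible_standard_hyperplane) (simp add: axis_in_Basis_iff)
  then have "negligible {x :: real ^ 2. x $ i = c}" by (simp add: inner_axis)
  then have "{x :: real ^ 2. x $ i = c} \<in> null_sets lebesgue"
    by (simp add: negligible_iff_null_sets)
  from AE_not_in[OF this] have "AE x in lebesgue. x \<notin> {x :: real ^ 2. x $ i = c}" .
  then show ?thesis by simp
qed

text \<open>
  The integrals of \<open>f\<close> over neighbouring cells differ by an integral of the increment \<open>f(x + h e\<^sub>i) - f(x)\<close> over one of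
  them. Here \<open>s\<close> maps the index of a cell to that of its neighbour, and \<open>C\<close> is the union of the cells that have one.
\<close>

lemma square_translation_cells:
  fixes f :: "real ^ 2 \<Rightarrow> real"
  assumes h: "h > 0" and L: "L > 0" and f: "integrable lebesgue f" and f0: "\<And>x. x \<notin> square L \<Longrightarrow> f x = 0"
    and P: "finite P" "C = (\<Union>p\<in>P. cell L h p)"
    and C: "\<And>x. x \<in> C \<Longrightarrow> \<forall>k. - L \<le> x $ k \<and> x $ k < L \<and> - L \<le> (x + axis i h) $ k \<and> (x + axis i h) $ k < L"
    and s: "\<And>p x. p \<in> P \<Longrightarrow> x + axis i h \<in> cell L h (s p) \<longleftrightarrow> x \<in> cell L h p"
  shows "(\<Sum>p\<in>P. \<bar>(LINT x|lebesgue. indicat_real (cell L h (s p)) x * f x)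
             - (LINT x|lebesgue. indicat_real (cell L h p) x * f x)\<bar>)
    \<le> (LINT x|lebesgue. indicat_real {x \<in> square L. x + axis i h \<in> square L} x * \<bar>f (x + axis i h) - f x\<bar>)"
proof -
  have [measurable]: "cell L h p \<in> sets lebesgue" for p
    using measure_cell(1)[OF h] by (simp add: fmeasurableD)
  have fT: "integrable lebesgue (\<lambda>x. f (x + axis i h))" by (rule integrable_translation[OF f])
  have int: "integrable lebesgue (\<lambda>x. indicat_real (cell L h p) x * g x)" if "integrable lebesgue g" for p g
    using that by (rule integrable_indicator_mult[rotated]) simp
  have "\<bar>(LINT x|lebesgue. indicat_real (cell L h (s p)) x * f x)
             - (LINT x|lebesgue. indicat_real (cell L h p) x * f x)\<bar>
    \<le> (LINT x|lebesgue. indicat_real (cell L h p) x * \<bar>f (x + axis i h) - f x\<bar>)" if p: "p \<in> P" for p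
  proof -
    have "(LINT x|lebesgue. indicat_real (cell L h (s p)) x * f x) =
      (LINT x|lebesgue. indicat_real (cell L h (s p)) (x + axis i h) * f (x + axis i h))"
      using int[OF f] by (intro integral_translation[symmetric]) auto
    also have "\<dots> = (LINT x|lebesgue. indicat_real (cell L h p) x * f (x + axis i h))"
      using s[OF p] by (simp add: indicator_def)
    finally have "(LINT x|lebesgue. indicat_real (cell L h (s p)) x * f x)
             - (LINT x|lebesgue. indicat_real (cell L h p) x * f x) =
        (LINT x|lebesgue. indicat_real (cell L h p) x * (f (x + axis i h) - f x))"
      using int[OF f] int[OF fT] by (simp add: right_diff_distrib)
    also have "\<bar>\<dots>\<bar> \<le> (LINT x|lebesgue. \<bar>indicat_real (cell L h p) x * (f (x + axis i h) - f x)\<bar>)"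
      by (rule integral_abs_bound)
    finally show ?thesis by (simp add: abs_mult)
  qed
  then have "(\<Sum>p\<in>P. \<bar>(LINT x|lebesgue. indicat_real (cell L h (s p)) x * f x)
             - (LINT x|lebesgue. indicat_real (cell L h p) x * f x)\<bar>)
    \<le> (\<Sum>p\<in>P. LINT x|lebesgue. indicat_real (cell L h p) x * \<bar>f (x + axis i h) - f x\<bar>)"
    by (intro sum_mono) auto
  also have "\<dots> = (LINT x|lebesgue. indicat_real C x * \<bar>f (x + axis i h) - f x\<bar>)"
    unfolding P(2) using f fT by (intro integral_indicator_mult_sum P disjoint_cells h) auto
  also have "\<dots> \<le> (LINT x|lebesgue. indicat_real {x \<in> square L. x + axis i h \<in> square L} x * \<bar>f (x + axis i h) - f x\<bar>)"
  proof (rule integral_mono_AE)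
    have Cm: "C \<in> sets lebesgue" using P by auto
    have sm: "square L \<in> sets lebesgue" using square_open by auto
    have "(\<lambda>x. x + axis i h) -` square L \<in> sets lebesgue"
    proof -
      have "open ((\<lambda>x. x + axis i h) -` square L)"
        by (intro open_vimage square_open continuous_intros)
      then show ?thesis by auto
    qed
    then have Am: "{x \<in> square L. x + axis i h \<in> square L} \<in> sets lebesgue"
      using sets.Int[OF sm] by (simp add: Collect_conj_eq vimage_def)
    have d: "integrable lebesgue (\<lambda>x. \<bar>f (x + axis i h) - f x\<bar>)" using f fT by auto
    show "integrable lebesgue (\<lambda>x. indicat_real C x * \<bar>f (x + axis i h) - f x\<bar>)"
      by (rule integrable_indicator_mult[OF Cm d])
    show "integrable lebesgue (\<lambda>x. indicat_real {x \<in> square L. x + axis i h \<in> square L} x * \<bar>f (x + axis i h) - f x\<bar>)"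
      by (rule integrable_indicator_mult[OF Am d])
    show "AE x in lebesgue. indicat_real C x * \<bar>f (x + axis i h) - f x\<bar>
       \<le> indicat_real {x \<in> square L. x + axis i h \<in> square L} x * \<bar>f (x + axis i h) - f x\<bar>"
      using AE_coordinate_neq[of i "-L"]
    proof eventually_elim
      case (elim x)
      show ?case
      proof (cases "x \<in> C \<and> f (x + axis i h) \<noteq> f x")
        case True
        have b: "- L \<le> x $ k" "x $ k < L" "- L \<le> (x + axis i h) $ k" "(x + axis i h) $ k < L" for k
          using C True by auto
        have "x \<in> square L \<or> x + axis i h \<in> square L" using True f0 by metis
        \<comment> \<open>Only the lower edge normal to the shift is a problem, and it has been excluded as a null set.\<close>
        then have "- L < x $ k" for k
          using elim b(1)[of k] by (cases "k = i") (auto simp: square_def axis_def dest!: spec[of _ k])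
        then have "x \<in> square L" "x + axis i h \<in> square L"
          using b h unfolding square_def by (auto simp: axis_def less_le_not_le add_pos_pos split: if_splits)
             (smt (verit))+
        then show ?thesis by (auto simp: indicator_def)
      qed (auto simp: indicator_def)
    qed
  qed
  finally show ?thesis .
qed

text \<open>
  Replacing \<open>f\<close> by its average \<open>a\<close> on a cell loses \<open>\<integral>\<^sub>C f (f - a)\<close> of the integral of \<open>f\<^sup>2\<close>. As \<open>\<bar>f\<bar> \<le> B\<close>, it suffices to
  estimate \<open>\<integral>\<^sub>C \<bar>f - a\<bar>\<close>, and this is small if \<open>f\<close> is \<open>L\<^sup>1\<close>-close to a function \<open>g\<close> of small oscillation on the cell.
\<close>

lemma cell_average_error:
  fixes f :: "real ^ 2 \<Rightarrow> real"
  assumes h: "h > 0" and f: "integrable lebesgue f" and f2: "integrable lebesgue (\<lambda>x. (f x)\<^sup>2)"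
    and B: "\<And>x. \<bar>f x\<bar> \<le> B" and g: "integrable lebesgue g"
    and osc: "\<And>x y. x \<in> cell L h p \<Longrightarrow> y \<in> cell L h p \<Longrightarrow> \<bar>g x - g y\<bar> \<le> \<eta>"
  defines "C \<equiv> cell L h p" and "a \<equiv> (LINT x|lebesgue. indicat_real (cell L h p) x * f x) / h\<^sup>2"
  shows "(LINT x|lebesgue. indicat_real C x * (f x)\<^sup>2)
     \<le> h\<^sup>2 * a\<^sup>2 + B * (2 * (LINT x|lebesgue. indicat_real C x * \<bar>f x - g x\<bar>) + \<eta> * h\<^sup>2)"
proof -
  have Cm: "C \<in> sets lebesgue" and Cl: "C \<in> lmeasurable" and mC: "measure lebesgue C = h\<^sup>2"
    using measure_cell[OF h, of L p] by (auto simp: C_def fmeasurableD)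
  have int: "integrable lebesgue (\<lambda>x. indicat_real C x * q x)" if "integrable lebesgue q" for q
    by (rule integrable_indicator_mult[OF Cm that])
  have intc: "integrable lebesgue (\<lambda>x. indicat_real C x * c)" for c :: real
    using Cl by (intro integrable_mult_left) (auto simp: fmeasurable_def less_top[symmetric])
  have Ic: "(LINT x|lebesgue. indicat_real C x * c) = h\<^sup>2 * c" for c :: real
    using Cm mC by simp
  define D where "D = (LINT x|lebesgue. indicat_real C x * \<bar>f x - g x\<bar>)"
  have af: "h\<^sup>2 * a = (LINT x|lebesgue. indicat_real C x * f x)"
    using h by (simp add: a_def C_def)
  have g_a: "h\<^sup>2 * \<bar>g x - a\<bar> \<le> D + \<eta> * h\<^sup>2" if x: "x \<in> C" for x
  proof -
    have "h\<^sup>2 * (g x - a) = (LINT y|lebesgue. indicat_real C y * g x) - (LINT y|lebesgue. indicat_real C y * f y)"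
      by (simp only: right_diff_distrib af Ic)
    also have "\<dots> = (LINT y|lebesgue. indicat_real C y * g x - indicat_real C y * f y)"
      by (intro Bochner_Integration.integral_diff[symmetric] intc int f)
    finally have eq: "h\<^sup>2 * (g x - a) = (LINT y|lebesgue. indicat_real C y * g x - indicat_real C y * f y)" .
    have "\<bar>h\<^sup>2 * (g x - a)\<bar> \<le> (LINT y|lebesgue. \<bar>indicat_real C y * g x - indicat_real C y * f y\<bar>)"
      unfolding eq by (rule integral_abs_bound)
    also have "\<dots> \<le> (LINT y|lebesgue. indicat_real C y * \<bar>f y - g y\<bar> + indicat_real C y * \<eta>)"
    proof (rule integral_mono)
      show "integrable lebesgue (\<lambda>y. \<bar>indicat_real C y * g x - indicat_real C y * f y\<bar>)"
        using intc int f by auto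
      show "integrable lebesgue (\<lambda>y. indicat_real C y * \<bar>f y - g y\<bar> + indicat_real C y * \<eta>)"
        using f g by (intro Bochner_Integration.integrable_add intc int) auto
      show "\<bar>indicat_real C y * g x - indicat_real C y * f y\<bar>
         \<le> indicat_real C y * \<bar>f y - g y\<bar> + indicat_real C y * \<eta>" for y
        using osc[of x y] x unfolding C_def[symmetric] by (auto simp: indicator_def)
    qed
    also have "\<dots> = D + (LINT y|lebesgue. indicat_real C y * \<eta>)"
      unfolding D_def using f g by (intro Bochner_Integration.integral_add intc int) auto
    also have "\<dots> = D + \<eta> * h\<^sup>2" unfolding Ic by simp
    finally show ?thesis by (simp add: abs_mult)
  qed
  have B0: "0 \<le> B" using B[of undefined] by linarith
  have "(LINT x|lebesgue. indicat_real C x * (f x)\<^sup>2) - h\<^sup>2 * a\<^sup>2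
      = (LINT x|lebesgue. indicat_real C x * (f x)\<^sup>2) - (LINT x|lebesgue. a * (indicat_real C x * f x))"
    using af by (simp add: power2_eq_square)
  also have "\<dots> = (LINT x|lebesgue. indicat_real C x * (f x)\<^sup>2 - a * (indicat_real C x * f x))"
    using f f2 by (intro Bochner_Integration.integral_diff[symmetric] integrable_mult_right int)
  also have "\<dots> \<le> (LINT x|lebesgue. B * (indicat_real C x * \<bar>f x - g x\<bar> + indicat_real C x * ((D + \<eta> * h\<^sup>2) / h\<^sup>2)))"
  proof (rule integral_mono)
    show "integrable lebesgue (\<lambda>x. indicat_real C x * (f x)\<^sup>2 - a * (indicat_real C x * f x))"
      using f f2 by (intro Bochner_Integration.integrable_diff integrable_mult_right int)
    show "integrable lebesgue (\<lambda>x. B * (indicat_real C x * \<bar>f x - g x\<bar> + indicat_real C x * ((D + \<eta> * h\<^sup>2) / h\<^sup>2)))"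
      using f g by (intro integrable_mult_right Bochner_Integration.integrable_add intc int) auto
    fix x
    show "indicat_real C x * (f x)\<^sup>2 - a * (indicat_real C x * f x)
       \<le> B * (indicat_real C x * \<bar>f x - g x\<bar> + indicat_real C x * ((D + \<eta> * h\<^sup>2) / h\<^sup>2))"
    proof (cases "x \<in> C")
      case True
      have "\<bar>g x - a\<bar> \<le> (D + \<eta> * h\<^sup>2) / h\<^sup>2"
        using g_a[OF True] h by (simp add: field_simps)
      then have "\<bar>f x - a\<bar> \<le> \<bar>f x - g x\<bar> + (D + \<eta> * h\<^sup>2) / h\<^sup>2" by linarith
      then have "\<bar>f x\<bar> * \<bar>f x - a\<bar> \<le> B * (\<bar>f x - g x\<bar> + (D + \<eta> * h\<^sup>2) / h\<^sup>2)"
        using B B0 by (intro mult_mono) auto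
      moreover have "(f x)\<^sup>2 - a * f x \<le> \<bar>f x\<bar> * \<bar>f x - a\<bar>"
        unfolding abs_mult[symmetric] by (auto simp: power2_eq_square algebra_simps intro: abs_ge_self order_trans[OF _ abs_ge_self])
      ultimately show ?thesis using True by simp
    qed simp
  qed
  also have "\<dots> = B * (LINT x|lebesgue. indicat_real C x * \<bar>f x - g x\<bar> + indicat_real C x * ((D + \<eta> * h\<^sup>2) / h\<^sup>2))"
    by (rule integral_mult_right_zero)
  also have "(LINT x|lebesgue. indicat_real C x * \<bar>f x - g x\<bar> + indicat_real C x * ((D + \<eta> * h\<^sup>2) / h\<^sup>2))
      = D + (LINT x|lebesgue. indicat_real C x * ((D + \<eta> * h\<^sup>2) / h\<^sup>2))"
    unfolding D_def using f g by (intro Bochner_Integration.integral_add intc int) auto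
  also have "(LINT x|lebesgue. indicat_real C x * ((D + \<eta> * h\<^sup>2) / h\<^sup>2)) = D + \<eta> * h\<^sup>2"
    unfolding Ic using h by simp
  finally show ?thesis by (simp add: D_def algebra_simps)
qed

text \<open>
  The square integral of \<open>f\<close> is recovered from its cell averages in the limit of small cells: sum the previous estimate
  over all cells with a continuous \<open>g\<close>.
\<close>

lemma cell_averages_L2:
  fixes f :: "real ^ 2 \<Rightarrow> real"
  assumes L: "L > 0" and f: "integrable lebesgue f" and f2: "integrable lebesgue (\<lambda>x. (f x)\<^sup>2)"
    and B: "\<And>x. \<bar>f x\<bar> \<le> B" and f0: "\<forall>x. x \<notin> square L \<longrightarrow> f x = 0" and e: "e > 0"
  shows "\<forall>\<^sub>F N in sequentially. (LINT x|lebesgue. (f x)\<^sup>2) \<le>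
     (\<Sum>p\<in>{..<N}\<times>{..<N}. (2 * L / real N)\<^sup>2 *
        ((LINT x|lebesgue. indicat_real (cell L (2 * L / real N) p) x * f x) / (2 * L / real N)\<^sup>2)\<^sup>2) + e"
proof -
  have B0: "0 \<le> B" using B[of undefined] by linarith
  define \<eta> where "\<eta> = e / (2 * (B + 1) * (2 * L)\<^sup>2)"
  have \<eta>: "\<eta> > 0" using e L B0 by (simp add: \<eta>_def)
  have pos: "e / (4 * (B + 1)) > 0" using e B0 by simp
  obtain g :: "real ^ 2 \<Rightarrow> real" and R B' :: real where g: "continuous_on UNIV g" "\<And>x. \<bar>g x\<bar> \<le> B'"
      "\<And>x. norm x > R \<Longrightarrow> g x = 0" "integrable lebesgue g"
      "(LINT x|lebesgue. \<bar>f x - g x\<bar>) < e / (4 * (B + 1))"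
    by (rule L1_approx_continuous[OF f pos]) (rule that)
  have "uniformly_continuous_on (cbox (vec (-L)) (vec L)) g"
    by (intro compact_uniformly_continuous continuous_on_subset[OF g(1)]) auto
  then obtain d where d: "d > 0" "\<And>x y. x \<in> cbox (vec (-L)) (vec L) \<Longrightarrow> y \<in> cbox (vec (-L)) (vec L) \<Longrightarrow>
      dist y x < d \<Longrightarrow> dist (g y) (g x) < \<eta>"
    using \<eta> unfolding uniformly_continuous_on_def by metis
  have "(\<lambda>N. 4 * L / real N) \<longlonglongrightarrow> 0" by (rule lim_const_over_n)
  then have "\<forall>\<^sub>F N in sequentially. 4 * L / real N < d" using d by (intro order_tendstoD(2)) auto
  then show ?thesis using eventually_gt_at_top[of 0]
  proof eventually_elim
    case (elim N)
    define h where "h = 2 * L / real N"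
    have h: "h > 0" using L elim by (simp add: h_def)
    have Nh: "- L + real N * h = L" using elim by (simp add: h_def)
    define P where "P = {..<N}\<times>{..<N}"
    define a where "a p = (LINT x|lebesgue. indicat_real (cell L h p) x * f x) / h\<^sup>2" for p
    have U: "(\<Union>p\<in>P. cell L h p) = {x. - L \<le> x $ 1 \<and> x $ 1 < L \<and> - L \<le> x $ 2 \<and> x $ 2 < L}"
      unfolding P_def Union_cells[OF h] Nh ..
    have sq: "x \<in> (\<Union>p\<in>P. cell L h p)" if "x \<in> square L" for x
      using that unfolding U by (auto simp: square_def forall_2 less_imp_le)
    have cm: "cell L h p \<in> sets lebesgue" for p using measure_cell(1)[OF h] by (simp add: fmeasurableD)
    have P: "finite P" by (simp add: P_def)
    have osc: "\<bar>g x - g y\<bar> \<le> \<eta>" if p: "p \<in> P" and x: "x \<in> cell L h p" and y: "y \<in> cell L h p" for x y p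
    proof -
      have "x \<in> (\<Union>p\<in>P. cell L h p)" "y \<in> (\<Union>p\<in>P. cell L h p)" using p x y by auto
      then have "x \<in> cbox (vec (-L)) (vec L)" "y \<in> cbox (vec (-L)) (vec L)"
        unfolding U by (auto simp: mem_box_cart forall_2)
      moreover have "dist y x < d"
      proof -
        have "\<bar>(y - x) $ i\<bar> \<le> h" for i
          using x y exhaust_2[of i] by (auto simp: cell_def algebra_simps)
        then have "norm (y - x) \<le> (\<Sum>i\<in>(UNIV::2 set). h)"
          by (intro order_trans[OF norm_le_l1_cart] sum_mono)
        also have "\<dots> = 4 * L / real N" by (simp add: h_def)
        finally show ?thesis using elim by (simp add: dist_norm)
      qed
      ultimately have "dist (g y) (g x) < \<eta>" using d by blast
      then show ?thesis by (simp add: dist_real_def abs_minus_commute)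
    qed
    have fU: "indicat_real (\<Union>p\<in>P. cell L h p) x * (f x)\<^sup>2 = (f x)\<^sup>2" for x
      using sq[of x] f0 by (cases "x \<in> square L") auto
    have "(LINT x|lebesgue. (f x)\<^sup>2) = (\<Sum>p\<in>P. LINT x|lebesgue. indicat_real (cell L h p) x * (f x)\<^sup>2)"
      by (subst integral_indicator_mult_sum[OF P disjoint_cells[OF h] cm f2]) (simp only: fU)
    also have "\<dots> \<le> (\<Sum>p\<in>P. h\<^sup>2 * (a p)\<^sup>2 +
        B * (2 * (LINT x|lebesgue. indicat_real (cell L h p) x * \<bar>f x - g x\<bar>) + \<eta> * h\<^sup>2))"
      unfolding a_def by (intro sum_mono cell_average_error h f f2 B g(4) osc)
    also have "\<dots> = (\<Sum>p\<in>P. h\<^sup>2 * (a p)\<^sup>2) +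
        (2 * B * (\<Sum>p\<in>P. LINT x|lebesgue. indicat_real (cell L h p) x * \<bar>f x - g x\<bar>) + B * \<eta> * (real N * h)\<^sup>2)"
      by (simp add: sum.distrib P_def power2_eq_square algebra_simps flip: sum_distrib_left)
    also have "(\<Sum>p\<in>P. LINT x|lebesgue. indicat_real (cell L h p) x * \<bar>f x - g x\<bar>) =
        (LINT x|lebesgue. indicat_real (\<Union>p\<in>P. cell L h p) x * \<bar>f x - g x\<bar>)"
      using f g(4) by (intro integral_indicator_mult_sum P disjoint_cells h cm) auto
    also have "\<dots> \<le> (LINT x|lebesgue. \<bar>f x - g x\<bar>)"
    proof (rule integral_mono)
      have "(\<Union>p\<in>P. cell L h p) \<in> sets lebesgue" using P cm by auto
      then show "integrable lebesgue (\<lambda>x. indicat_real (\<Union>p\<in>P. cell L h p) x * \<bar>f x - g x\<bar>)"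
        using f g(4) by (intro integrable_indicator_mult) auto
    qed (use f g(4) in \<open>auto simp: indicator_def\<close>)
    finally have "(LINT x|lebesgue. (f x)\<^sup>2) \<le> (\<Sum>p\<in>P. h\<^sup>2 * (a p)\<^sup>2) +
        (2 * B * (LINT x|lebesgue. \<bar>f x - g x\<bar>) + B * \<eta> * (real N * h)\<^sup>2)"
      using B0 by (simp add: mult_left_mono)
    also have "2 * B * (LINT x|lebesgue. \<bar>f x - g x\<bar>) \<le> 2 * B * (e / (4 * (B + 1)))"
      using g(5) B0 by (intro mult_left_mono) auto
    also have "\<dots> \<le> e / 2" using B0 e by (simp add: field_simps)
    also have "B * \<eta> * (real N * h)\<^sup>2 = (B / (B + 1)) * (e / 2)"
    proof -
      have "real N * h = 2 * L" using Nh by simp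
      moreover have "\<eta> * (2 * L)\<^sup>2 = e / (2 * (B + 1))" using L B0 by (simp add: \<eta>_def)
      ultimately show ?thesis by (simp add: mult.assoc)
    qed
    also have "\<dots> \<le> 1 * (e / 2)" using B0 e by (intro mult_right_mono) (auto simp: field_simps)
    finally have "(LINT x|lebesgue. (f x)\<^sup>2) \<le> (\<Sum>p\<in>P. h\<^sup>2 * (a p)\<^sup>2) + e" by simp
    then show ?case by (simp add: P_def a_def h_def)
  qed
qed

text \<open>
  With mesh \<open>h = 2L/N\<close> the cell averages of \<open>f\<close> form an \<open>N \<times> N\<close> array. The sum of its entries is \<open>h\<^sup>-\<^sup>2 \<integral> f\<close> and its
  variation in each direction is at most \<open>h\<^sup>-\<^sup>2 \<cdot> h T\<close>. All powers of \<open>h\<close> cancel in \<open>discrete_sobolev\<close>, which is the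
  scale invariance of the embedding of \<open>BV\<close> into \<open>L\<^sup>2\<close> in the plane.
\<close>

lemma sobolev_square:
  fixes f :: "real ^ 2 \<Rightarrow> real"
  assumes L: "L > 0" and f: "integrable lebesgue f" and nn: "\<And>x. 0 \<le> f x" and B: "\<And>x. f x \<le> B"
    and f0: "\<And>x. x \<notin> square L \<Longrightarrow> f x = 0"
    and T: "\<And>i. \<forall>\<^sub>F h in at_right 0.
        (LINT x|lebesgue. indicat_real {x \<in> square L. x + axis i h \<in> square L} x * \<bar>f (x + axis i h) - f x\<bar>) \<le> h * T"
  shows "(LINT x|lebesgue. (f x)\<^sup>2) \<le> ((LINT x|lebesgue. f x) / (2 * L) + T)\<^sup>2"
proof (rule field_le_epsilon)
  fix e :: real assume e: "e > 0"
  have f2: "integrable lebesgue (\<lambda>x. (f x)\<^sup>2)"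
  proof (rule Bochner_Integration.integrable_bound[where f="\<lambda>x. B * f x"])
    show "integrable lebesgue (\<lambda>x. B * f x)" using f by auto
    show "AE x in lebesgue. norm ((f x)\<^sup>2) \<le> norm (B * f x)"
    proof (intro AE_I2)
      fix x
      have "f x * f x \<le> B * f x" using nn[of x] B[of x] by (intro mult_right_mono) auto
      then show "norm ((f x)\<^sup>2) \<le> norm (B * f x)" by (simp add: power2_eq_square)
    qed
  qed (use f in auto)
  have f0': "\<forall>x. x \<notin> square L \<longrightarrow> f x = 0" using f0 by blast
  have Babs: "\<bar>f x\<bar> \<le> B" for x using nn[of x] B[of x] by simp
  have lim: "filterlim (\<lambda>N. 2 * L / real N) (at_right 0) sequentially"
    unfolding filterlim_at using L
    by (auto intro!: lim_const_over_n eventually_mono[OF eventually_gt_at_top[of 0]])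
  have "\<forall>\<^sub>F N in sequentially. N > 0 \<and> (\<forall>i. (LINT x|lebesgue. indicat_real {x \<in> square L. x + axis i (2 * L / real N) \<in> square L} x
         * \<bar>f (x + axis i (2 * L / real N)) - f x\<bar>) \<le> (2 * L / real N) * T)"
    by (intro eventually_conj eventually_gt_at_top eventually_all_finite eventually_compose_filterlim[OF T lim])
  then have "\<forall>\<^sub>F N in sequentially. (LINT x|lebesgue. (f x)\<^sup>2) \<le> ((LINT x|lebesgue. f x) / (2 * L) + T)\<^sup>2 + e"
    using cell_averages_L2[OF L f f2 Babs f0' e]
  proof eventually_elim
    case (elim N)
    define h where "h = 2 * L / real N"
    have N: "N > 0" using elim by simp
    have h: "h > 0" using L N by (simp add: h_def)
    have Nh: "- L + real N * h = L" using N by (simp add: h_def)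
    have N1h: "- L + real (N - 1) * h = L - h" using N Nh by (simp add: of_nat_diff algebra_simps)
    define I where "I p = (LINT x|lebesgue. indicat_real (cell L h p) x * f x)" for p
    define a where "a j k = I (j, k) / h\<^sup>2" for j k
    define F where "F = (LINT x|lebesgue. f x)"
    have cm: "cell L h p \<in> sets lebesgue" for p using measure_cell(1)[OF h] by (simp add: fmeasurableD)
    have V: "(LINT x|lebesgue. indicat_real {x \<in> square L. x + axis i h \<in> square L} x * \<bar>f (x + axis i h) - f x\<bar>) \<le> h * T" for i
      using elim by (simp add: h_def)
    have "(\<Sum>p\<in>{..<N-1}\<times>{..<N}. \<bar>I (Suc (fst p), snd p) - I p\<bar>) \<le> h * T"
      unfolding I_def
    proof (rule order_trans[OF square_translation_cells[OF h L f f0 _ refl, where s="\<lambda>p. (Suc (fst p), snd p)" and i=1] V])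
      fix x assume "x \<in> (\<Union>p\<in>{..<N - 1} \<times> {..<N}. cell L h p)"
      then show "\<forall>k. - L \<le> x $ k \<and> x $ k < L \<and> - L \<le> (x + axis 1 h) $ k \<and> (x + axis 1 h) $ k < L"
        unfolding Union_cells[OF h] Nh N1h using h by (auto simp: forall_2 axis_def)
    qed (auto simp: cell_def axis_def algebra_simps)
    then have V1: "(\<Sum>k<N. \<Sum>j<N-1. \<bar>a (Suc j) k - a j k\<bar>) \<le> T / h"
      unfolding a_def diff_divide_distrib[symmetric] abs_divide sum_divide_distrib[symmetric]
      using h by (subst sum.swap) (simp add: sum.cartesian_product case_prod_beta field_simps power2_eq_square)
    have "(\<Sum>p\<in>{..<N}\<times>{..<N-1}. \<bar>I (fst p, Suc (snd p)) - I p\<bar>) \<le> h * T"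
      unfolding I_def
    proof (rule order_trans[OF square_translation_cells[OF h L f f0 _ refl, where s="\<lambda>p. (fst p, Suc (snd p))" and i=2] V])
      fix x assume "x \<in> (\<Union>p\<in>{..<N} \<times> {..<N - 1}. cell L h p)"
      then show "\<forall>k. - L \<le> x $ k \<and> x $ k < L \<and> - L \<le> (x + axis 2 h) $ k \<and> (x + axis 2 h) $ k < L"
        unfolding Union_cells[OF h] Nh N1h using h by (auto simp: forall_2 axis_def)
    qed (auto simp: cell_def axis_def algebra_simps)
    then have V2: "(\<Sum>j<N. \<Sum>k<N-1. \<bar>a j (Suc k) - a j k\<bar>) \<le> T / h"
      unfolding a_def diff_divide_distrib[symmetric] abs_divide sum_divide_distrib[symmetric]
      using h by (simp add: sum.cartesian_product case_prod_beta field_simps power2_eq_square)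
    have fU: "indicat_real (\<Union>p\<in>{..<N}\<times>{..<N}. cell L h p) x * f x = f x" for x
      unfolding Union_cells[OF h] Nh using f0[of x]
      by (cases "x \<in> square L") (auto simp: square_def forall_2 less_imp_le)
    have "(\<Sum>p\<in>{..<N}\<times>{..<N}. I p) = F"
      unfolding I_def F_def
      by (subst integral_indicator_mult_sum[OF _ disjoint_cells[OF h] cm f]) (simp_all only: fU finite_cartesian_product finite_lessThan)
    then have S: "(\<Sum>j<N. \<Sum>k<N. a j k) = F / h\<^sup>2"
      unfolding a_def sum_divide_distrib[symmetric] by (simp add: sum.cartesian_product case_prod_beta)
    have nn': "0 \<le> a j k" for j k
      using nn by (simp add: a_def I_def)
    have "(\<Sum>p\<in>{..<N}\<times>{..<N}. h\<^sup>2 * (I p / h\<^sup>2)\<^sup>2) = h\<^sup>2 * (\<Sum>j<N. \<Sum>k<N. (a j k)\<^sup>2)"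
      by (simp add: a_def sum.cartesian_product case_prod_beta sum_distrib_left)
    also have "\<dots> \<le> h\<^sup>2 * ((F / h\<^sup>2 / N + T / h) * (F / h\<^sup>2 / N + T / h))"
      using discrete_sobolev[of a N, OF nn'] V1 V2 nn' unfolding S[symmetric]
      by (intro mult_left_mono order_trans[OF discrete_sobolev[of a N, OF nn']] mult_mono add_left_mono)
         (auto intro!: add_nonneg_nonneg divide_nonneg_nonneg sum_nonneg order_trans[OF _ V1])
    also have "F / h\<^sup>2 / N = F / (2 * L) / h" using L N by (simp add: h_def field_simps power2_eq_square)
    also have "h\<^sup>2 * ((F / (2 * L) / h + T / h) * (F / (2 * L) / h + T / h)) = (F / (2 * L) + T)\<^sup>2"
      unfolding add_divide_distrib[symmetric] using h by (simp add: power2_eq_square)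
    finally show ?case using elim by (simp add: h_def I_def F_def)
  qed
  then show "(LINT x|lebesgue. (f x)\<^sup>2) \<le> ((LINT x|lebesgue. f x) / (2 * L) + T)\<^sup>2 + e"
    by (auto simp: eventually_sequentially)
qed

section \<open>Test functions\<close>

lemma C1I:
  assumes "\<And>x. (f has_derivative D x) (at x)" and "\<And>i. continuous_on UNIV (\<lambda>x. D x (axis i 1))"
  shows "f \<in> C1" and "partial i f x = D x (axis i 1)"
proof -
  have p: "partial i f x = D x (axis i 1)" for i x
    using frechet_derivative_at[OF assms(1)] by (simp add: partial_def)
  then show "partial i f x = D x (axis i 1)" .
  have "partial i f = (\<lambda>x. D x (axis i 1))" for i using p by auto
  then show "f \<in> C1"
    using assms by (auto simp: C1_def differentiable_on_def intro: differentiableI differentiable_at_withinI)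
qed

lemma C1_has_derivative: "f \<in> C1 \<Longrightarrow> (f has_derivative frechet_derivative f (at x)) (at x)"
  by (simp add: C1_def differentiable_on_def frechet_derivative_works)

lemma C1_partial_continuous: "f \<in> C1 \<Longrightarrow> continuous_on UNIV (partial i f)"
  by (simp add: C1_def)

lemma C1_continuous: "f \<in> C1 \<Longrightarrow> continuous_on UNIV f"
  by (simp add: C1_def differentiable_imp_continuous_on)

lemma C1_const: "(\<lambda>_. c) \<in> C1"
  by (rule C1I(1)[where D="\<lambda>_ _. 0"]) (auto intro: derivative_eq_intros)

lemma C1_add:
  assumes "f \<in> C1" "g \<in> C1"
  shows "(\<lambda>x. f x + g x) \<in> C1"
proof (rule C1I(1))
  show "((\<lambda>x. f x + g x) has_derivative (\<lambda>v. frechet_derivative f (at x) v + frechet_derivative g (at x) v)) (at x)" for x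
    by (intro has_derivative_add C1_has_derivative assms)
  show "continuous_on UNIV (\<lambda>x. frechet_derivative f (at x) (axis i 1) + frechet_derivative g (at x) (axis i 1))" for i
    using C1_partial_continuous[OF assms(1), of i] C1_partial_continuous[OF assms(2), of i]
    unfolding partial_def by (rule continuous_on_add)
qed

lemma C1_mult:
  assumes "f \<in> C1" "g \<in> C1"
  shows "(\<lambda>x. f x * g x) \<in> C1"
proof (rule C1I(1))
  show "((\<lambda>x. f x * g x) has_derivative (\<lambda>v. f x * frechet_derivative g (at x) v + frechet_derivative f (at x) v * g x)) (at x)" for x
    by (intro has_derivative_mult C1_has_derivative assms)
  show "continuous_on UNIV (\<lambda>x. f x * frechet_derivative g (at x) (axis i 1) + frechet_derivative f (at x) (axis i 1) * g x)" for i
    using C1_partial_continuous[OF assms(1), of i] C1_partial_continuous[OF assms(2), of i]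
      C1_continuous[OF assms(1)] C1_continuous[OF assms(2)]
    unfolding partial_def by (intro continuous_on_add continuous_on_mult)
qed

lemma C1_translate:
  assumes "f \<in> C1"
  shows "(\<lambda>x. f (x + a)) \<in> C1" and "partial i (\<lambda>x. f (x + a)) x = partial i f (x + a)"
proof -
  have d: "((\<lambda>x. f (x + a)) has_derivative frechet_derivative f (at (x + a))) (at x)" for x
  proof -
    have "((\<lambda>x. x + a) has_derivative (\<lambda>v. v)) (at x)" by (auto intro!: derivative_eq_intros)
    from has_derivative_compose[OF this C1_has_derivative[OF assms]] show ?thesis .
  qed
  have c: "continuous_on UNIV (\<lambda>x. frechet_derivative f (at (x + a)) (axis i 1))" for i
    using continuous_on_compose2[OF C1_partial_continuous[OF assms, of i], of UNIV "\<lambda>x. x + a"]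
    by (simp add: partial_def continuous_on_add)
  show "(\<lambda>x. f (x + a)) \<in> C1" "partial i (\<lambda>x. f (x + a)) x = partial i f (x + a)"
    using C1I[OF d c] by (simp_all add: partial_def)
qed

lemma C1_coordinate:
  assumes "\<And>s. (g has_real_derivative g' s) (at s)" and "continuous_on UNIV g'"
  shows "(\<lambda>x. g (x $ j)) \<in> C1"
proof (rule C1I(1))
  show "((\<lambda>x. g (x $ j)) has_derivative (\<lambda>v. g' (x $ j) * v $ j)) (at x)" for x :: "real ^ 2"
    using has_derivative_compose[of "\<lambda>x. x $ j" "\<lambda>v. v $ j" x UNIV g "\<lambda>y. g' (x $ j) * y"]
      assms(1)[of "x $ j"]
    by (auto simp: has_field_derivative_def intro: bounded_linear_imp_has_derivative bounded_linear_vec_nth)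
  show "continuous_on UNIV (\<lambda>x. g' (x $ j) * axis i 1 $ j)" for i
    by (intro continuous_intros continuous_on_compose2[OF assms(2)]) auto
qed

lemma axis_scaleR: "axis i s = s *\<^sub>R axis i (1::real)"
  by (simp add: vec_eq_iff axis_def)

lemma norm_axis_real: "norm (axis i (s::real) :: real ^ 'n) = \<bar>s\<bar>"
  by (subst axis_scaleR) simp

lemma C1_line_derivative:
  assumes "f \<in> C1"
  shows "((\<lambda>s. f (x + axis i s)) has_real_derivative partial i f (x + axis i s)) (at s)"
proof -
  note e = axis_scaleR[of i]
  have "((\<lambda>s. f (x + s *\<^sub>R axis i 1)) has_derivative (\<lambda>r. frechet_derivative f (at (x + s *\<^sub>R axis i 1)) (r *\<^sub>R axis i 1))) (at s)"
    by (rule has_derivative_compose[OF _ C1_has_derivative[OF assms]]) (auto intro!: derivative_eq_intros)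
  moreover have "frechet_derivative f (at y) (r *\<^sub>R axis i 1) = partial i f y * r" for y r
    using linear_cmul[OF has_derivative_linear[OF C1_has_derivative[OF assms]]]
    by (simp add: partial_def)
  ultimately show ?thesis
    by (subst e, subst e) (simp add: has_field_derivative_def mult_commute_abs)
qed

lemma test_functions_C1: "\<phi> \<in> test_functions bc L \<Longrightarrow> \<phi> \<in> C1"
  by (cases bc) auto

lemma Neumann_test_zero: "\<phi> \<in> test_functions Neumann L \<Longrightarrow> x \<notin> square L \<Longrightarrow> \<phi> x = 0"
  using closure_subset[of "{x. \<phi> x \<noteq> 0}"] by auto

lemma Neumann_testI:
  assumes "\<phi> \<in> C1" "compact S" "S \<subseteq> square L" "\<And>x. \<phi> x \<noteq> 0 \<Longrightarrow> x \<in> S"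
  shows "\<phi> \<in> test_functions Neumann L"
proof -
  have "closure {x. \<phi> x \<noteq> 0} \<subseteq> S"
    using assms by (intro closure_minimal compact_imp_closed) auto
  then show ?thesis using assms compact_closure bounded_subset[OF compact_imp_bounded[OF assms(2)], of "{x. \<phi> x \<noteq> 0}"]
    by (auto simp: compact_closure)
qed

lemma Periodic_test_translate:
  assumes "\<phi> \<in> test_functions Periodic L"
  shows "(\<lambda>x. \<phi> (x - a)) \<in> test_functions Periodic L"
proof -
  have "\<phi> (x + axis i (2 * L) - a) = \<phi> (x - a)" for x i
  proof -
    have "x + axis i (2 * L) - a = (x - a) + axis i (2 * L)" by simp
    then show ?thesis using assms by (simp only: test_functions.simps mem_Collect_eq)
  qed
  then show ?thesis using assms C1_translate(1)[of \<phi> "- a"] by simp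
qed

lemma test_shift_small:
  assumes "\<phi> \<in> test_functions bc L"
  obtains d where "d > 0" "\<And>s. \<bar>s\<bar> < d \<Longrightarrow> (\<lambda>x. \<phi> (x - axis i s)) \<in> test_functions bc L"
proof (cases bc)
  case Periodic
  then show ?thesis using that[of 1] Periodic_test_translate assms by (metis zero_less_one)
next
  case Neumann
  let ?S = "closure {x. \<phi> x \<noteq> 0}"
  have S: "compact ?S" "?S \<subseteq> square L" and C: "\<phi> \<in> C1" using assms Neumann by auto
  obtain d where d: "d > 0" "(\<Union>x\<in>?S. ball x d) \<subseteq> square L"
    using compact_subset_open_imp_ball_epsilon_subset[OF S(1) _ S(2)]
    by (metis square_eq_box open_box)
  show ?thesis
  proof (rule that[OF d(1)])
    fix s :: real assume s: "\<bar>s\<bar> < d"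
    show "(\<lambda>x. \<phi> (x - axis i s)) \<in> test_functions bc L"
      unfolding Neumann
    proof (rule Neumann_testI)
      show "(\<lambda>x. \<phi> (x - axis i s)) \<in> C1" using C1_translate(1)[OF C, of "- axis i s"] by simp
      show "compact ((+) (axis i s) ` ?S)" by (rule compact_translation[OF S(1)])
      have "axis i s + x \<in> ball x d" for x using s by (simp add: dist_norm norm_axis_real)
      then show "(+) (axis i s) ` ?S \<subseteq> square L" using d(2) by blast
      show "x \<in> (+) (axis i s) ` ?S" if "\<phi> (x - axis i s) \<noteq> 0" for x
        using that closure_subset[of "{x. \<phi> x \<noteq> 0}"] by (intro image_eqI[of _ _ "x - axis i s"]) auto
    qed
  qed
qed


text \<open>
  A smooth function that is below 1 inside the interval \<open>(-L, L)\<close> and equal to 1 at its end points; in the periodic case it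
  has period \<open>2L\<close>. High powers of it are close to 0 except near the end points, which makes the functions \<open>bump\<close> cut-offs
  that tend to 1 in the open square. The positive part is squared to make them continuously differentiable.
\<close>

fun profile :: "boundary_condition \<Rightarrow> real \<Rightarrow> real \<Rightarrow> real" where
  "profile Neumann L s = (s / L)\<^sup>2"
| "profile Periodic L s = (sin (pi * s / (2 * L)))\<^sup>2"

definition bump :: "boundary_condition \<Rightarrow> real \<Rightarrow> nat \<Rightarrow> real ^ 2 \<Rightarrow> real" where
  "bump bc L n x = (max 0 (1 - 2 * profile bc L (x $ 1) ^ n))\<^sup>2 * (max 0 (1 - 2 * profile bc L (x $ 2) ^ n))\<^sup>2"

definition bump_support :: "boundary_condition \<Rightarrow> real \<Rightarrow> nat \<Rightarrow> (real ^ 2) set" where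
  "bump_support bc L n = {x \<in> cbox (vec (-L)) (vec L). \<forall>j. 2 * profile bc L (x $ j) ^ n \<le> 1}"

lemma profile_nonneg: "0 \<le> profile bc L s"
  by (cases bc) auto

lemma profile_less_1:
  assumes "L > 0" "-L < s" "s < L"
  shows "profile bc L s < 1"
proof (cases bc)
  case Neumann
  have "\<bar>s / L\<bar> < 1" using assms by (auto simp: abs_less_iff field_simps)
  then show ?thesis using Neumann by (simp only: profile.simps abs_square_less_1)
next
  case Periodic
  have "cos (pi * s / (2 * L)) > 0"
  proof (rule cos_gt_zero_pi)
    have "pi * (-L) < pi * s" "pi * s < pi * L"
      using assms by (intro mult_strict_left_mono; simp)+
    then show "- (pi / 2) < pi * s / (2 * L)" "pi * s / (2 * L) < pi / 2"
      using assms(1) by (simp_all add: field_simps)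
  qed
  then have "(cos (pi * s / (2 * L)))\<^sup>2 > 0" by (rule zero_less_power)
  then have "(sin (pi * s / (2 * L)))\<^sup>2 < 1"
    using sin_cos_squared_add[of "pi * s / (2 * L)"] by linarith
  then show ?thesis using Periodic by simp
qed

lemma profile_Periodic: "L > 0 \<Longrightarrow> profile Periodic L (s + 2 * L) = profile Periodic L s"
  by (simp add: distrib_left add_divide_distrib)

lemma profile_boundary: "L > 0 \<Longrightarrow> profile bc L L = 1 \<and> profile bc L (-L) = 1"
  by (cases bc) auto

lemma profile_deriv:
  assumes "L > 0"
  obtains p' where "\<And>s. (profile bc L has_real_derivative p' s) (at s)" "continuous_on UNIV p'"
proof (cases bc)
  case Neumann
  have "profile bc L = (\<lambda>s. (s / L)\<^sup>2)" using Neumann by auto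
  then show ?thesis using assms
    by (intro that[of "\<lambda>s. 2 * (s / L) * (1 / L)"]) (auto intro!: derivative_eq_intros continuous_intros simp: power2_eq_square)
next
  case Periodic
  have "profile bc L = (\<lambda>s. (sin (pi * s / (2 * L)))\<^sup>2)" using Periodic by auto
  then show ?thesis using assms
    by (intro that[of "\<lambda>s. 2 * sin (pi * s / (2 * L)) * (cos (pi * s / (2 * L)) * (pi / (2 * L)))"])
      (auto intro!: derivative_eq_intros continuous_intros simp: power2_eq_square)
qed

lemma profile_continuous:
  assumes "L > 0"
  shows "continuous_on UNIV (profile bc L)"
proof -
  obtain p' where "\<And>s. (profile bc L has_real_derivative p' s) (at s)"
    by (rule profile_deriv[OF assms]) (rule that)
  then show ?thesis by (meson DERIV_isCont continuous_at_imp_continuous_on)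
qed

lemma max_0_squared_deriv: "((\<lambda>r. (max 0 r)\<^sup>2) has_real_derivative 2 * max 0 r) (at (r::real))"
proof (cases "r = 0")
  case True
  have "((\<lambda>h. (max 0 h)\<^sup>2 / h) \<longlongrightarrow> 0) (at (0::real))"
  proof (rule Lim_null_comparison)
    show "\<forall>\<^sub>F h in at (0::real). norm ((max 0 h)\<^sup>2 / h) \<le> \<bar>h\<bar>"
      by (intro always_eventually) (auto simp: max_def power2_eq_square)
    show "((\<lambda>h. \<bar>h\<bar>) \<longlongrightarrow> 0) (at (0::real))" by (intro tendsto_rabs_zero tendsto_ident_at)
  qed
  then show ?thesis using True by (simp add: DERIV_def)
next
  case False
  show ?thesis
  proof (cases "r > 0")
    case True
    have "((\<lambda>r. r\<^sup>2) has_real_derivative 2 * r) (at r)" by (auto intro!: derivative_eq_intros)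
    moreover have "\<forall>\<^sub>F x in nhds r. x\<^sup>2 = (max 0 x)\<^sup>2"
      using eventually_nhds_in_open[of "{0<..}" r] True by (auto elim!: eventually_mono)
    ultimately show ?thesis using DERIV_cong_ev[OF refl _ refl, of "\<lambda>x. x\<^sup>2" "\<lambda>x. (max 0 x)\<^sup>2" r "2 * r"] True by simp
  next
    case False
    then have "r < 0" using \<open>r \<noteq> 0\<close> by simp
    then have "\<forall>\<^sub>F x in nhds r. 0 = (max 0 x)\<^sup>2"
      using eventually_nhds_in_open[of "{..<0}" r] by (auto elim!: eventually_mono)
    then show ?thesis using DERIV_cong_ev[OF refl _ refl, of "\<lambda>x. 0" "\<lambda>x. (max 0 x)\<^sup>2" r 0] \<open>r < 0\<close> by simp
  qed
qed

lemma bump_C1: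
  assumes "L > 0"
  shows "bump bc L n \<in> C1"
proof -
  obtain p' where p: "\<And>s. (profile bc L has_real_derivative p' s) (at s)" "continuous_on UNIV p'"
    by (rule profile_deriv[OF assms]) (rule that)
  note pc = profile_continuous[OF assms, of bc]
  have "(\<lambda>x. (max 0 (1 - 2 * profile bc L (x $ j) ^ n))\<^sup>2) \<in> C1" for j
  proof (rule C1_coordinate)
    show "((\<lambda>s. (max 0 (1 - 2 * profile bc L s ^ n))\<^sup>2) has_real_derivative
      2 * max 0 (1 - 2 * profile bc L s ^ n) * (- (2 * (real n * (p' s * profile bc L s ^ (n - Suc 0)))))) (at s)" for s
      by (rule DERIV_chain2[OF max_0_squared_deriv]) (auto intro!: derivative_eq_intros p)
    show "continuous_on UNIV (\<lambda>s. 2 * max 0 (1 - 2 * profile bc L s ^ n) * (- (2 * (real n * (p' s * profile bc L s ^ (n - Suc 0))))))"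
      by (intro continuous_intros p pc)
  qed
  then show ?thesis unfolding bump_def[abs_def] by (intro C1_mult)
qed

lemma bump_bounds: "0 \<le> bump bc L n x" "bump bc L n x \<le> 1"
proof -
  have b: "(max 0 (1 - 2 * profile bc L s ^ n))\<^sup>2 \<le> 1" for s
    using profile_nonneg[of bc L s] by (intro power_le_one) auto
  show "0 \<le> bump bc L n x" by (simp add: bump_def)
  show "bump bc L n x \<le> 1" unfolding bump_def by (intro mult_le_one b) auto
qed

lemma bump_tendsto_1:
  assumes "\<And>j. profile bc L (x $ j) < 1"
  shows "(\<lambda>n. bump bc L n x) \<longlonglongrightarrow> 1" "\<forall>\<^sub>F n in sequentially. \<forall>j. 2 * profile bc L (x $ j) ^ n \<le> 1"
proof -
  have l: "(\<lambda>n. profile bc L (x $ j) ^ n) \<longlonglongrightarrow> 0" for j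
    using assms profile_nonneg by (intro LIMSEQ_power_zero) (simp add: abs_less_iff less_eq_real_def dual_order.strict_trans2)
  have "(\<lambda>n. bump bc L n x) \<longlonglongrightarrow> (max 0 (1 - 2 * 0))\<^sup>2 * (max 0 (1 - 2 * 0))\<^sup>2"
    unfolding bump_def by (intro tendsto_intros l)
  then show "(\<lambda>n. bump bc L n x) \<longlonglongrightarrow> 1" by simp
  have ev: "\<forall>\<^sub>F n in sequentially. profile bc L (x $ j) ^ n < 1/2" for j
    using l by (intro order_tendstoD(2)) auto
  have "\<forall>\<^sub>F n in sequentially. 2 * profile bc L (x $ j) ^ n \<le> 1" for j
    using ev[of j] by (rule eventually_mono) simp
  then show "\<forall>\<^sub>F n in sequentially. \<forall>j. 2 * profile bc L (x $ j) ^ n \<le> 1"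
    by (rule eventually_all_finite)
qed

lemma bump_nonzero: "bump bc L n x \<noteq> 0 \<Longrightarrow> 2 * profile bc L (x $ j) ^ n \<le> 1"
  using exhaust_2[of j] by (auto simp: bump_def)

lemma bump_support_compact: "L > 0 \<Longrightarrow> compact (bump_support bc L n)"
proof -
  assume L: "L > 0"
  note pc = profile_continuous[OF L, of bc]
  have "closed {x::real^2. \<forall>j. 2 * profile bc L (x $ j) ^ n \<le> 1}"
    by (intro closed_Collect_all closed_Collect_le continuous_intros continuous_on_compose2[OF pc]) auto
  then have "compact (cbox (vec (-L)) (vec L) \<inter> {x::real^2. \<forall>j. 2 * profile bc L (x $ j) ^ n \<le> 1})"
    by (intro compact_Int_closed compact_cbox)
  then show ?thesis by (simp add: bump_support_def Int_def)
qed

lemma bump_support_subset: "L > 0 \<Longrightarrow> bump_support bc L n \<subseteq> square L"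
proof
  fix x assume L: "L > 0" and x: "x \<in> bump_support bc L n"
  have "- L < x $ j \<and> x $ j < L" for j
  proof -
    have "x $ j \<noteq> L" "x $ j \<noteq> - L"
      using x profile_boundary[OF L, of bc] unfolding bump_support_def
      by (auto dest!: spec[of _ j])
    moreover have "- L \<le> x $ j" "x $ j \<le> L"
      using x unfolding bump_support_def by (auto simp: mem_box_cart)
    ultimately show ?thesis by linarith
  qed
  then show "x \<in> square L" by (simp add: square_def)
qed

text \<open>
  Periodic functions cannot distinguish opposite edges of the square, but on the open square
  \<open>sin (\<pi> x\<^sub>j / L)\<close> and \<open>cos (\<pi> x\<^sub>j / L)\<close> together separate points. So the Stone-Weierstrass theorem applies to the
  algebra of periodic test functions on every compact subset of the open square.
\<close>

lemma Periodic_function_ring: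
  assumes "L > 0" "compact S" "S \<subseteq> square L"
  shows "function_ring_on (test_functions Periodic L) S"
proof
  show "compact S" by fact
  show "continuous_on S f" if "f \<in> test_functions Periodic L" for f
    using C1_continuous[of f] that continuous_on_subset by auto
  show "(\<lambda>x. f x + g x) \<in> test_functions Periodic L" "(\<lambda>x. f x * g x) \<in> test_functions Periodic L"
    if "f \<in> test_functions Periodic L" "g \<in> test_functions Periodic L" for f g
    using that C1_add[of f g] C1_mult[of f g] by auto
  show "(\<lambda>_. c) \<in> test_functions Periodic L" for c using C1_const by auto
  fix x y assume xy: "x \<in> S" "y \<in> S" "x \<noteq> y"
  then obtain j where j: "x $ j \<noteq> y $ j" by (auto simp: vec_eq_iff)
  define \<theta> where "\<theta> z = pi * (z $ j) / L" for z :: "real ^ 2"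
  have s: "(\<lambda>z. sin (\<theta> z)) \<in> C1" unfolding \<theta>_def
    by (rule C1_coordinate[where g'="\<lambda>s. cos (pi * s / L) * (pi / L)"])
       (use assms(1) in \<open>auto intro!: derivative_eq_intros continuous_intros\<close>)
  have c: "(\<lambda>z. cos (\<theta> z)) \<in> C1" unfolding \<theta>_def
    by (rule C1_coordinate[where g'="\<lambda>s. - sin (pi * s / L) * (pi / L)"])
       (use assms(1) in \<open>auto intro!: derivative_eq_intros continuous_intros\<close>)
  have per: "\<theta> (z + axis i (2 * L)) = \<theta> z \<or> \<theta> (z + axis i (2 * L)) = \<theta> z + 2 * pi" for z i
    using assms(1) by (auto simp: \<theta>_def axis_def field_simps)
  have sT: "(\<lambda>z. sin (\<theta> z)) \<in> test_functions Periodic L" and cT: "(\<lambda>z. cos (\<theta> z)) \<in> test_functions Periodic L"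
    using s c per by (auto, (metis sin_periodic cos_periodic)+)
  have bd: "- pi < \<theta> z" "\<theta> z < pi" if "z \<in> S" for z
  proof -
    have "- L < z $ j" "z $ j < L" using that assms(3) by (auto simp: square_def)
    then have "pi * (- L) < pi * (z $ j)" "pi * (z $ j) < pi * L" by (intro mult_strict_left_mono; simp)+
    then show "- pi < \<theta> z" "\<theta> z < pi" using assms(1) by (simp_all add: \<theta>_def field_simps)
  qed
  have ne: "\<theta> x \<noteq> \<theta> y" using j assms(1) by (simp add: \<theta>_def)
  have "sin (\<theta> x) \<noteq> sin (\<theta> y) \<or> cos (\<theta> x) \<noteq> cos (\<theta> y)"
  proof (rule ccontr)
    assume "\<not> ?thesis"
    then have eq: "sin (\<theta> x) = sin (\<theta> y)" "cos (\<theta> x) = cos (\<theta> y)" by auto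
    have ca: "cos \<bar>t\<bar> = cos t" for t :: real by (simp add: abs_if)
    have "\<bar>\<theta> x\<bar> = \<bar>\<theta> y\<bar>"
      by (rule cos_inj_pi) (use bd[OF xy(1)] bd[OF xy(2)] eq in \<open>auto simp: ca\<close>)
    then have m: "\<theta> y = - \<theta> x" using ne by (auto simp: abs_if split: if_splits)
    then have "sin (\<theta> x) = 0" using eq by simp
    then have "\<theta> x = 0" using bd[OF xy(1)] by (simp add: sin_eq_0_pi)
    then show False using m ne by simp
  qed
  then show "\<exists>f\<in>test_functions Periodic L. f x \<noteq> f y"
    by (elim disjE) (rule bexI[OF _ sT], assumption, rule bexI[OF _ cT], assumption)
qed

text \<open>
  Used to extend bounds from the fundamental domain to the plane; one \<open>y\<close> serves all periodic functions at once.
\<close>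

lemma Periodic_reduce:
  assumes "L > 0"
  shows "\<exists>y. (\<forall>j. - L \<le> y $ j \<and> y $ j < L) \<and>
    (\<forall>f :: real ^ 2 \<Rightarrow> real. (\<forall>x i. f (x + axis i (2 * L)) = f x) \<longrightarrow> f x = f y)"
proof -
  have int: "f (x + axis i (2 * L * of_int k)) = f x" if f: "\<And>x i. f (x + axis i (2 * L)) = f x"
    for f :: "real ^ 2 \<Rightarrow> real" and i k and x
  proof (induction k arbitrary: x rule: int_induct[of _ 0])
    case (step1 k)
    have "x + axis i (2 * L * of_int (k + 1)) = x + axis i (2 * L * of_int k) + axis i (2 * L)"
      by (simp add: vec_eq_iff axis_def algebra_simps)
    then show ?case using f[of "x + axis i (2 * L * of_int k)" i] step1(2)[of x] by (simp only:)
  next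
    case (step2 k)
    have "x + axis i (2 * L * of_int k) = x + axis i (2 * L * of_int (k - 1)) + axis i (2 * L)"
      by (simp add: vec_eq_iff axis_def algebra_simps)
    then show ?case using f[of "x + axis i (2 * L * of_int (k - 1))" i] step2(2)[of x] by (simp only:)
  next
    case base
    have "x + axis i (2 * L * of_int 0) = x" by (simp add: vec_eq_iff axis_def)
    then show ?case by (simp only:)
  qed
  define k where "k j = - \<lfloor>(x $ j + L) / (2 * L)\<rfloor>" for j
  define y where "y = x + axis 1 (2 * L * of_int (k 1)) + axis 2 (2 * L * of_int (k 2))"
  have yj: "y $ j = x $ j + 2 * L * of_int (k j)" for j
    using exhaust_2[of j] by (auto simp: y_def axis_def)
  show ?thesis
  proof (intro exI conjI allI impI)
    fix j
    define q where "q = (x $ j + L) / (2 * L)"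
    have q: "x $ j = 2 * L * q - L" using assms by (simp add: q_def field_simps)
    have "2 * L * (q - of_int \<lfloor>q\<rfloor>) \<ge> 0" using assms by simp
    moreover have "2 * L * (q - of_int \<lfloor>q\<rfloor>) < 2 * L * 1" using assms by (intro mult_strict_left_mono) linarith+
    ultimately show "- L \<le> y $ j" "y $ j < L"
      unfolding yj k_def q_def[symmetric] q by (simp_all add: algebra_simps)
  qed (simp add: y_def int)
qed

lemma bump_Periodic: "L > 0 \<Longrightarrow> bump Periodic L n (x + axis i (2 * L)) = bump Periodic L n x"
proof -
  assume L: "L > 0"
  have "profile Periodic L ((x + axis i (2 * L)) $ j) = profile Periodic L (x $ j)" for j
    using profile_Periodic[OF L] by (cases "i = j") (simp_all add: axis_def)
  then show ?thesis unfolding bump_def by simp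
qed

text \<open>
  The points of the domain whose translate by \<open>h e\<^sub>i\<close> is again a point of the domain; on the torus these are all points.
\<close>

definition shiftable :: "boundary_condition \<Rightarrow> real \<Rightarrow> 2 \<Rightarrow> real \<Rightarrow> (real ^ 2) set" where
  "shiftable bc L i h = {x \<in> square L. bc = Periodic \<or> x + axis i h \<in> square L}"

text \<open>
  The test functions all of whose translates by \<open>s e\<^sub>i\<close>, \<open>0 \<le> s \<le> h\<close>, remain test functions. The intermediate shifts are
  needed because increments are estimated by the mean value theorem in \<open>s\<close>. For Neumann conditions these functions vanish
  outside the shiftable points.
\<close>

definition shift_tests :: "boundary_condition \<Rightarrow> real \<Rightarrow> 2 \<Rightarrow> real \<Rightarrow> (real ^ 2 \<Rightarrow> real) set" where
  "shift_tests bc L i h = {\<psi>. \<forall>s. 0 \<le> s \<and> s \<le> h \<longrightarrow> (\<lambda>x. \<psi> (x - axis i s)) \<in> test_functions bc L}"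

text \<open>
  The sublevel sets of the profile are intervals; hence a segment whose end points lie in the support of the cut-off lies in
  it entirely.
\<close>

lemma profile_Neumann_between:
  assumes "0 \<le> s" "s \<le> h" "2 * profile Neumann L y ^ n \<le> 1" "2 * profile Neumann L (y + h) ^ n \<le> 1" "L > 0"
  shows "2 * profile Neumann L (y + s) ^ n \<le> 1"
proof -
  have "\<bar>y + s\<bar> \<le> \<bar>y\<bar> \<or> \<bar>y + s\<bar> \<le> \<bar>y + h\<bar>" using assms(1,2) by linarith
  then have "profile Neumann L (y + s) \<le> profile Neumann L y \<or> profile Neumann L (y + s) \<le> profile Neumann L (y + h)"
    using assms(5) by (auto simp: power_divide abs_le_square_iff intro!: divide_right_mono)
  then have "profile Neumann L (y + s) ^ n \<le> profile Neumann L y ^ n \<or> profile Neumann L (y + s) ^ n \<le> profile Neumann L (y + h) ^ n"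
    using power_mono profile_nonneg by blast
  then show ?thesis using assms by linarith
qed

lemma profile_Neumann_abs_le:
  assumes "L > 0" "2 * profile Neumann L y ^ n \<le> 1"
  shows "\<bar>y\<bar> \<le> L"
proof (rule ccontr)
  assume "\<not> ?thesis"
  then have "L\<^sup>2 \<le> y\<^sup>2" using assms(1) by (simp add: abs_le_square_iff[symmetric])
  then have "1 \<le> profile Neumann L y" using assms(1) by (simp add: power_divide)
  then show False using assms(2) one_le_power[of "profile Neumann L y" n] by linarith
qed

text \<open>
  The product of two cut-offs is nonzero only where both \<open>x\<close> and \<open>x + h e\<^sub>i\<close> lie in the support of one cut-off, and then so
  do the points between them. The factor \<open>p\<close> may be taken periodic for both boundary conditions.
\<close>

lemma bump_product_shift_test:
  assumes L: "L > 0" and h: "0 \<le> h" and p: "p \<in> test_functions Periodic L" and n: "n > 0"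
  shows "(\<lambda>x. bump bc L n x * bump bc L n (x + axis i h) * p x) \<in> shift_tests bc L i h"
proof -
  let ?\<psi> = "\<lambda>x. bump bc L n x * bump bc L n (x + axis i h) * p x"
  have C: "?\<psi> \<in> C1" using p by (intro C1_mult bump_C1 C1_translate L) (auto simp: test_functions_C1)
  show ?thesis
  proof (cases bc)
    case Periodic
    have "bump Periodic L n (x + axis j (2 * L) + axis i h) = bump Periodic L n (x + axis i h)" for x j
      using bump_Periodic[OF L, of n "x + axis i h" j] by (simp add: add.assoc add.commute[of "axis j _"])
    then have "?\<psi> \<in> test_functions Periodic L" using C p bump_Periodic[OF L] Periodic by auto
    then show ?thesis unfolding shift_tests_def Periodic using Periodic_test_translate by blast
  next
    case Neumann
    have "(\<lambda>x. ?\<psi> (x - axis i s)) \<in> test_functions Neumann L" if s: "0 \<le> s" "s \<le> h" for s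
    proof (rule Neumann_testI)
      show "(\<lambda>x. ?\<psi> (x - axis i s)) \<in> C1" using C1_translate(1)[OF C, of "- axis i s"] by simp
      show "compact (bump_support Neumann L n)" "bump_support Neumann L n \<subseteq> square L"
        by (simp_all add: bump_support_compact bump_support_subset L)
      fix x assume "?\<psi> (x - axis i s) \<noteq> 0"
      then have nz: "bump Neumann L n (x - axis i s) \<noteq> 0" "bump Neumann L n (x - axis i s + axis i h) \<noteq> 0"
        using Neumann by auto
      have *: "2 * profile Neumann L (x $ j) ^ n \<le> 1" for j
      proof (cases "j = i")
        case True
        then show ?thesis using profile_Neumann_between[OF s, of L "x $ j - s" n] bump_nonzero[OF nz(1), of j] bump_nonzero[OF nz(2), of j] L
          by (simp add: axis_def)
      qed (use bump_nonzero[OF nz(1), of j] in \<open>simp add: axis_def\<close>)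
      have "\<bar>x $ j\<bar> \<le> L" for j by (rule profile_Neumann_abs_le[OF L *])
      then have "x \<in> cbox (vec (-L)) (vec L)" by (simp add: mem_box_cart abs_le_iff) (metis minus_le_iff)
      then show "x \<in> bump_support Neumann L n" using * by (simp add: bump_support_def)
    qed
    then show ?thesis by (auto simp: shift_tests_def Neumann)
  qed
qed

lemma bump_product_bounded:
  assumes L: "L > 0" and p: "p \<in> test_functions Periodic L" and n: "n > 0"
    and b: "\<And>x. x \<in> bump_support bc L n \<Longrightarrow> \<bar>p x\<bar> \<le> 1"
  shows "\<bar>bump bc L n x * bump bc L n (x + axis i h) * p x\<bar> \<le> 1"
proof (cases "bump bc L n x = 0")
  case False
  have "\<bar>p x\<bar> \<le> 1"
  proof (cases bc)
    case Periodic
    obtain y where y: "\<forall>j. - L \<le> y $ j \<and> y $ j < L"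
      "\<And>f :: real ^ 2 \<Rightarrow> real. \<forall>x i. f (x + axis i (2 * L)) = f x \<Longrightarrow> f x = f y"
      using Periodic_reduce[OF L, of x] by auto
    have "bump Periodic L n x = bump Periodic L n y" "p x = p y"
      using p by (auto intro!: y(2) bump_Periodic L)
    moreover have "y \<in> bump_support bc L n"
      using y(1) bump_nonzero[of bc L n y] False calculation(1) Periodic
      by (simp add: bump_support_def mem_box_cart less_imp_le)
    ultimately show ?thesis using b by metis
  next
    case Neumann
    have "\<bar>x $ j\<bar> \<le> L" for j
      by (rule profile_Neumann_abs_le[OF L]) (use bump_nonzero[OF False, of j] Neumann in simp)
    then have "x \<in> cbox (vec (-L)) (vec L)" by (simp add: mem_box_cart abs_le_iff) (metis minus_le_iff)
    then show ?thesis using b bump_nonzero[OF False] by (simp add: bump_support_def)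
  qed
  then show ?thesis unfolding abs_mult using bump_bounds[of bc L n]
    by (intro mult_le_one) auto
qed simp

lemma profile_shifted_less_1:
  assumes L: "L > 0" and h: "0 \<le> h" "h < 2 * L" and x: "x \<in> shiftable bc L i h" and ne: "x $ i \<noteq> L - h"
  shows "profile bc L ((x + axis i h) $ j) < 1"
proof (cases "x + axis i h \<in> square L")
  case True then show ?thesis by (intro profile_less_1 L) (auto simp: square_def)
next
  case False
  then have P: "bc = Periodic" and sq: "x \<in> square L" using x by (auto simp: shiftable_def)
  have xj: "- L < x $ j" "x $ j < L" using sq by (auto simp: square_def)
  show ?thesis
  proof (cases "j = i \<and> x $ i > L - h")
    case True
    have "profile Periodic L (x $ j + h - 2 * L) < 1"
      using True xj h by (intro profile_less_1 L) auto
    then have "profile Periodic L (x $ j + h) < 1" using profile_Periodic[OF L, of "x $ j + h - 2 * L"] by simp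
    then show ?thesis using True P by (simp add: axis_def)
  next
    case False
    then show ?thesis using xj h ne by (intro profile_less_1 L) (auto simp: axis_def)
  qed
qed

text \<open>
  Approximate \<open>\<sigma>\<close> by continuous functions, these by periodic test functions on the support of a cut-off, and multiply by the
  cut-offs. The bound by 1 survives everywhere, which is what testing total variation requires.
\<close>

lemma shift_tests_dense:
  assumes L: "L > 0" and h: "0 \<le> h" "h < 2 * L"
    and \<sigma>: "\<sigma> \<in> borel_measurable lebesgue" "\<And>x. \<bar>\<sigma> x\<bar> \<le> 1"
  obtains \<psi> :: "nat \<Rightarrow> real ^ 2 \<Rightarrow> real" where "\<And>n. \<psi> n \<in> shift_tests bc L i h" "\<And>n x. \<bar>\<psi> n x\<bar> \<le> 1"
    "AE x in lebesgue. x \<in> shiftable bc L i h \<longrightarrow> (\<lambda>n. \<psi> n x) \<longlonglongrightarrow> \<sigma> x"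
proof -
  obtain g :: "nat \<Rightarrow> real ^ 2 \<Rightarrow> real" where g: "\<And>n. continuous_on UNIV (g n)" "\<And>n x. \<bar>g n x\<bar> \<le> 1"
    "AE x in lebesgue. (\<lambda>n. g n x) \<longlonglongrightarrow> \<sigma> x"
    by (rule bounded_approx_continuous[OF \<sigma>]) (rule that)
  \<comment> \<open>The factor \<open>1 - 1 / Suc n\<close> leaves room for the uniform error \<open>1 / Suc n\<close> under the bound 1.\<close>
  have "\<exists>p\<in>test_functions Periodic L. \<forall>x\<in>bump_support bc L (Suc n). \<bar>(1 - 1 / Suc n) * g n x - p x\<bar> < 1 / Suc n" for n
    by (rule function_ring_on.Stone_Weierstrass_basic[OF Periodic_function_ring[OF L bump_support_compact[OF L] bump_support_subset[OF L]]])
       (auto intro!: continuous_intros continuous_on_subset[OF g(1)])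
  then obtain p where p: "\<And>n. p n \<in> test_functions Periodic L"
    "\<And>n x. x\<in>bump_support bc L (Suc n) \<Longrightarrow> \<bar>(1 - 1 / Suc n) * g n x - p n x\<bar> < 1 / Suc n" by metis
  have pb: "\<bar>p n x\<bar> \<le> 1" if x: "x \<in> bump_support bc L (Suc n)" for n x
  proof -
    have "\<bar>(1 - 1 / Suc n) * g n x\<bar> \<le> (1 - 1 / Suc n) * 1"
      unfolding abs_mult using g(2)[of n x] by (intro mult_mono) auto
    moreover have "\<bar>b\<bar> \<le> 1" if "\<bar>a\<bar> \<le> (1 - c) * 1" "\<bar>a - b\<bar> < c" for a b c :: real
    proof -
      have "\<bar>b\<bar> \<le> \<bar>a\<bar> + \<bar>a - b\<bar>" using abs_triangle_ineq4[of a "a - b"] by simp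
      with that show ?thesis by simp
    qed
    ultimately show ?thesis using p(2)[OF x] by blast
  qed
  define \<psi> where "\<psi> n x = bump bc L (Suc n) x * bump bc L (Suc n) (x + axis i h) * p n x" for n x
  show thesis
  proof
    show "\<psi> n \<in> shift_tests bc L i h" for n
      unfolding \<psi>_def[abs_def] by (intro bump_product_shift_test L h p) simp
    show "\<bar>\<psi> n x\<bar> \<le> 1" for n x
      unfolding \<psi>_def by (intro bump_product_bounded L p pb) auto
    show "AE x in lebesgue. x \<in> shiftable bc L i h \<longrightarrow> (\<lambda>n. \<psi> n x) \<longlonglongrightarrow> \<sigma> x"
      using g(3) AE_coordinate_neq[of i "L - h"]
    proof eventually_elim
      case (elim x)
      show ?case
      proof
        assume x: "x \<in> shiftable bc L i h"
        then have sq: "x \<in> square L" by (simp add: shiftable_def)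
        have pr: "profile bc L (x $ j) < 1" for j using sq by (intro profile_less_1 L) (auto simp: square_def)
        have b1: "(\<lambda>n. bump bc L (Suc n) x) \<longlonglongrightarrow> 1"
          using bump_tendsto_1(1)[OF pr] by (rule LIMSEQ_Suc)
        have b2: "(\<lambda>n. bump bc L (Suc n) (x + axis i h)) \<longlonglongrightarrow> 1"
          using bump_tendsto_1(1)[OF profile_shifted_less_1[OF L h x elim(2)]] by (rule LIMSEQ_Suc)
        have inv: "(\<lambda>n. 1 / real (Suc n)) \<longlonglongrightarrow> 0" by (rule LIMSEQ_inverse_real_of_nat[unfolded inverse_eq_divide])
        have "\<forall>\<^sub>F n in sequentially. x \<in> bump_support bc L (Suc n)"
        proof -
          have "x \<in> cbox (vec (-L)) (vec L)" using sq by (auto simp: square_def mem_box_cart less_imp_le)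
          then have "\<forall>\<^sub>F n in sequentially. x \<in> bump_support bc L n"
            using bump_tendsto_1(2)[OF pr] by (auto simp: bump_support_def elim: eventually_mono)
          then show ?thesis by (rule eventually_sequentially_Suc[THEN iffD2])
        qed
        then have "\<forall>\<^sub>F n in sequentially. norm ((1 - 1 / real (Suc n)) * g n x - p n x) \<le> 1 / real (Suc n)"
          by eventually_elim (use p(2) in \<open>auto intro: less_imp_le simp del: of_nat_Suc\<close>)
        then have d: "(\<lambda>n. (1 - 1 / real (Suc n)) * g n x - p n x) \<longlonglongrightarrow> 0"
          by (rule Lim_null_comparison[OF _ inv])
        have "(\<lambda>n. (1 - 1 / real (Suc n)) * g n x - ((1 - 1 / real (Suc n)) * g n x - p n x)) \<longlonglongrightarrow> (1 - 0) * \<sigma> x - 0"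
          by (intro tendsto_diff tendsto_mult d elim inv tendsto_const)
        then have "(\<lambda>n. p n x) \<longlonglongrightarrow> \<sigma> x" by simp
        then have "(\<lambda>n. \<psi> n x) \<longlonglongrightarrow> 1 * 1 * \<sigma> x" unfolding \<psi>_def by (intro tendsto_mult b1 b2)
        then show "(\<lambda>n. \<psi> n x) \<longlonglongrightarrow> \<sigma> x" by simp
      qed
    qed
  qed
qed

section \<open>Increments along the coordinate axes\<close>

abbreviation "leb L \<equiv> lebesgue_on (square L)"

lemma square_sets: "square L \<in> sets lebesgue"
  using square_open by auto

lemma square_lmeasurable: "square L \<in> lmeasurable"
  by (simp only: square_eq_box lmeasurable_box)

lemma finite_measure_square: "finite_measure (leb L)"
  by (rule finite_measure_lebesgue_on[OF square_lmeasurable])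

text \<open>
  Extension by zero, which turns integrals over the square into integrals over the plane, where translation is available.
\<close>

definition zext :: "real \<Rightarrow> (real ^ 2 \<Rightarrow> real) \<Rightarrow> real ^ 2 \<Rightarrow> real" where
  "zext L u x = indicat_real (square L) x * u x"

lemma zext_simps [simp]: "x \<in> square L \<Longrightarrow> zext L u x = u x" "x \<notin> square L \<Longrightarrow> zext L u x = 0"
  by (simp_all add: zext_def)

lemma integrable_zext: "integrable (leb L) u \<longleftrightarrow> integrable lebesgue (zext L u)"
  unfolding zext_def using square_sets by (subst integrable_restrict_space) auto

lemma integral_zext: "(LINT x|leb L. u x) = (LINT x|lebesgue. zext L u x)"
  unfolding zext_def using square_sets by (subst integral_restrict_space) auto

lemma AE_leb_iff: "(AE x in leb L. P x) \<longleftrightarrow> (AE x in lebesgue. x \<in> square L \<longrightarrow> P x)"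
  using square_sets by (subst AE_restrict_space_iff) auto

lemma AE_leb_I: "AE x in lebesgue. P x \<Longrightarrow> AE x in leb L. P x"
  unfolding AE_leb_iff by (auto elim: eventually_mono)

lemma AE_leb_square: "AE x in leb L. x \<in> square L"
  unfolding AE_leb_iff by simp

lemma integrable_leb_I:
  fixes f :: "real ^ 2 \<Rightarrow> real"
  shows "integrable lebesgue f \<Longrightarrow> integrable (leb L) f"
  unfolding integrable_zext zext_def by (rule integrable_indicator_mult[OF square_sets])

lemma measurable_leb_continuous:
  fixes f :: "real ^ 2 \<Rightarrow> real"
  shows "continuous_on UNIV f \<Longrightarrow> f \<in> borel_measurable (leb L)"
  by (intro measurable_restrict_space1 lebesgue_measurable_continuous)

lemma integrable_mult_bounded:
  fixes u \<phi> :: "real ^ 2 \<Rightarrow> real"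
  assumes "integrable (leb L) u" "\<phi> \<in> borel_measurable (leb L)" "\<And>x. x \<in> square L \<Longrightarrow> \<bar>\<phi> x\<bar> \<le> B"
  shows "integrable (leb L) (\<lambda>x. u x * \<phi> x)"
proof (rule Bochner_Integration.integrable_bound[where f="\<lambda>x. B * u x"])
  show "integrable (leb L) (\<lambda>x. B * u x)" using assms(1) by simp
  show "(\<lambda>x. u x * \<phi> x) \<in> borel_measurable (leb L)" using assms by auto
  show "AE x in leb L. norm (u x * \<phi> x) \<le> norm (B * u x)"
    using AE_leb_square
  proof eventually_elim
    case (elim x)
    have "\<bar>\<phi> x\<bar> \<le> \<bar>B\<bar>" using assms(3)[OF elim] by linarith
    then show ?case by (simp add: abs_mult mult.commute mult_right_mono)
  qed
qed

lemma continuous_bounded_square: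
  fixes \<phi> :: "real ^ 2 \<Rightarrow> real"
  assumes "continuous_on UNIV \<phi>"
  obtains B where "\<And>x. x \<in> square L \<Longrightarrow> \<bar>\<phi> x\<bar> \<le> B"
proof -
  have "bounded (\<phi> ` cbox (vec (-L)) (vec L))"
    by (intro compact_imp_bounded compact_continuous_image compact_cbox continuous_on_subset[OF assms]) auto
  then obtain B where "\<forall>x\<in>\<phi> ` cbox (vec (-L)) (vec L). norm x \<le> B" by (auto simp: bounded_iff)
  then show ?thesis
    by (intro that[of B]) (auto simp: square_def mem_box_cart less_imp_le)
qed

lemma integrable_mult_continuous:
  fixes u \<phi> :: "real ^ 2 \<Rightarrow> real"
  assumes "integrable (leb L) u" "continuous_on UNIV \<phi>"
  shows "integrable (leb L) (\<lambda>x. u x * \<phi> x)"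
proof -
  obtain B where B: "\<And>x. x \<in> square L \<Longrightarrow> \<bar>\<phi> x\<bar> \<le> B"
    using continuous_bounded_square[OF assms(2), of L thesis] by blast
  show ?thesis by (rule integrable_mult_bounded[OF assms(1) measurable_leb_continuous[OF assms(2)] B])
qed

text \<open>
  The value of \<open>u\<close> at the point \<open>x + h e\<^sub>i\<close>, read on the torus in the periodic case. Writing it with extensions by zero,
  instead of reducing the point modulo \<open>2L\<close>, makes it a sum of translates of one integrable function on the plane. For
  \<open>0 \<le> h < 2L\<close> at most one of the two terms is different from zero.
\<close>

definition shift :: "boundary_condition \<Rightarrow> real \<Rightarrow> 2 \<Rightarrow> real \<Rightarrow> (real ^ 2 \<Rightarrow> real) \<Rightarrow> real ^ 2 \<Rightarrow> real" where
  "shift bc L i h u x = zext L u (x + axis i h) +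
     (if bc = Periodic then zext L u (x + axis i (h - 2 * L)) else 0)"

definition incr :: "boundary_condition \<Rightarrow> real \<Rightarrow> 2 \<Rightarrow> real \<Rightarrow> (real ^ 2 \<Rightarrow> real) \<Rightarrow> real ^ 2 \<Rightarrow> real" where
  "incr bc L i h u x = indicat_real (shiftable bc L i h) x * (shift bc L i h u x - u x)"

abbreviation variation :: "boundary_condition \<Rightarrow> real \<Rightarrow> 2 \<Rightarrow> real \<Rightarrow> (real ^ 2 \<Rightarrow> real) \<Rightarrow> real" where
  "variation bc L i h u \<equiv> LINT x|leb L. \<bar>incr bc L i h u x\<bar>"

lemma shiftable_sets: "shiftable bc L i h \<in> sets (leb L)" "shiftable bc L i h \<in> sets lebesgue"
proof -
  have "open ((\<lambda>x. x + axis i h) -` square L)"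
    by (intro open_vimage square_open continuous_intros)
  then have "open (square L \<inter> (\<lambda>x. x + axis i h) -` square L)" using square_open by blast
  moreover have "shiftable bc L i h = (if bc = Periodic then square L else square L \<inter> (\<lambda>x. x + axis i h) -` square L)"
    by (auto simp: shiftable_def)
  ultimately have o: "open (shiftable bc L i h)" using square_open by simp
  then show "shiftable bc L i h \<in> sets lebesgue" by auto
  then show "shiftable bc L i h \<in> sets (leb L)"
    using square_sets by (subst sets_restrict_space_iff) (auto simp: shiftable_def)
qed

text \<open>
  At almost every shiftable point the shift evaluates all functions at one and the same point. It therefore commutes with
  every pointwise operation, in particular with truncation.
\<close>

lemma shift_pointwise:
  assumes "0 \<le> h" "h < 2 * L" "x \<in> shiftable bc L i h" "x $ i \<noteq> L - h"
  obtains y where "y \<in> square L" "\<And>u. shift bc L i h u x = u y"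
proof (cases "x + axis i h \<in> square L")
  case True
  then have "x $ i + h < L" by (auto simp: square_def axis_def dest: spec[of _ i])
  then have "x + axis i (h - 2 * L) \<notin> square L" by (auto simp: square_def axis_def intro!: exI[of _ i])
  then show ?thesis using that[of "x + axis i h"] True by (simp add: shift_def)
next
  case False
  then have P: "bc = Periodic" and sq: "x \<in> square L" using assms(3) by (auto simp: shiftable_def)
  have xj: "- L < x $ j" "x $ j < L" for j using sq by (auto simp: square_def)
  have "x $ i + h \<ge> L"
  proof (rule ccontr)
    assume "\<not> ?thesis"
    moreover have "- L < x $ i + h" using xj(1)[of i] assms(1) by linarith
    ultimately have "x + axis i h \<in> square L" using xj by (auto simp: square_def axis_def)
    then show False using False by simp
  qed
  then have "x $ i + h > L" using assms(4) by linarith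
  moreover have "x $ i + h < 3 * L" using xj(2)[of i] assms(2) by linarith
  ultimately have "x + axis i (h - 2 * L) \<in> square L"
    using xj by (auto simp: square_def axis_def)
  then show ?thesis using that[of "x + axis i (h - 2 * L)"] False P by (simp add: shift_def)
qed

lemma integrable_shift: "integrable (leb L) u \<Longrightarrow> integrable (leb L) (shift bc L i h u)"
  unfolding shift_def[abs_def] integrable_zext[of L u]
  by (cases bc) (auto intro!: integrable_leb_I Bochner_Integration.integrable_add integrable_translation)

lemma integrable_incr: "integrable (leb L) u \<Longrightarrow> integrable (leb L) (incr bc L i h u)"
  unfolding incr_def[abs_def]
  by (intro integrable_indicator_mult shiftable_sets Bochner_Integration.integrable_diff integrable_shift)

lemma shift_tests_subset: "0 \<le> s \<Longrightarrow> s \<le> h \<Longrightarrow> \<psi> \<in> shift_tests bc L i h \<Longrightarrow> \<psi> \<in> shift_tests bc L i s"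
  by (auto simp: shift_tests_def)

lemma shift_testsD: "\<psi> \<in> shift_tests bc L i h \<Longrightarrow> 0 \<le> s \<Longrightarrow> s \<le> h \<Longrightarrow> (\<lambda>x. \<psi> (x - axis i s)) \<in> test_functions bc L"
  by (auto simp: shift_tests_def)

lemma axis_zero [simp]: "axis i (0::real) = 0"
  by (simp add: vec_eq_iff axis_def)

lemma shift_tests_test: "\<psi> \<in> shift_tests bc L i h \<Longrightarrow> 0 \<le> h \<Longrightarrow> \<psi> \<in> test_functions bc L"
  using shift_testsD[of \<psi> bc L i h 0] by simp

lemma shift_tests_zero:
  assumes "\<psi> \<in> shift_tests bc L i h" "0 \<le> h" "x \<in> square L" "x \<notin> shiftable bc L i h"
  shows "\<psi> x = 0"
proof -
  have N: "bc = Neumann" "x + axis i h \<notin> square L" using assms by (cases bc; auto simp: shiftable_def)+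
  have "(\<lambda>x. \<psi> (x - axis i h)) (x + axis i h) = 0"
    using shift_testsD[OF assms(1,2) order_refl] N Neumann_test_zero by blast
  then show ?thesis by simp
qed

text \<open>
  A change of variables. In the periodic case the translates of the square by \<open>h e\<^sub>i\<close> and \<open>(h - 2L) e\<^sub>i\<close> cover the square
  exactly once, up to the null set \<open>y\<^sub>i = h - L\<close>; in the Neumann case the missing part is where the translated test function vanishes.
\<close>

lemma integral_shift_test:
  assumes L: "L > 0" and h: "0 \<le> h" "h < 2 * L" and u: "integrable (leb L) u" and \<psi>: "\<psi> \<in> test_functions bc L"
  shows "(LINT x|leb L. shift bc L i h u x * \<psi> x) = (LINT x|leb L. u x * \<psi> (x - axis i h))"
proof -
  have \<psi>c: "continuous_on UNIV \<psi>" using test_functions_C1[OF \<psi>] by (rule C1_continuous)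
  have u0: "integrable lebesgue (zext L u)" using u by (simp add: integrable_zext)
  define K where "K = indicat_real (square L)"
  have int1: "integrable lebesgue (\<lambda>x. K x * (zext L u (x + a) * \<psi> x))" for a
  proof -
    have "integrable (leb L) (\<lambda>x. zext L u (x + a) * \<psi> x)"
      by (intro integrable_mult_continuous integrable_leb_I integrable_translation u0 \<psi>c)
    moreover have "(\<lambda>x. K x * (zext L u (x + a) * \<psi> x)) = zext L (\<lambda>x. zext L u (x + a) * \<psi> x)"
      by (simp add: fun_eq_iff zext_def K_def)
    ultimately show ?thesis by (simp only: integrable_zext)
  qed
  have int2: "integrable lebesgue (\<lambda>y. K (y - a) * (zext L u y * \<psi> (y - a)))" for a
    using integrable_translation[OF int1[of a], of "- a"] by simp
  have shift: "(LINT x|lebesgue. K x * (zext L u (x + a) * \<psi> x)) =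
      (LINT y|lebesgue. K (y - a) * (zext L u y * \<psi> (y - a)))" for a
    using integral_translation[OF borel_measurable_integrable[OF int1[of a]], of "- a"] by simp
  have "(LINT x|leb L. shift bc L i h u x * \<psi> x) = (LINT x|lebesgue. K x * (zext L u (x + axis i h) * \<psi> x)
      + (if bc = Periodic then K x * (zext L u (x + axis i (h - 2 * L)) * \<psi> x) else 0))"
    unfolding integral_zext zext_def[of L "\<lambda>x. shift bc L i h u x * \<psi> x"] K_def[symmetric]
    by (intro Bochner_Integration.integral_cong) (auto simp: shift_def algebra_simps)
  also have "\<dots> = (LINT x|lebesgue. K x * (zext L u (x + axis i h) * \<psi> x))
      + (if bc = Periodic then LINT x|lebesgue. K x * (zext L u (x + axis i (h - 2 * L)) * \<psi> x) else 0)"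
    using int1 by (cases bc) (auto simp: Bochner_Integration.integral_add)
  also have "\<dots> = (LINT y|lebesgue. K (y - axis i h) * (zext L u y * \<psi> (y - axis i h)))
      + (if bc = Periodic then LINT y|lebesgue. K (y - axis i (h - 2 * L)) * (zext L u y * \<psi> (y - axis i (h - 2 * L))) else 0)"
    unfolding shift ..
  also have "\<dots> = (LINT y|lebesgue. K (y - axis i h) * (zext L u y * \<psi> (y - axis i h))
      + (if bc = Periodic then K (y - axis i (h - 2 * L)) * (zext L u y * \<psi> (y - axis i (h - 2 * L))) else 0))"
    using int2 by (cases bc) (auto simp: Bochner_Integration.integral_add)
  also have "\<dots> = (LINT y|lebesgue. zext L (\<lambda>y. u y * \<psi> (y - axis i h)) y)"
  proof (rule integral_cong_AE)
    show "(\<lambda>y. K (y - axis i h) * (zext L u y * \<psi> (y - axis i h))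
      + (if bc = Periodic then K (y - axis i (h - 2 * L)) * (zext L u y * \<psi> (y - axis i (h - 2 * L))) else 0)) \<in> borel_measurable lebesgue"
      using int2 by (cases bc) auto
    have "continuous_on UNIV (\<lambda>y. \<psi> (y - axis i h))"
      by (intro continuous_on_compose2[OF \<psi>c] continuous_intros) auto
    then have "integrable (leb L) (\<lambda>y. u y * \<psi> (y - axis i h))"
      by (rule integrable_mult_continuous[OF u])
    then show "zext L (\<lambda>y. u y * \<psi> (y - axis i h)) \<in> borel_measurable lebesgue"
      by (simp add: integrable_zext borel_measurable_integrable)
    show "AE y in lebesgue. K (y - axis i h) * (zext L u y * \<psi> (y - axis i h))
      + (if bc = Periodic then K (y - axis i (h - 2 * L)) * (zext L u y * \<psi> (y - axis i (h - 2 * L))) else 0)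
      = zext L (\<lambda>y. u y * \<psi> (y - axis i h)) y"
      using AE_coordinate_neq[of i "h - L"]
    proof eventually_elim
      case (elim y)
      show ?case
      proof (cases "y \<in> square L")
        case y: True
        show ?thesis
        proof (cases bc)
          case Neumann
          then show ?thesis using Neumann_test_zero[of \<psi> L "y - axis i h"] \<psi> y
            by (cases "y - axis i h \<in> square L") (auto simp: K_def)
        next
          case Periodic
          have "y - axis i (h - 2 * L) = y - axis i h + axis i (2 * L)" by (simp add: vec_eq_iff axis_def)
          moreover have "\<psi> (y - axis i h + axis i (2 * L)) = \<psi> (y - axis i h)"
            using \<psi> Periodic by (simp only: test_functions.simps mem_Collect_eq)
          ultimately have "\<psi> (y - axis i (h - 2 * L)) = \<psi> (y - axis i h)" by (simp only:)
          moreover have "K (y - axis i h) + K (y - axis i (h - 2 * L)) = 1"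
          proof -
            have yj: "- L < y $ j" "y $ j < L" for j using y by (auto simp: square_def)
            note yi = yj(1)[of i] yj(2)[of i]
            have a: "y - axis i h \<in> square L \<longleftrightarrow> y $ i > h - L"
            proof
              assume "y - axis i h \<in> square L"
              then have "- L < (y - axis i h) $ i" unfolding square_def by blast
              then show "y $ i > h - L" by (simp add: axis_def)
            next
              assume "y $ i > h - L"
              then have "- L < y $ i - h" "y $ i - h < L" using yi h by linarith+
              then show "y - axis i h \<in> square L" using yj by (auto simp: square_def axis_def)
            qed
            have b: "y - axis i (h - 2 * L) \<in> square L \<longleftrightarrow> y $ i < h - L"
            proof
              assume "y - axis i (h - 2 * L) \<in> square L"
              then have "(y - axis i (h - 2 * L)) $ i < L" unfolding square_def by blast
              then show "y $ i < h - L" by (simp add: axis_def)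
            next
              assume "y $ i < h - L"
              then have "- L < y $ i - (h - 2 * L)" "y $ i - (h - 2 * L) < L" using yi h by linarith+
              then show "y - axis i (h - 2 * L) \<in> square L" using yj unfolding square_def mem_Collect_eq
                by (simp add: axis_def)
            qed
            show ?thesis using a b elim by (auto simp: K_def indicator_def)
          qed
          ultimately show ?thesis using y Periodic by (simp flip: distrib_right)
        qed
      qed simp
    qed
  qed
  also have "\<dots> = (LINT x|leb L. u x * \<psi> (x - axis i h))" by (simp add: integral_zext)
  finally show ?thesis .
qed

lemma incr_summation_by_parts:
  assumes L: "L > 0" and h: "0 \<le> h" "h < 2 * L" and u: "integrable (leb L) u" and \<psi>: "\<psi> \<in> shift_tests bc L i h"
  shows "(LINT x|leb L. incr bc L i h u x * \<psi> x) = (LINT x|leb L. u x * \<psi> (x - axis i h)) - (LINT x|leb L. u x * \<psi> x)"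
proof -
  have t: "\<psi> \<in> test_functions bc L" by (rule shift_tests_test[OF \<psi> h(1)])
  have c: "continuous_on UNIV \<psi>" using test_functions_C1[OF t] by (rule C1_continuous)
  have "(LINT x|leb L. incr bc L i h u x * \<psi> x) = (LINT x|leb L. shift bc L i h u x * \<psi> x - u x * \<psi> x)"
  proof (rule Bochner_Integration.integral_cong[OF refl])
    fix x assume "x \<in> space (leb L)"
    then have "x \<in> square L" by simp
    then show "incr bc L i h u x * \<psi> x = shift bc L i h u x * \<psi> x - u x * \<psi> x"
      using shift_tests_zero[OF \<psi> h(1)] by (cases "x \<in> shiftable bc L i h") (auto simp: incr_def algebra_simps)
  qed
  also have "\<dots> = (LINT x|leb L. shift bc L i h u x * \<psi> x) - (LINT x|leb L. u x * \<psi> x)"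
    by (intro Bochner_Integration.integral_diff integrable_mult_continuous integrable_shift u c)
  finally show ?thesis unfolding integral_shift_test[OF L h u t] .
qed

text \<open>
  Differentiation under the integral sign. The difference quotients of \<open>\<psi>\<close> are bounded by the maximum of its partial
  derivative on a large ball, by the mean value inequality.
\<close>

lemma translated_integral_deriv:
  assumes u: "integrable (leb L) u" and \<psi>: "\<psi> \<in> C1"
  shows "((\<lambda>s. LINT x|leb L. u x * \<psi> (x - axis i s)) has_real_derivative
           - (LINT x|leb L. u x * partial i \<psi> (x - axis i s))) (at s)"
proof -
  let ?G = "\<lambda>s. LINT x|leb L. u x * \<psi> (x - axis i s)"
  have \<psi>c: "continuous_on UNIV \<psi>" using \<psi> by (rule C1_continuous)
  have pc: "continuous_on UNIV (partial i \<psi>)" using \<psi> by (rule C1_partial_continuous)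
  have cm: "continuous_on UNIV (\<lambda>x. \<psi> (x - axis i s))" for s
    by (intro continuous_on_compose2[OF \<psi>c] continuous_intros) auto
  have cp: "continuous_on UNIV (\<lambda>x. partial i \<psi> (x - axis i s))" for s
    by (intro continuous_on_compose2[OF pc] continuous_intros) auto
  have int: "integrable (leb L) (\<lambda>x. u x * \<psi> (x - axis i s))" for s
    by (rule integrable_mult_continuous[OF u cm])
  have line: "((\<lambda>s. \<psi> (x - axis i s)) has_real_derivative - partial i \<psi> (x - axis i s)) (at s)" for x s
  proof -
    have e: "x - axis i s = x + axis i (- s)" for s by (simp add: vec_eq_iff axis_def)
    have "((\<lambda>s. \<psi> (x + axis i (- s))) has_real_derivative partial i \<psi> (x + axis i (- s)) * (- 1)) (at s)"
      by (rule DERIV_chain2[OF C1_line_derivative[OF \<psi>]]) (auto intro!: derivative_eq_intros)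
    then show ?thesis unfolding e by simp
  qed
  have "((\<lambda>k. (?G (s + k) - ?G s) / k) \<longlongrightarrow> - (LINT x|leb L. u x * partial i \<psi> (x - axis i s))) (at 0)"
    unfolding tendsto_at_iff_sequentially o_def
  proof safe
    fix k :: "nat \<Rightarrow> real" assume k0: "\<forall>n. k n \<in> UNIV - {0}" and k: "k \<longlonglongrightarrow> 0"
    then have kn: "k n \<noteq> 0" for n by auto
    obtain r where r: "\<And>n. \<bar>k n\<bar> \<le> r"
      using k by (metis BseqE convergentI convergent_imp_Bseq real_norm_def)
    define R where "R = norm (vec L :: real ^ 2) + (\<bar>s\<bar> + r)"
    have "bounded (partial i \<psi> ` cball 0 R)"
      by (intro compact_imp_bounded compact_continuous_image compact_cball continuous_on_subset[OF pc]) auto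
    then obtain B where B: "\<And>y. norm y \<le> R \<Longrightarrow> \<bar>partial i \<psi> y\<bar> \<le> B" by (force simp: bounded_iff)
    have q: "\<bar>(\<psi> (x - axis i (s + k n)) - \<psi> (x - axis i s)) / k n\<bar> \<le> B" if x: "x \<in> square L" for x n
    proof -
      have nx: "norm x \<le> norm (vec L :: real ^ 2)"
      proof (rule norm_le_componentwise_cart)
        fix j
        have "- L < x $ j" "x $ j < L" using x by (auto simp: square_def)
        then show "norm (x $ j) \<le> norm ((vec L :: real ^ 2) $ j)" by simp
      qed
      have "norm (\<psi> (x - axis i (s + k n)) - \<psi> (x - axis i s)) \<le> B * norm ((s + k n) - s)"
      proof (rule field_differentiable_bound[of "cball s r"])
        show "((\<lambda>s. \<psi> (x - axis i s)) has_field_derivative - partial i \<psi> (x - axis i t)) (at t within cball s r)" for t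
          using line by (rule has_field_derivative_at_within)
        show "norm (- partial i \<psi> (x - axis i t)) \<le> B" if "t \<in> cball s r" for t
        proof -
          have "\<bar>t\<bar> \<le> \<bar>s\<bar> + r" using that by (auto simp: dist_real_def)
          then have "norm (x - axis i t) \<le> R"
            using norm_triangle_ineq4[of x "axis i t"] nx by (simp add: norm_axis_real R_def)
          then show ?thesis using B by simp
        qed
        show "s + k n \<in> cball s r" "s \<in> cball s r" using r[of n] by (auto simp: dist_real_def)
      qed simp
      then show ?thesis using kn[of n] by (simp add: field_simps)
    qed
    have "(\<lambda>n. LINT x|leb L. u x * ((\<psi> (x - axis i (s + k n)) - \<psi> (x - axis i s)) / k n)) \<longlonglongrightarrow>
       (LINT x|leb L. u x * (- partial i \<psi> (x - axis i s)))"
    proof (rule integral_dominated_convergence[where w="\<lambda>x. B * \<bar>u x\<bar>"])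
      show "(\<lambda>x. u x * - partial i \<psi> (x - axis i s)) \<in> borel_measurable (leb L)"
        using integrable_mult_continuous[OF u continuous_on_minus[OF cp]] by auto
      have "continuous_on UNIV (\<lambda>x. (\<psi> (x - axis i (s + k n)) - \<psi> (x - axis i s)) / k n)" for n
        using kn[of n] by (intro continuous_intros cm) auto
      then show "(\<lambda>x. u x * ((\<psi> (x - axis i (s + k n)) - \<psi> (x - axis i s)) / k n)) \<in> borel_measurable (leb L)" for n
        by (intro borel_measurable_integrable integrable_mult_continuous[OF u])
      show "integrable (leb L) (\<lambda>x. B * \<bar>u x\<bar>)" using u by auto
      show "AE x in leb L. norm (u x * ((\<psi> (x - axis i (s + k n)) - \<psi> (x - axis i s)) / k n)) \<le> B * \<bar>u x\<bar>" for n
        using AE_leb_square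
      proof eventually_elim
        case (elim x)
        show ?case using mult_left_mono[OF q[OF elim, of n], of "\<bar>u x\<bar>"] by (simp add: abs_mult mult.commute)
      qed
      show "AE x in leb L. (\<lambda>n. u x * ((\<psi> (x - axis i (s + k n)) - \<psi> (x - axis i s)) / k n)) \<longlonglongrightarrow>
          u x * - partial i \<psi> (x - axis i s)"
      proof (intro AE_I2 tendsto_mult tendsto_const)
        fix x
        have "(\<lambda>h. (\<psi> (x - axis i (s + h)) - \<psi> (x - axis i s)) / h) \<midarrow>0\<rightarrow> - partial i \<psi> (x - axis i s)"
          using line[of x s] by (simp add: DERIV_def)
        then show "(\<lambda>n. (\<psi> (x - axis i (s + k n)) - \<psi> (x - axis i s)) / k n) \<longlonglongrightarrow> - partial i \<psi> (x - axis i s)"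
          using k0 k by (auto simp: tendsto_at_iff_sequentially o_def)
      qed
    qed
    moreover have eq: "(?G (s + k n) - ?G s) / k n =
        (LINT x|leb L. u x * ((\<psi> (x - axis i (s + k n)) - \<psi> (x - axis i s)) / k n))" for n
    proof -
      have "(?G (s + k n) - ?G s) / k n = (LINT x|leb L. u x * \<psi> (x - axis i (s + k n)) - u x * \<psi> (x - axis i s)) / k n"
        by (simp only: Bochner_Integration.integral_diff[OF int int])
      also have "\<dots> = (LINT x|leb L. (u x * \<psi> (x - axis i (s + k n)) - u x * \<psi> (x - axis i s)) / k n)"
        by (rule integral_divide_zero[symmetric])
      finally show ?thesis by (simp add: right_diff_distrib)
    qed
    ultimately show "(\<lambda>n. (?G (s + k n) - ?G s) / k n) \<longlonglongrightarrow> - (LINT x|leb L. u x * partial i \<psi> (x - axis i s))"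
      by (simp only: eq mult_minus_right Bochner_Integration.integral_minus)
  qed
  then show ?thesis by (simp add: DERIV_def)
qed

lemma test_functions_uminus:
  assumes "\<phi> \<in> test_functions bc L"
  shows "(\<lambda>x. - \<phi> x) \<in> test_functions bc L" and "partial i (\<lambda>x. - \<phi> x) x = - partial i \<phi> x"
proof -
  have C: "\<phi> \<in> C1" by (rule test_functions_C1[OF assms])
  have d: "((\<lambda>x. - \<phi> x) has_derivative (\<lambda>v. - frechet_derivative \<phi> (at x) v)) (at x)" for x
    by (intro has_derivative_minus C1_has_derivative C)
  have c: "continuous_on UNIV (\<lambda>x. - frechet_derivative \<phi> (at x) (axis i 1))" for i
    using continuous_on_minus[OF C1_partial_continuous[OF C, of i]] by (simp add: partial_def)
  show "partial i (\<lambda>x. - \<phi> x) x = - partial i \<phi> x"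
    using C1I(2)[OF d c] by (simp add: partial_def)
  have "(\<lambda>x. - \<phi> x) \<in> C1" by (rule C1I(1)[OF d c])
  then show "(\<lambda>x. - \<phi> x) \<in> test_functions bc L" using assms by (cases bc) auto
qed

text \<open>
  The \<open>L\<^sup>1\<close> norm as a supremum over test functions bounded by 1, attained in the limit along test functions that tend to the
  sign of \<open>F\<close>.
\<close>

lemma L1_norm_dual:
  assumes L: "L > 0" and h: "0 \<le> h" "h < 2 * L" and F: "integrable (leb L) F"
    and F0: "\<And>x. x \<in> square L \<Longrightarrow> x \<notin> shiftable bc L i h \<Longrightarrow> F x = 0"
  obtains \<psi> :: "nat \<Rightarrow> real ^ 2 \<Rightarrow> real" where "\<And>n. \<psi> n \<in> shift_tests bc L i h" "\<And>n x. \<bar>\<psi> n x\<bar> \<le> 1"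
    "(\<lambda>n. LINT x|leb L. F x * \<psi> n x) \<longlonglongrightarrow> (LINT x|leb L. \<bar>F x\<bar>)"
proof -
  have F1: "integrable lebesgue (zext L F)" using F by (simp add: integrable_zext)
  have m: "(\<lambda>x. sgn (zext L F x)) \<in> borel_measurable lebesgue" using F1 by auto
  have b: "\<bar>sgn (zext L F x)\<bar> \<le> 1" for x by (auto simp: sgn_if)
  obtain \<psi> :: "nat \<Rightarrow> real ^ 2 \<Rightarrow> real" where \<psi>: "\<And>n. \<psi> n \<in> shift_tests bc L i h" "\<And>n x. \<bar>\<psi> n x\<bar> \<le> 1"
    "AE x in lebesgue. x \<in> shiftable bc L i h \<longrightarrow> (\<lambda>n. \<psi> n x) \<longlonglongrightarrow> sgn (zext L F x)"
    by (rule shift_tests_dense[OF L h m b]) (rule that)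
  have "(\<lambda>n. LINT x|leb L. F x * \<psi> n x) \<longlonglongrightarrow> (LINT x|leb L. \<bar>F x\<bar>)"
  proof (rule integral_dominated_convergence[where w="\<lambda>x. \<bar>F x\<bar>"])
    show "(\<lambda>x. \<bar>F x\<bar>) \<in> borel_measurable (leb L)" "integrable (leb L) (\<lambda>x. \<bar>F x\<bar>)" using F by auto
    show "(\<lambda>x. F x * \<psi> n x) \<in> borel_measurable (leb L)" for n
      by (intro borel_measurable_integrable integrable_mult_continuous F C1_continuous
          test_functions_C1[OF shift_tests_test[OF \<psi>(1) h(1)]])
    show "AE x in leb L. norm (F x * \<psi> n x) \<le> \<bar>F x\<bar>" for n
      using \<psi>(2)[of n] by (auto simp: abs_mult intro!: mult_left_le)
    show "AE x in leb L. (\<lambda>n. F x * \<psi> n x) \<longlonglongrightarrow> \<bar>F x\<bar>"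
      using AE_leb_I[OF \<psi>(3)] AE_leb_square
    proof eventually_elim
      case (elim x)
      show ?case
      proof (cases "x \<in> shiftable bc L i h")
        case True
        then have "(\<lambda>n. F x * \<psi> n x) \<longlonglongrightarrow> F x * sgn (F x)"
          using elim by (intro tendsto_mult tendsto_const) auto
        then show ?thesis by (simp add: abs_sgn)
      next
        case False then show ?thesis using F0 elim by simp
      qed
    qed
  qed
  then show thesis by (rule that[OF \<psi>(1,2)])
qed

lemma incr_zero_off_shiftable: "x \<notin> shiftable bc L i h \<Longrightarrow> incr bc L i h u x = 0"
  by (simp add: incr_def)

text \<open>
  Increments are controlled by the total variation. For a test function \<open>\<psi>\<close>, summation by parts turns
  \<open>\<integral> incr u \<psi>\<close> into \<open>G h - G 0\<close> with \<open>G s = \<integral> u(x) \<psi>(x - s e\<^sub>i) dx\<close>, and \<open>G'\<close> pairs \<open>u\<close> with the partial derivative of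
  the test function \<open>-\<psi>(\<cdot> - s e\<^sub>i)\<close>. Both directions are treated together, since the hypothesis bounds the sum only.
\<close>

lemma incr_variation_le:
  assumes L: "L > 0" and h: "0 < h" "h < 2 * L" and u: "integrable (leb L) u"
    and B: "\<And>\<phi>1 \<phi>2. \<phi>1 \<in> test_functions bc L \<Longrightarrow> \<phi>2 \<in> test_functions bc L \<Longrightarrow>
        (\<And>x. \<bar>\<phi>1 x\<bar> \<le> 1) \<Longrightarrow> (\<And>x. \<bar>\<phi>2 x\<bar> \<le> 1) \<Longrightarrow>
        (LINT x|leb L. u x * partial 1 \<phi>1 x) + (LINT x|leb L. u x * partial 2 \<phi>2 x) \<le> B"
  shows "variation bc L 1 h u + variation bc L 2 h u \<le> h * B"
proof -
  have h0: "0 \<le> h" using h by simp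
  have main: "(LINT x|leb L. incr bc L 1 h u x * \<psi>1 x) + (LINT x|leb L. incr bc L 2 h u x * \<psi>2 x) \<le> h * B"
    if \<psi>: "\<psi>1 \<in> shift_tests bc L 1 h" "\<psi>2 \<in> shift_tests bc L 2 h" and b: "\<And>x. \<bar>\<psi>1 x\<bar> \<le> 1" "\<And>x. \<bar>\<psi>2 x\<bar> \<le> 1"
    for \<psi>1 \<psi>2
  proof -
    let ?G = "\<lambda>s. (LINT x|leb L. u x * \<psi>1 (x - axis 1 s)) + (LINT x|leb L. u x * \<psi>2 (x - axis 2 s))"
    let ?G' = "\<lambda>s. - (LINT x|leb L. u x * partial 1 \<psi>1 (x - axis 1 s)) + - (LINT x|leb L. u x * partial 2 \<psi>2 (x - axis 2 s))"
    have C: "\<psi>1 \<in> C1" "\<psi>2 \<in> C1" using \<psi> by (auto intro: test_functions_C1 shift_tests_test[OF _ h0])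
    have "\<exists>s. 0 < s \<and> s < h \<and> ?G h - ?G 0 = (h - 0) * ?G' s"
      by (rule MVT2[OF h(1)]) (intro DERIV_add translated_integral_deriv u C)
    then obtain s where s: "0 < s" "s < h" and eq: "?G h - ?G 0 = h * ?G' s" by auto
    define \<phi>1 \<phi>2 where "\<phi>1 = (\<lambda>x. - \<psi>1 (x - axis 1 s))" and "\<phi>2 = (\<lambda>x. - \<psi>2 (x - axis 2 s))"
    have t: "(\<lambda>x. \<psi>1 (x - axis 1 s)) \<in> test_functions bc L" "(\<lambda>x. \<psi>2 (x - axis 2 s)) \<in> test_functions bc L"
      using shift_testsD \<psi> s by auto
    have p: "partial 1 \<phi>1 x = - partial 1 \<psi>1 (x - axis 1 s)" "partial 2 \<phi>2 x = - partial 2 \<psi>2 (x - axis 2 s)" for x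
      unfolding \<phi>1_def \<phi>2_def test_functions_uminus(2)[OF t(1)] test_functions_uminus(2)[OF t(2)]
      using C1_translate(2)[OF C(1), of 1 "- axis 1 s"] C1_translate(2)[OF C(2), of 2 "- axis 2 s"] by simp_all
    have "?G' s = (LINT x|leb L. u x * partial 1 \<phi>1 x) + (LINT x|leb L. u x * partial 2 \<phi>2 x)"
      unfolding p by simp
    also have "\<dots> \<le> B"
      by (rule B) (auto simp: \<phi>1_def \<phi>2_def b intro: test_functions_uminus(1) t)
    finally have "?G h - ?G 0 \<le> h * B" unfolding eq using h by (intro mult_left_mono) auto
    then show ?thesis
      unfolding incr_summation_by_parts[OF L h0 h(2) u \<psi>(1)] incr_summation_by_parts[OF L h0 h(2) u \<psi>(2)] by simp
  qed
  obtain \<psi>1 :: "nat \<Rightarrow> real ^ 2 \<Rightarrow> real" where 1: "\<And>n. \<psi>1 n \<in> shift_tests bc L 1 h" "\<And>n x. \<bar>\<psi>1 n x\<bar> \<le> 1"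
    "(\<lambda>n. LINT x|leb L. incr bc L 1 h u x * \<psi>1 n x) \<longlonglongrightarrow> variation bc L 1 h u"
    by (rule L1_norm_dual[OF L h0 h(2) integrable_incr[OF u] incr_zero_off_shiftable]) (assumption, rule that)
  obtain \<psi>2 :: "nat \<Rightarrow> real ^ 2 \<Rightarrow> real" where 2: "\<And>n. \<psi>2 n \<in> shift_tests bc L 2 h" "\<And>n x. \<bar>\<psi>2 n x\<bar> \<le> 1"
    "(\<lambda>n. LINT x|leb L. incr bc L 2 h u x * \<psi>2 n x) \<longlonglongrightarrow> variation bc L 2 h u"
    by (rule L1_norm_dual[OF L h0 h(2) integrable_incr[OF u] incr_zero_off_shiftable]) (assumption, rule that)
  show ?thesis
    by (rule tendsto_upperbound[OF tendsto_add[OF 1(3) 2(3)]])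
       (auto intro!: always_eventually main 1 2)
qed

lemma shift_tests_small:
  assumes "\<phi> \<in> test_functions bc L"
  shows "\<forall>\<^sub>F h in at_right 0. \<phi> \<in> shift_tests bc L i h"
proof -
  obtain d where d: "d > 0" "\<And>s. \<bar>s\<bar> < d \<Longrightarrow> (\<lambda>x. \<phi> (x - axis i s)) \<in> test_functions bc L"
    by (rule test_shift_small[OF assms]) (rule that)
  show ?thesis
    unfolding eventually_at_right_field shift_tests_def using d by (intro exI[of _ d]) auto
qed

text \<open>
  The converse link: a test function sees the derivative of \<open>u\<close> as a limit of increments, so that the total variation is at
  most the lower limit of \<open>variation bc L i h u / h\<close>.
\<close>

lemma incr_tendsto_test:
  assumes L: "L > 0" and u: "integrable (leb L) u" and \<phi>: "\<phi> \<in> test_functions bc L"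
  shows "((\<lambda>h. (LINT x|leb L. incr bc L i h u x * \<phi> x) / h) \<longlongrightarrow> - (LINT x|leb L. u x * partial i \<phi> x)) (at_right 0)"
proof -
  let ?G = "\<lambda>s. LINT x|leb L. u x * \<phi> (x - axis i s)"
  have "((\<lambda>h. (?G (0 + h) - ?G 0) / h) \<longlongrightarrow> - (LINT x|leb L. u x * partial i \<phi> (x - axis i 0))) (at 0)"
    using translated_integral_deriv[OF u test_functions_C1[OF \<phi>], of i 0] unfolding DERIV_def .
  then have "((\<lambda>h. (?G h - ?G 0) / h) \<longlongrightarrow> - (LINT x|leb L. u x * partial i \<phi> x)) (at_right 0)"
    by (simp add: filterlim_at_split)
  moreover have L2: "0 < 2 * L" using L by simp
  have "\<forall>\<^sub>F h in at_right 0. (?G h - ?G 0) / h = (LINT x|leb L. incr bc L i h u x * \<phi> x) / h"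
    using shift_tests_small[OF \<phi>, of i] eventually_at_right_less[of "0::real"]
      eventually_at_right_real[OF L2]
  proof eventually_elim
    case (elim h)
    then show ?case using incr_summation_by_parts[OF L _ _ u elim(1)] by simp
  qed
  ultimately show ?thesis by (rule Lim_transform_eventually)
qed

text \<open>
  For a point \<open>x\<close> of the square, the zero extension vanishes at \<open>x - 2L e\<^sub>i\<close>; so the second term in the definition of the
  shift is itself an increment of the extension, and both terms are covered by the continuity of translations.
\<close>

lemma incr_L1_tendsto_0:
  assumes L: "L > 0" and g: "integrable (leb L) g"
  shows "((\<lambda>s. variation bc L i s g) \<longlongrightarrow> 0) (at_right 0)"
proof -
  have g0: "integrable lebesgue (zext L g)" using g by (simp add: integrable_zext)
  let ?T = "\<lambda>s. LINT x|lebesgue. \<bar>zext L g (x + axis i s) - zext L g x\<bar>"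
  have int: "integrable lebesgue (\<lambda>x. \<bar>zext L g (x + axis i s) - zext L g x\<bar>)" for s
    using integrable_translation[OF g0, of "axis i s"] g0 by auto
  have "((\<lambda>s. s *\<^sub>R axis i 1 :: real ^ 2) \<longlongrightarrow> 0 *\<^sub>R axis i 1) (at_right (0::real))"
    by (intro tendsto_intros)
  then have "((\<lambda>s. axis i s :: real ^ 2) \<longlongrightarrow> axis i 0) (at_right (0::real))"
    by (simp only: axis_scaleR[symmetric])
  then have T0: "(?T \<longlongrightarrow> 0) (at_right 0)"
    by (intro filterlim_compose[OF L1_translation_continuous[OF g0]]) simp
  have le: "variation bc L i s g \<le> 2 * ?T s" for s
  proof -
    let ?D = "\<lambda>x. \<bar>zext L g (x + axis i s) - zext L g x\<bar>"
    have D2: "integrable lebesgue (\<lambda>x. ?D (x + axis i (- 2 * L)))"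
      by (rule integrable_translation[OF int])
    have "variation bc L i s g = (LINT x|lebesgue. zext L (\<lambda>x. \<bar>incr bc L i s g x\<bar>) x)"
      by (rule integral_zext)
    also have "\<dots> \<le> (LINT x|lebesgue. ?D x + ?D (x + axis i (- 2 * L)))"
    proof (rule integral_mono)
      show "integrable lebesgue (zext L (\<lambda>x. \<bar>incr bc L i s g x\<bar>))"
        using integrable_incr[OF g] by (auto simp: integrable_zext[symmetric])
      show "integrable lebesgue (\<lambda>x. ?D x + ?D (x + axis i (- 2 * L)))"
        using int D2 by (rule Bochner_Integration.integrable_add)
      fix x
      show "zext L (\<lambda>x. \<bar>incr bc L i s g x\<bar>) x \<le> ?D x + ?D (x + axis i (- 2 * L))"
      proof (cases "x \<in> square L")
        case True
        have z: "x + axis i (- 2 * L) \<notin> square L"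
          using True by (auto simp: square_def axis_def intro!: exI[of _ i] dest: spec[of _ i])
        have "x + axis i (- 2 * L) + axis i s = x + axis i (s - 2 * L)"
          by (simp add: vec_eq_iff axis_def)
        then have "?D (x + axis i (- 2 * L)) = \<bar>zext L g (x + axis i (s - 2 * L))\<bar>"
          by (simp only: zext_simps(2)[OF z] diff_0_right)
        then have rhs: "?D x + ?D (x + axis i (- 2 * L)) =
            \<bar>zext L g (x + axis i s) - g x\<bar> + \<bar>zext L g (x + axis i (s - 2 * L))\<bar>"
          using True by (simp only: zext_simps(1))
        have lhs: "zext L (\<lambda>x. \<bar>incr bc L i s g x\<bar>) x \<le> \<bar>shift bc L i s g x - g x\<bar>"
          using True by (simp add: incr_def indicator_def)
        have mid: "\<bar>shift bc L i s g x - g x\<bar> \<le> \<bar>zext L g (x + axis i s) - g x\<bar> + \<bar>zext L g (x + axis i (s - 2 * L))\<bar>"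
          unfolding shift_def by (cases bc) simp_all
        show ?thesis unfolding rhs using lhs mid by (rule order_trans)
      qed simp
    qed
    also have "\<dots> = ?T s + (LINT x|lebesgue. ?D (x + axis i (- 2 * L)))"
      by (rule Bochner_Integration.integral_add[OF int D2])
    also have "(LINT x|lebesgue. ?D (x + axis i (- 2 * L))) = ?T s"
      by (rule integral_translation) (use int in auto)
    finally show ?thesis by simp
  qed
  have lim: "((\<lambda>s. 2 * ?T s) \<longlongrightarrow> 0) (at_right 0)"
    using tendsto_mult_left[OF T0, of 2] by simp
  show ?thesis
  proof (rule Lim_null_comparison[OF _ lim], rule always_eventually, rule allI)
    fix s
    show "norm (variation bc L i s g) \<le> 2 * ?T s" using le[of s] by simp
  qed
qed

section \<open>Difference quotients and weak derivatives\<close>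

lemma dominated_convergence_at_right:
  fixes f :: "real \<Rightarrow> 'a \<Rightarrow> real"
  assumes "\<And>h. 0 < h \<Longrightarrow> f h \<in> borel_measurable M" "F \<in> borel_measurable M" "integrable M w"
    and "\<And>h. 0 < h \<Longrightarrow> AE x in M. \<bar>f h x\<bar> \<le> w x"
    and "AE x in M. ((\<lambda>h. f h x) \<longlongrightarrow> F x) (at_right 0)"
  shows "((\<lambda>h. LINT x|M. f h x) \<longlongrightarrow> (LINT x|M. F x)) (at_right 0)"
proof (rule tendsto_at_right_sequentially[of 0 1])
  fix S :: "nat \<Rightarrow> real"
  assume S: "\<And>n. 0 < S n" "S \<longlonglongrightarrow> 0"
  then have lim: "filterlim S (at_right 0) sequentially"
    unfolding filterlim_at by (auto intro!: always_eventually simp: less_imp_neq[THEN not_sym])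
  show "(\<lambda>n. LINT x|M. f (S n) x) \<longlonglongrightarrow> (LINT x|M. F x)"
  proof (rule integral_dominated_convergence[where w=w])
    show "AE x in M. (\<lambda>n. f (S n) x) \<longlonglongrightarrow> F x"
      using assms(5) by eventually_elim (rule filterlim_compose[OF _ lim])
  qed (use assms S in auto)
qed simp

lemma axis_tendsto: "((\<lambda>s. axis i s :: real ^ 2) \<longlongrightarrow> axis i 0) (at_right (0::real))"
proof -
  have "((\<lambda>s. s *\<^sub>R axis i 1 :: real ^ 2) \<longlongrightarrow> 0 *\<^sub>R axis i 1) (at_right (0::real))"
    by (intro tendsto_intros)
  then show ?thesis by (simp only: axis_scaleR[symmetric])
qed

lemma eventually_shiftable:
  assumes "x \<in> square L"
  shows "\<forall>\<^sub>F h in at_right 0. x \<in> shiftable bc L i h"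
proof -
  have "((\<lambda>s. axis i s :: real ^ 2) \<longlongrightarrow> axis i 0) (at_right (0::real))"
    by (rule axis_tendsto)
  then have "((\<lambda>s. x + axis i s) \<longlongrightarrow> x) (at_right (0::real))"
    using tendsto_add[OF tendsto_const[of x]] by force
  then have "\<forall>\<^sub>F s in at_right 0. x + axis i s \<in> square L"
    by (rule topological_tendstoD) (use assms square_open in auto)
  then show ?thesis using assms by (auto simp: shiftable_def elim: eventually_mono)
qed

lemma L2_imp_integrable:
  assumes "f \<in> L2 L"
  shows "integrable (leb L) f"
proof (rule finite_measure.square_integrable_imp_integrable[OF finite_measure_square])
  show "f \<in> borel_measurable (leb L)" "integrable (leb L) (\<lambda>x. (f x)\<^sup>2)"
    using assms unfolding L2_def by blast+
qed

lemma weak_gradient_test: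
  assumes "has_weak_gradient bc L u g" "\<phi> \<in> test_functions bc L"
  shows "(LINT x|leb L. u x * partial i \<phi> x) = - (LINT x|leb L. g x $ i * \<phi> x)"
  using assms by (auto simp: has_weak_gradient_def L2_inner_def)

text \<open>
  The difference quotient of \<open>u\<close> is an average of translates of its weak derivative \<open>g\<close> over shifts in \<open>(0, h)\<close>, and
  these converge to \<open>g\<close>. To avoid integrating in the shift, the difference is tested with \<open>\<psi>\<close>: the mean value theorem
  provides a shift \<open>s \<in> (0, h)\<close> with \<open>\<integral> (incr\<^sub>h u / h - g) \<psi> = \<integral> incr\<^sub>s g \<psi>\<close>, bounded by the \<open>L\<^sup>1\<close> norm of \<open>incr\<^sub>s g\<close>.
\<close>

lemma difference_quotient_L1_tendsto:
  assumes L: "L > 0" and u: "integrable (leb L) u" and g: "integrable (leb L) g"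
    and wg: "\<And>\<phi>. \<phi> \<in> test_functions bc L \<Longrightarrow> (LINT x|leb L. u x * partial i \<phi> x) = - (LINT x|leb L. g x * \<phi> x)"
  shows "((\<lambda>h. LINT x|leb L. \<bar>incr bc L i h u x / h - indicat_real (shiftable bc L i h) x * g x\<bar>) \<longlongrightarrow> 0) (at_right 0)"
proof (rule tendstoI)
  fix e :: real assume e: "e > 0"
  have "\<forall>\<^sub>F s in at_right 0. variation bc L i s g < e / 2"
    using incr_L1_tendsto_0[OF L g, of bc i] e by (intro order_tendstoD(2)) auto
  then obtain d where d: "d > 0" "\<And>s. 0 < s \<Longrightarrow> s < d \<Longrightarrow> variation bc L i s g < e / 2"
    unfolding eventually_at_right_field by auto
  have "0 < min d (2 * L)" using d L by simp
  from eventually_at_right_real[OF this]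
  show "\<forall>\<^sub>F h in at_right 0. dist (LINT x|leb L. \<bar>incr bc L i h u x / h - indicat_real (shiftable bc L i h) x * g x\<bar>) 0 < e"
  proof eventually_elim
    case (elim h)
    then have h: "0 < h" "h < d" "h < 2 * L" and h0: "0 \<le> h" by auto
    let ?F = "\<lambda>x. incr bc L i h u x / h - indicat_real (shiftable bc L i h) x * g x"
    have Ag: "integrable (leb L) (\<lambda>x. indicat_real (shiftable bc L i h) x * g x)"
      by (rule integrable_indicator_mult[OF shiftable_sets(1) g])
    have F: "integrable (leb L) ?F"
      by (intro Bochner_Integration.integrable_diff Ag integrable_divide_zero integrable_incr u)
    have main: "(LINT x|leb L. ?F x * \<psi> x) \<le> e / 2"
      if \<psi>: "\<psi> \<in> shift_tests bc L i h" and b: "\<And>x. \<bar>\<psi> x\<bar> \<le> 1" for \<psi>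
    proof -
      let ?G = "\<lambda>s. LINT x|leb L. u x * \<psi> (x - axis i s)"
      have C: "\<psi> \<in> C1" using \<psi> by (intro test_functions_C1 shift_tests_test[OF _ h0])
      have c: "continuous_on UNIV \<psi>" by (rule C1_continuous[OF C])
      have "\<exists>s. 0 < s \<and> s < h \<and> ?G h - ?G 0 = (h - 0) * (- (LINT x|leb L. u x * partial i \<psi> (x - axis i s)))"
        by (rule MVT2[OF h(1)]) (rule translated_integral_deriv[OF u C])
      then obtain s where s: "0 < s" "s < h" and eq: "?G h - ?G 0 = h * (- (LINT x|leb L. u x * partial i \<psi> (x - axis i s)))"
        by auto
      have s2: "0 \<le> s" "s < 2 * L" "s \<le> h" using s h by auto
      have t: "(\<lambda>x. \<psi> (x - axis i s)) \<in> test_functions bc L" using shift_testsD[OF \<psi>] s by auto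
      have p: "partial i (\<lambda>x. \<psi> (x - axis i s)) x = partial i \<psi> (x - axis i s)" for x
        using C1_translate(2)[OF C, of i "- axis i s"] by simp
      have Gs: "?G h - ?G 0 = h * (LINT x|leb L. g x * \<psi> (x - axis i s))"
        unfolding eq using wg[OF t] by (simp add: p)
      have Aeq: "(LINT x|leb L. indicat_real (shiftable bc L i h) x * g x * \<psi> x) = (LINT x|leb L. g x * \<psi> x)"
        by (intro Bochner_Integration.integral_cong refl)
           (use shift_tests_zero[OF \<psi> h0] in \<open>auto simp: indicator_def\<close>)
      have "(LINT x|leb L. ?F x * \<psi> x) = (LINT x|leb L. incr bc L i h u x / h * \<psi> x - indicat_real (shiftable bc L i h) x * g x * \<psi> x)"
        by (simp only: left_diff_distrib)
      also have "\<dots> = (LINT x|leb L. incr bc L i h u x / h * \<psi> x) - (LINT x|leb L. indicat_real (shiftable bc L i h) x * g x * \<psi> x)"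
        by (intro Bochner_Integration.integral_diff integrable_mult_continuous Ag c integrable_divide_zero integrable_incr u)
      also have "(LINT x|leb L. incr bc L i h u x / h * \<psi> x) = (?G h - ?G 0) / h"
        using incr_summation_by_parts[OF L h0 h(3) u \<psi>] by (simp add: times_divide_eq_left)
      also have "\<dots> = (LINT x|leb L. g x * \<psi> (x - axis i s))" unfolding Gs using h by simp
      finally have "(LINT x|leb L. ?F x * \<psi> x) = (LINT x|leb L. incr bc L i s g x * \<psi> x)"
        unfolding Aeq incr_summation_by_parts[OF L s2(1,2) g shift_tests_subset[OF s2(1,3) \<psi>]] .
      also have "\<dots> \<le> variation bc L i s g"
      proof (rule integral_mono)
        show "integrable (leb L) (\<lambda>x. incr bc L i s g x * \<psi> x)"
          by (intro integrable_mult_continuous integrable_incr g c)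
        show "integrable (leb L) (\<lambda>x. \<bar>incr bc L i s g x\<bar>)" using integrable_incr[OF g] by auto
        show "incr bc L i s g x * \<psi> x \<le> \<bar>incr bc L i s g x\<bar>" for x
        proof -
          have "incr bc L i s g x * \<psi> x \<le> \<bar>incr bc L i s g x\<bar> * \<bar>\<psi> x\<bar>" unfolding abs_mult[symmetric] by (rule abs_ge_self)
          also have "\<dots> \<le> \<bar>incr bc L i s g x\<bar>" using b[of x] by (intro mult_left_le) auto
          finally show ?thesis .
        qed
      qed
      also have "\<dots> \<le> e / 2" using d(2)[of s] s h by auto
      finally show ?thesis .
    qed
    have F0: "?F x = 0" if "x \<in> square L" "x \<notin> shiftable bc L i h" for x
      using that by (simp add: incr_def)
    obtain \<psi> :: "nat \<Rightarrow> real ^ 2 \<Rightarrow> real" where \<psi>: "\<And>n. \<psi> n \<in> shift_tests bc L i h" "\<And>n x. \<bar>\<psi> n x\<bar> \<le> 1"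
      "(\<lambda>n. LINT x|leb L. ?F x * \<psi> n x) \<longlonglongrightarrow> (LINT x|leb L. \<bar>?F x\<bar>)"
      by (rule L1_norm_dual[OF L h0 h(3) F F0]) (assumption, assumption, rule that)
    have "(LINT x|leb L. \<bar>?F x\<bar>) \<le> e / 2"
      by (rule tendsto_upperbound[OF \<psi>(3)], rule always_eventually, rule allI, rule main[OF \<psi>(1,2)]) simp
    moreover have "0 \<le> (LINT x|leb L. \<bar>?F x\<bar>)" by simp
    ultimately show ?case using e by (simp add: dist_real_def)
  qed
qed

lemma variation_tendsto:
  assumes L: "L > 0" and u: "integrable (leb L) u" and g: "integrable (leb L) g"
    and wg: "\<And>\<phi>. \<phi> \<in> test_functions bc L \<Longrightarrow> (LINT x|leb L. u x * partial i \<phi> x) = - (LINT x|leb L. g x * \<phi> x)"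
  shows "((\<lambda>h. variation bc L i h u / h) \<longlongrightarrow> (LINT x|leb L. \<bar>g x\<bar>)) (at_right 0)"
proof -
  let ?A = "\<lambda>h. indicat_real (shiftable bc L i h)"
  have Ag: "integrable (leb L) (\<lambda>x. ?A h x * g x)" for h
    by (rule integrable_indicator_mult[OF shiftable_sets(1) g])
  have 1: "((\<lambda>h. LINT x|leb L. \<bar>?A h x * g x\<bar>) \<longlongrightarrow> (LINT x|leb L. \<bar>g x\<bar>)) (at_right 0)"
  proof (rule dominated_convergence_at_right[where w="\<lambda>x. \<bar>g x\<bar>"])
    show "(\<lambda>x. \<bar>?A h x * g x\<bar>) \<in> borel_measurable (leb L)" for h using Ag[of h] by auto
    show "AE x in leb L. \<bar>\<bar>?A h x * g x\<bar>\<bar> \<le> \<bar>g x\<bar>" for h by (auto simp: indicator_def)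
    show "AE x in leb L. ((\<lambda>h. \<bar>?A h x * g x\<bar>) \<longlongrightarrow> \<bar>g x\<bar>) (at_right 0)"
      using AE_leb_square
    proof eventually_elim
      case (elim x)
      show ?case
        by (rule tendsto_eventually, rule eventually_mono[OF eventually_shiftable[OF elim, of bc i]]) simp
    qed
  qed (use g in auto)
  have 2: "((\<lambda>h. variation bc L i h u / h - (LINT x|leb L. \<bar>?A h x * g x\<bar>)) \<longlongrightarrow> 0) (at_right 0)"
  proof (rule Lim_null_comparison[OF _ difference_quotient_L1_tendsto[OF L u g wg]])
    show "\<forall>\<^sub>F h in at_right 0. norm (variation bc L i h u / h - (LINT x|leb L. \<bar>?A h x * g x\<bar>))
      \<le> (LINT x|leb L. \<bar>incr bc L i h u x / h - ?A h x * g x\<bar>)"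
      using eventually_at_right_less[of "0::real"]
    proof eventually_elim
      case (elim h)
      have I: "integrable (leb L) (\<lambda>x. incr bc L i h u x / h)"
        by (intro integrable_divide_zero integrable_incr u)
      have "variation bc L i h u / h = (LINT x|leb L. \<bar>incr bc L i h u x / h\<bar>)"
        using elim by (simp add: abs_divide)
      then have "variation bc L i h u / h - (LINT x|leb L. \<bar>?A h x * g x\<bar>)
        = (LINT x|leb L. \<bar>incr bc L i h u x / h\<bar> - \<bar>?A h x * g x\<bar>)"
        using I Ag[of h] by (simp only: Bochner_Integration.integral_diff integrable_abs)
      also have "norm \<dots> \<le> (LINT x|leb L. \<bar>\<bar>incr bc L i h u x / h\<bar> - \<bar>?A h x * g x\<bar>\<bar>)"
        unfolding real_norm_def by (rule integral_abs_bound)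
      also have "\<dots> \<le> (LINT x|leb L. \<bar>incr bc L i h u x / h - ?A h x * g x\<bar>)"
        by (intro integral_mono integrable_abs Bochner_Integration.integrable_diff I Ag abs_triangle_ineq3)
      finally show ?case .
    qed
  qed
  show ?thesis using tendsto_add[OF 2 1] by simp
qed

text \<open>
  The weak derivative of \<open>max u c\<close> at a point where \<open>u = a\<close> has weak derivative \<open>b\<close>. On the level set \<open>u = c\<close> it is given
  the value \<open>max b 0\<close>, the one-sided derivative obtained with positive increments, so that the difference quotients
  converge at every point.
\<close>

definition max_gradient :: "real \<Rightarrow> real \<Rightarrow> real \<Rightarrow> real" where
  "max_gradient c a b = (if a > c then b else if a = c then max b 0 else 0)"

lemma max_gradient_abs: "\<bar>max_gradient c a b\<bar> \<le> \<bar>b\<bar>"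
  by (auto simp: max_gradient_def)

lemma max_gradient_tendsto:
  "((\<lambda>h. (max (a + h * b) c - max a c) / h) \<longlongrightarrow> max_gradient c a b) (at_right 0)"
proof (rule tendsto_eventually)
  consider "a > c" | "a = c" | "a < c" by linarith
  then show "\<forall>\<^sub>F h in at_right 0. (max (a + h * b) c - max a c) / h = max_gradient c a b"
  proof cases
    case 1
    have "((\<lambda>h. a + h * b) \<longlongrightarrow> a + 0 * b) (at_right 0)" by (intro tendsto_intros)
    then have "\<forall>\<^sub>F h in at_right 0. a + h * b > c" using 1 by (intro order_tendstoD(1)) auto
    then show ?thesis using eventually_at_right_less[of "0::real"]
      by eventually_elim (use 1 in \<open>auto simp: max_gradient_def max_def\<close>)
  next
    case 2
    show ?thesis using eventually_at_right_less[of "0::real"]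
      by eventually_elim (use 2 in \<open>auto simp: max_gradient_def max_def mult_le_0_iff zero_le_mult_iff\<close>)
  next
    case 3
    have "((\<lambda>h. a + h * b) \<longlongrightarrow> a + 0 * b) (at_right 0)" by (intro tendsto_intros)
    then have "\<forall>\<^sub>F h in at_right 0. a + h * b < c" using 3 by (intro order_tendstoD(2)) auto
    then show ?thesis using eventually_at_right_less[of "0::real"]
      by eventually_elim (use 3 in \<open>auto simp: max_gradient_def max_def\<close>)
  qed
qed

lemma max_gradient_measurable [measurable]:
  assumes [measurable]: "a \<in> borel_measurable M" "b \<in> borel_measurable M"
  shows "(\<lambda>x. max_gradient c (a x) (b x)) \<in> borel_measurable M"
  unfolding max_gradient_def by measurable

lemma integrable_max_const:
  fixes u :: "real ^ 2 \<Rightarrow> real"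
  assumes "integrable (leb L) u"
  shows "integrable (leb L) (\<lambda>x. max (u x) c)" "integrable (leb L) (\<lambda>x. max (c - u x) 0)"
proof -
  have c: "integrable (leb L) (\<lambda>x. c)"
    using finite_measure.integrable_const[OF finite_measure_square] .
  show "integrable (leb L) (\<lambda>x. max (u x) c)" by (intro integrable_max assms c)
  show "integrable (leb L) (\<lambda>x. max (c - u x) 0)"
    by (intro integrable_max Bochner_Integration.integrable_diff integrable_zero assms c)
qed

lemma AE_shift_pointwise:
  assumes "0 \<le> h" "h < 2 * L"
  shows "AE x in leb L. x \<in> shiftable bc L i h \<longrightarrow> (\<exists>y. \<forall>u. shift bc L i h u x = u y)"
  using AE_leb_I[OF AE_coordinate_neq[of i "L - h"]]
proof eventually_elim
  case (elim x)
  show ?case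
  proof
    assume x: "x \<in> shiftable bc L i h"
    obtain y where "y \<in> square L" "\<And>u. shift bc L i h u x = u y"
      by (rule shift_pointwise[OF assms x elim]) (rule that)
    then show "\<exists>y. \<forall>u. shift bc L i h u x = u y" by blast
  qed
qed

text \<open>
  For real numbers \<open>a\<close> and \<open>b\<close> the distance \<open>\<bar>a - b\<bar>\<close> is the sum of the distances of the parts above and below \<open>c\<close>, because
  \<open>\<lambda>r. max r c\<close> and \<open>\<lambda>r. min r c\<close> are both monotone. This is the exact additivity of total variation under truncation.
\<close>

lemma incr_max_split:
  assumes "0 \<le> h" "h < 2 * L" and u: "integrable (leb L) u"
  shows "variation bc L i h u =
    variation bc L i h (\<lambda>x. max (u x) c) + variation bc L i h (\<lambda>x. max (c - u x) 0)"
proof -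
  let ?v = "\<lambda>x. max (u x) c" and ?f = "\<lambda>x. max (c - u x) 0"
  have I: "integrable (leb L) (\<lambda>x. \<bar>incr bc L i h ?v x\<bar>)" "integrable (leb L) (\<lambda>x. \<bar>incr bc L i h ?f x\<bar>)"
    "integrable (leb L) (\<lambda>x. \<bar>incr bc L i h u x\<bar>)"
    by (intro integrable_abs integrable_incr integrable_max_const u)+
  have "variation bc L i h u = (LINT x|leb L. \<bar>incr bc L i h ?v x\<bar> + \<bar>incr bc L i h ?f x\<bar>)"
  proof (rule integral_cong_AE)
    show "AE x in leb L. \<bar>incr bc L i h u x\<bar> = \<bar>incr bc L i h ?v x\<bar> + \<bar>incr bc L i h ?f x\<bar>"
      using AE_shift_pointwise[OF assms(1,2), where bc=bc and i=i]
    proof eventually_elim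
      case (elim x)
      show ?case
      proof (cases "x \<in> shiftable bc L i h")
        case True
        then obtain y where "\<And>u. shift bc L i h u x = u y" using elim by blast
        then show ?thesis using True by (auto simp: incr_def)
      qed (simp add: incr_def)
    qed
  qed (use I in auto)
  also have "\<dots> = variation bc L i h ?v + variation bc L i h ?f"
    by (rule Bochner_Integration.integral_add[OF I(1,2)])
  finally show ?thesis .
qed

text \<open>
  Since \<open>\<lambda>r. max r c\<close> does not increase distances, the difference quotient of \<open>max u c\<close> differs from
  \<open>(max (u + h g) c - max u c) / h\<close> by at most \<open>\<bar>incr u / h - g\<bar>\<close>, which tends to zero in \<open>L\<^sup>1\<close>. The latter quotient is
  dominated by \<open>\<bar>g\<bar>\<close> and converges at every point.
\<close>

lemma weak_derivative_max:
  assumes L: "L > 0" and u: "integrable (leb L) u" and g: "integrable (leb L) g"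
    and wg: "\<And>\<phi>. \<phi> \<in> test_functions bc L \<Longrightarrow> (LINT x|leb L. u x * partial i \<phi> x) = - (LINT x|leb L. g x * \<phi> x)"
    and \<phi>: "\<phi> \<in> test_functions bc L"
  shows "(LINT x|leb L. max (u x) c * partial i \<phi> x) = - (LINT x|leb L. max_gradient c (u x) (g x) * \<phi> x)"
proof -
  let ?v = "\<lambda>x. max (u x) c" and ?A = "\<lambda>h. indicat_real (shiftable bc L i h)"
  let ?Q = "\<lambda>h x. (max (u x + h * g x) c - max (u x) c) / h"
  have um: "u \<in> borel_measurable (leb L)" and gm: "g \<in> borel_measurable (leb L)" using u g by auto
  have \<phi>c: "continuous_on UNIV \<phi>" by (rule C1_continuous[OF test_functions_C1[OF \<phi>]])
  have \<phi>m: "\<phi> \<in> borel_measurable (leb L)" by (rule measurable_leb_continuous[OF \<phi>c])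
  obtain B where B: "\<And>x. x \<in> square L \<Longrightarrow> \<bar>\<phi> x\<bar> \<le> B"
    using continuous_bounded_square[OF \<phi>c, of L thesis] by blast
  have v: "integrable (leb L) ?v" by (rule integrable_max_const[OF u])
  have Qb: "\<bar>?Q h x\<bar> \<le> \<bar>g x\<bar>" if "0 < h" for h x
  proof -
    have "\<bar>max (u x + h * g x) c - max (u x) c\<bar> \<le> \<bar>h * g x\<bar>" by linarith
    then show ?thesis using that by (simp add: abs_mult field_simps)
  qed
  have Qm: "?Q h \<in> borel_measurable (leb L)" for h using um gm by measurable
  have AQ: "integrable (leb L) (\<lambda>x. ?A h x * ?Q h x)" if "0 < h" for h
  proof (rule integrable_indicator_mult[OF shiftable_sets(1)])
    show "integrable (leb L) (?Q h)"
      by (rule Bochner_Integration.integrable_bound[OF g Qm]) (use Qb[OF that] in auto)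
  qed
  have 1: "((\<lambda>h. LINT x|leb L. ?A h x * ?Q h x * \<phi> x) \<longlongrightarrow> (LINT x|leb L. max_gradient c (u x) (g x) * \<phi> x)) (at_right 0)"
  proof (rule dominated_convergence_at_right[where w="\<lambda>x. B * \<bar>g x\<bar>"])
    show "(\<lambda>x. ?A h x * ?Q h x * \<phi> x) \<in> borel_measurable (leb L)" if "0 < h" for h
      by (intro borel_measurable_times borel_measurable_integrable[OF AQ[OF that]] \<phi>m)
    show "(\<lambda>x. max_gradient c (u x) (g x) * \<phi> x) \<in> borel_measurable (leb L)"
      using um gm \<phi>m by measurable
    show "AE x in leb L. \<bar>?A h x * ?Q h x * \<phi> x\<bar> \<le> B * \<bar>g x\<bar>" if "0 < h" for h
      using AE_leb_square
    proof eventually_elim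
      case (elim x)
      have "\<bar>?A h x\<bar> * \<bar>?Q h x\<bar> * \<bar>\<phi> x\<bar> \<le> 1 * \<bar>g x\<bar> * B"
        using Qb[OF that] B[OF elim] by (intro mult_mono) (auto simp: indicator_def)
      then show ?case by (simp only: abs_mult mult_1 mult.commute[of B])
    qed
    show "AE x in leb L. ((\<lambda>h. ?A h x * ?Q h x * \<phi> x) \<longlongrightarrow> max_gradient c (u x) (g x) * \<phi> x) (at_right 0)"
      using AE_leb_square
    proof eventually_elim
      case (elim x)
      have "((\<lambda>h. ?A h x) \<longlongrightarrow> 1) (at_right 0)"
        by (rule tendsto_eventually, rule eventually_mono[OF eventually_shiftable[OF elim, of bc i]]) simp
      from tendsto_mult[OF tendsto_mult[OF this max_gradient_tendsto[of "u x" "g x" c]] tendsto_const[of "\<phi> x"]]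
      show ?case by simp
    qed
  qed (use g in auto)
  have 2: "((\<lambda>h. (LINT x|leb L. incr bc L i h ?v x * \<phi> x) / h - (LINT x|leb L. ?A h x * ?Q h x * \<phi> x)) \<longlongrightarrow> 0) (at_right 0)"
  proof (rule Lim_null_comparison)
    have L2: "0 < 2 * L" using L by simp
    show "\<forall>\<^sub>F h in at_right 0. norm ((LINT x|leb L. incr bc L i h ?v x * \<phi> x) / h - (LINT x|leb L. ?A h x * ?Q h x * \<phi> x))
      \<le> B * (LINT x|leb L. \<bar>incr bc L i h u x / h - ?A h x * g x\<bar>)"
      using eventually_at_right_real[OF L2]
    proof eventually_elim
      case (elim h)
      then have h: "0 < h" "0 \<le> h" "h < 2 * L" by auto
      have Iv: "integrable (leb L) (\<lambda>x. incr bc L i h ?v x / h)"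
        by (intro integrable_divide_zero integrable_incr v)
      have Iu: "integrable (leb L) (\<lambda>x. \<bar>incr bc L i h u x / h - ?A h x * g x\<bar>)"
        by (intro integrable_abs Bochner_Integration.integrable_diff integrable_divide_zero integrable_incr u
            integrable_indicator_mult[OF shiftable_sets(1) g])
      have "(LINT x|leb L. incr bc L i h ?v x * \<phi> x) / h = (LINT x|leb L. incr bc L i h ?v x / h * \<phi> x)"
        by simp
      then have eq: "(LINT x|leb L. incr bc L i h ?v x * \<phi> x) / h - (LINT x|leb L. ?A h x * ?Q h x * \<phi> x)
          = (LINT x|leb L. incr bc L i h ?v x / h * \<phi> x - ?A h x * ?Q h x * \<phi> x)"
        using Bochner_Integration.integral_diff[OF integrable_mult_continuous[OF Iv \<phi>c] integrable_mult_continuous[OF AQ[OF h(1)] \<phi>c]]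
        by (simp only:)
      have "norm ((LINT x|leb L. incr bc L i h ?v x * \<phi> x) / h - (LINT x|leb L. ?A h x * ?Q h x * \<phi> x))
          \<le> (LINT x|leb L. \<bar>incr bc L i h ?v x / h * \<phi> x - ?A h x * ?Q h x * \<phi> x\<bar>)"
        unfolding eq real_norm_def by (rule integral_abs_bound)
      also have "\<dots> \<le> (LINT x|leb L. B * \<bar>incr bc L i h u x / h - ?A h x * g x\<bar>)"
      proof (rule integral_mono_AE)
        show "integrable (leb L) (\<lambda>x. \<bar>incr bc L i h ?v x / h * \<phi> x - ?A h x * ?Q h x * \<phi> x\<bar>)"
          by (intro integrable_abs Bochner_Integration.integrable_diff integrable_mult_continuous Iv AQ h \<phi>c)
        show "integrable (leb L) (\<lambda>x. B * \<bar>incr bc L i h u x / h - ?A h x * g x\<bar>)"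
          using Iu by (rule integrable_mult_right)
        show "AE x in leb L. \<bar>incr bc L i h ?v x / h * \<phi> x - ?A h x * ?Q h x * \<phi> x\<bar>
            \<le> B * \<bar>incr bc L i h u x / h - ?A h x * g x\<bar>"
          using AE_shift_pointwise[OF h(2,3), where bc=bc and i=i] AE_leb_square
        proof eventually_elim
          case (elim x)
          have "\<bar>incr bc L i h ?v x / h - ?A h x * ?Q h x\<bar> \<le> \<bar>incr bc L i h u x / h - ?A h x * g x\<bar>"
          proof (cases "x \<in> shiftable bc L i h")
            case True
            then obtain y where y: "\<And>u. shift bc L i h u x = u y" using elim by blast
            have l: "incr bc L i h ?v x / h - ?A h x * ?Q h x = (max (u y) c - max (u x + h * g x) c) / h"
              using True by (simp add: incr_def y diff_divide_distrib)
            have r: "incr bc L i h u x / h - ?A h x * g x = (u y - (u x + h * g x)) / h"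
              using True h by (simp add: incr_def y field_simps)
            show ?thesis unfolding l r abs_divide using h by (intro divide_right_mono) linarith+
          qed (simp add: incr_def)
          then have "\<bar>incr bc L i h ?v x / h - ?A h x * ?Q h x\<bar> * \<bar>\<phi> x\<bar> \<le> \<bar>incr bc L i h u x / h - ?A h x * g x\<bar> * B"
            using B[of x] elim by (intro mult_mono) auto
          then show ?case by (simp only: abs_mult[symmetric] left_diff_distrib mult.commute[of B])
        qed
      qed
      also have "\<dots> = B * (LINT x|leb L. \<bar>incr bc L i h u x / h - ?A h x * g x\<bar>)"
        by (rule integral_mult_right_zero)
      finally show ?case .
    qed
    show "((\<lambda>h. B * (LINT x|leb L. \<bar>incr bc L i h u x / h - ?A h x * g x\<bar>)) \<longlongrightarrow> 0) (at_right 0)"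
      using tendsto_mult_left[OF difference_quotient_L1_tendsto[OF L u g wg], where c=B] by simp
  qed
  have "((\<lambda>h. (LINT x|leb L. incr bc L i h ?v x * \<phi> x) / h) \<longlongrightarrow> (LINT x|leb L. max_gradient c (u x) (g x) * \<phi> x)) (at_right 0)"
    using tendsto_add[OF 2 1] by simp
  then have "(LINT x|leb L. max_gradient c (u x) (g x) * \<phi> x) = - (LINT x|leb L. ?v x * partial i \<phi> x)"
    using incr_tendsto_test[OF L v \<phi>] by (rule tendsto_unique[rotated]) simp
  then show ?thesis by simp
qed

section \<open>Energy released by truncation\<close>

lemma L2_max_const:
  assumes "w \<in> L2 L"
  shows "(\<lambda>x. max (w x) c) \<in> L2 L" and "(\<lambda>x. max (c - w x) 0) \<in> L2 L"
proof -
  have m: "w \<in> borel_measurable (leb L)" and i: "integrable (leb L) (\<lambda>x. (w x)\<^sup>2)"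
    using assms unfolding L2_def by blast+
  have "integrable (leb L) (\<lambda>x. c\<^sup>2)"
    using finite_measure.integrable_const[OF finite_measure_square] .
  then have b: "integrable (leb L) (\<lambda>x. 2 * (w x)\<^sup>2 + 2 * c\<^sup>2)" using i by auto
  have "integrable (leb L) (\<lambda>x. (max (w x) c)\<^sup>2)"
    by (rule Bochner_Integration.integrable_bound[OF b]) (use m in \<open>auto simp: max_def\<close>)
  then show "(\<lambda>x. max (w x) c) \<in> L2 L" using m unfolding L2_def by simp
  have "(max (c - w x) 0)\<^sup>2 \<le> 2 * (w x)\<^sup>2 + 2 * c\<^sup>2" for x
  proof -
    have "(max (c - w x) 0)\<^sup>2 \<le> (c - w x)\<^sup>2" by (auto simp: max_def)
    moreover have "0 \<le> (c + w x)\<^sup>2" by simp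
    ultimately show ?thesis by (simp add: power2_eq_square algebra_simps)
  qed
  then have "integrable (leb L) (\<lambda>x. (max (c - w x) 0)\<^sup>2)"
    by (intro Bochner_Integration.integrable_bound[OF b]) (use m in auto)
  then show "(\<lambda>x. max (c - w x) 0) \<in> L2 L" using m unfolding L2_def by simp
qed

lemma test_functions_separate:
  assumes L: "L > 0" and g: "integrable (leb L) g"
    and zero: "\<And>\<phi>. \<phi> \<in> test_functions bc L \<Longrightarrow> (LINT x|leb L. g x * \<phi> x) = 0"
  shows "AE x in leb L. g x = 0"
proof -
  have g0: "g x = 0" if "x \<in> square L" "x \<notin> shiftable bc L 1 0" for x
    using that by (simp add: shiftable_def)
  have h: "(0::real) \<le> 0" "0 < 2 * L" using L by auto
  obtain \<psi> :: "nat \<Rightarrow> real ^ 2 \<Rightarrow> real" where \<psi>: "\<And>n. \<psi> n \<in> shift_tests bc L 1 0" "\<And>n x. \<bar>\<psi> n x\<bar> \<le> 1"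
    "(\<lambda>n. LINT x|leb L. g x * \<psi> n x) \<longlonglongrightarrow> (LINT x|leb L. \<bar>g x\<bar>)"
    by (rule L1_norm_dual[OF L h g g0]) (assumption, assumption, rule that)
  have "(LINT x|leb L. g x * \<psi> n x) = 0" for n
    by (rule zero[OF shift_tests_test[OF \<psi>(1) order_refl]])
  then have "(LINT x|leb L. \<bar>g x\<bar>) = 0" using \<psi>(3) by (simp add: LIMSEQ_const_iff)
  then have "AE x in leb L. \<bar>g x\<bar> = 0"
    using integral_nonneg_eq_0_iff_AE[of "leb L" "\<lambda>x. \<bar>g x\<bar>"] g by simp
  then show ?thesis by simp
qed

text \<open>
  The energy refers to a chosen weak gradient. Uniqueness allows it to be computed with the explicit weak gradient of a
  truncation.
\<close>

lemma weak_gradient_unique: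
  assumes L: "L > 0" and g: "has_weak_gradient bc L u g" and g': "has_weak_gradient bc L u g'"
  shows "AE x in leb L. g x = g' x"
proof -
  have i: "integrable (leb L) (\<lambda>x. g x $ i)" "integrable (leb L) (\<lambda>x. g' x $ i)" for i
    using g g' by (auto simp: has_weak_gradient_def intro: L2_imp_integrable)
  have "AE x in leb L. g x $ i - g' x $ i = 0" for i
  proof (rule test_functions_separate[OF L])
    show "integrable (leb L) (\<lambda>x. g x $ i - g' x $ i)" using i by auto
    fix \<phi> assume \<phi>: "\<phi> \<in> test_functions bc L"
    have c: "continuous_on UNIV \<phi>" by (rule C1_continuous[OF test_functions_C1[OF \<phi>]])
    show "(LINT x|leb L. (g x $ i - g' x $ i) * \<phi> x) = 0"
      unfolding left_diff_distrib
      using weak_gradient_test[OF g \<phi>, of i] weak_gradient_test[OF g' \<phi>, of i]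
      by (subst Bochner_Integration.integral_diff[OF integrable_mult_continuous[OF i(1) c] integrable_mult_continuous[OF i(2) c]]) simp
  qed
  from this[of 1] this[of 2] show ?thesis
    by eventually_elim (simp add: vec_eq_iff forall_2)
qed

text \<open>
  Choose a field \<open>z\<close> that nearly attains the total variation of \<open>v = max w c\<close>. Increments of \<open>v\<close> are then at least about
  \<open>h TV v\<close>, by testing with \<open>z\<close>, while increments of \<open>w\<close> are at most \<open>h TV w\<close>. By the splitting identity, what remains
  for \<open>f\<close> is at most \<open>h (TV w - TV v)\<close> up to a small error, and the subgradient inequality bounds this by
  \<open>- h \<langle>\<xi>, f\<rangle>\<close>.
\<close>

lemma tv_subgradient_truncation:
  fixes c :: real
  assumes L: "L > 0" and \<xi>: "\<xi> \<in> L2_subdifferential L (anisotropic_tv bc L) w" and \<eta>: "\<eta> > 0"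
  defines "f \<equiv> \<lambda>x. max (c - w x) 0"
  shows "\<forall>\<^sub>F h in at_right 0. variation bc L 1 h f + variation bc L 2 h f
            \<le> h * (- L2_inner L \<xi> f + \<eta>)"
proof -
  define v where "v = (\<lambda>x. max (w x) c)"
  let ?Z = "{z. (\<forall>i. (\<lambda>x. z x $ i) \<in> test_functions bc L) \<and> (\<forall>x. max \<bar>z x $ 1\<bar> \<bar>z x $ 2\<bar> \<le> 1)}"
  have wL2: "w \<in> L2 L" and fin: "\<bar>anisotropic_tv bc L w\<bar> \<noteq> \<infinity>"
    and sub: "\<And>v. v \<in> L2 L \<Longrightarrow> anisotropic_tv bc L w + ereal (L2_inner L \<xi> (\<lambda>x. v x - w x)) \<le> anisotropic_tv bc L v"
    using \<xi> by (auto simp: L2_subdifferential_def)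
  have w: "integrable (leb L) w" by (rule L2_imp_integrable[OF wL2])
  have v: "integrable (leb L) v" unfolding v_def by (rule integrable_max_const[OF w])
  obtain T where T: "anisotropic_tv bc L w = ereal T" using fin by auto
  define P where "P = L2_inner L \<xi> f"
  have vf: "(\<lambda>x. v x - w x) = f" by (auto simp: v_def f_def fun_eq_iff)
  have TP: "ereal (T + P) \<le> anisotropic_tv bc L v"
    using sub[of v] L2_max_const(1)[OF wL2, of c, folded v_def] by (simp add: T P_def vf)
  have div: "(LINT x|leb L. u x * divergence z x) =
      (LINT x|leb L. u x * partial 1 (\<lambda>x. z x $ 1) x) + (LINT x|leb L. u x * partial 2 (\<lambda>x. z x $ 2) x)"
    if "\<And>i. (\<lambda>x. z x $ i) \<in> test_functions bc L" "integrable (leb L) u" for u and z :: "real ^ 2 \<Rightarrow> real ^ 2"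
    unfolding divergence_def sum_2 distrib_left
    by (intro Bochner_Integration.integral_add integrable_mult_continuous that(2)
        C1_partial_continuous[OF test_functions_C1[OF that(1)]])
  have up: "(LINT x|leb L. w x * partial 1 \<phi>1 x) + (LINT x|leb L. w x * partial 2 \<phi>2 x) \<le> T"
    if t: "\<phi>1 \<in> test_functions bc L" "\<phi>2 \<in> test_functions bc L" and b: "\<And>x. \<bar>\<phi>1 x\<bar> \<le> 1" "\<And>x. \<bar>\<phi>2 x\<bar> \<le> 1" for \<phi>1 \<phi>2
  proof -
    define z :: "real ^ 2 \<Rightarrow> real ^ 2" where "z x = (\<chi> i. if i = 1 then \<phi>1 x else \<phi>2 x)" for x
    have z1: "(\<lambda>x. z x $ 1) = \<phi>1" and z2: "(\<lambda>x. z x $ 2) = \<phi>2" by (auto simp: z_def)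
    have zt: "(\<lambda>x. z x $ i) \<in> test_functions bc L" for i using exhaust_2[of i] z1 z2 t by metis
    have "z \<in> ?Z" using zt b by (simp add: z_def)
    then have "ereal (LINT x|leb L. w x * divergence z x) \<le> anisotropic_tv bc L w"
      unfolding anisotropic_tv_def by (rule SUP_upper)
    then show ?thesis unfolding div[OF zt w] z1 z2 T by simp
  qed
  have "ereal (T + P - \<eta> / 2) < anisotropic_tv bc L v"
    using \<eta> by (intro less_le_trans[OF _ TP]) simp
  then obtain z where z: "z \<in> ?Z" "T + P - \<eta> / 2 < (LINT x|leb L. v x * divergence z x)"
    unfolding anisotropic_tv_def less_SUP_iff by auto
  have zt: "(\<lambda>x. z x $ i) \<in> test_functions bc L" for i using z by auto
  have zb: "\<bar>z x $ i\<bar> \<le> 1" for x i using z exhaust_2[of i] by auto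
  let ?I = "\<lambda>i h. LINT x|leb L. incr bc L i h v x * (z x $ i)"
  have "((\<lambda>h. - (?I 1 h / h + ?I 2 h / h)) \<longlongrightarrow> (LINT x|leb L. v x * divergence z x)) (at_right 0)"
    using tendsto_minus[OF tendsto_add[OF incr_tendsto_test[OF L v zt[of 1], of 1] incr_tendsto_test[OF L v zt[of 2], of 2]]]
    unfolding div[OF zt v] by (simp only: minus_add_distrib minus_minus)
  then have ev: "\<forall>\<^sub>F h in at_right 0. T + P - \<eta> / 2 < - (?I 1 h / h + ?I 2 h / h)"
    using z(2) by (rule order_tendstoD(1))
  have L2: "0 < 2 * L" using L by simp
  show ?thesis using ev eventually_at_right_real[OF L2]
  proof eventually_elim
    case (elim h)
    then have h: "0 < h" "0 \<le> h" "h < 2 * L" by auto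
    let ?V = "\<lambda>i u. LINT x|leb L. \<bar>incr bc L i h u x\<bar>"
    have Ib: "- ?I i h \<le> ?V i v" for i
    proof -
      have "- ?I i h \<le> \<bar>?I i h\<bar>" by simp
      also have "\<dots> \<le> (LINT x|leb L. \<bar>incr bc L i h v x * (z x $ i)\<bar>)" by (rule integral_abs_bound)
      also have "\<dots> \<le> ?V i v"
        using integrable_incr[OF v] zb
        by (intro integral_mono integrable_abs integrable_mult_continuous C1_continuous[OF test_functions_C1[OF zt]])
           (auto simp: abs_mult intro!: mult_left_le)
      finally show ?thesis .
    qed
    have "h * (T + P - \<eta> / 2) \<le> h * (- (?I 1 h / h + ?I 2 h / h))"
      using elim h by (intro mult_left_mono) auto
    also have "\<dots> = - ?I 1 h + - ?I 2 h" using h by (simp add: field_simps)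
    also have "\<dots> \<le> ?V 1 v + ?V 2 v" by (intro add_mono Ib)
    finally have Vv: "h * (T + P - \<eta> / 2) \<le> ?V 1 v + ?V 2 v" .
    have Vw: "?V 1 w + ?V 2 w \<le> h * T" by (rule incr_variation_le[OF L h(1,3) w up])
    have split: "?V i w = ?V i v + ?V i f" for i
      unfolding v_def f_def by (rule incr_max_split[OF h(2,3) w])
    have "?V 1 f + ?V 2 f \<le> h * T - h * (T + P - \<eta> / 2)"
      using Vv Vw split[of 1] split[of 2] by linarith
    also have "\<dots> \<le> h * (- P + \<eta>)" using h \<eta> by (simp add: algebra_simps)
    finally show ?case unfolding P_def .
  qed
qed

lemma has_weak_gradient_max:
  assumes L: "L > 0" and w: "w \<in> L2 L" and g: "has_weak_gradient bc L w g"
  shows "has_weak_gradient bc L (\<lambda>x. max (w x) c) (\<lambda>x. \<chi> i. max_gradient c (w x) (g x $ i))"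
  unfolding has_weak_gradient_def
proof (intro conjI allI ballI)
  have gL2: "(\<lambda>x. g x $ i) \<in> L2 L" for i using g by (auto simp: has_weak_gradient_def)
  show "(\<lambda>x. (\<chi> i. max_gradient c (w x) (g x $ i)) $ i) \<in> L2 L" for i
  proof -
    have m: "w \<in> borel_measurable (leb L)" "(\<lambda>x. g x $ i) \<in> borel_measurable (leb L)"
      and q: "integrable (leb L) (\<lambda>x. (g x $ i)\<^sup>2)"
      using w gL2[of i] unfolding L2_def by blast+
    have mm: "(\<lambda>x. max_gradient c (w x) (g x $ i)) \<in> borel_measurable (leb L)"
      by (rule max_gradient_measurable[OF m])
    have "integrable (leb L) (\<lambda>x. (max_gradient c (w x) (g x $ i))\<^sup>2)"
      by (rule Bochner_Integration.integrable_bound[OF q]) (use mm max_gradient_abs in \<open>auto simp: abs_le_square_iff[symmetric]\<close>)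
    then show ?thesis using mm unfolding L2_def by simp
  qed
  fix \<phi> i assume \<phi>: "\<phi> \<in> test_functions bc L"
  show "L2_inner L (\<lambda>x. max (w x) c) (partial i \<phi>) =
      - L2_inner L (\<lambda>x. (\<chi> i. max_gradient c (w x) (g x $ i)) $ i) \<phi>"
    unfolding L2_inner_def
    using weak_derivative_max[OF L L2_imp_integrable[OF w] L2_imp_integrable[OF gL2[of i]] weak_gradient_test[OF g] \<phi>, where c=c]
    by simp
qed

text \<open>
  The variations of \<open>w\<close> and of \<open>v = max w c\<close> divided by \<open>h\<close> converge to the \<open>L\<^sup>1\<close> norms of their weak derivatives, so the
  splitting identity gives the limit for \<open>f\<close>. In the subgradient inequality the Dirichlet terms have the favourable sign,
  because truncation increases no component of the gradient in absolute value.
\<close>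

lemma dirichlet_subgradient_truncation:
  fixes c :: real
  assumes L: "L > 0" and \<gamma>: "\<gamma> > 0" and \<xi>: "\<xi> \<in> L2_subdifferential L (dirichlet_tv_energy bc L \<gamma>) w" and \<eta>: "\<eta> > 0"
  defines "f \<equiv> \<lambda>x. max (c - w x) 0"
  shows "\<forall>\<^sub>F h in at_right 0. variation bc L 1 h f + variation bc L 2 h f
            \<le> h * (- L2_inner L \<xi> f + \<eta>)"
proof -
  define v where "v = (\<lambda>x. max (w x) c)"
  have wL2: "w \<in> L2 L" and fin: "\<bar>dirichlet_tv_energy bc L \<gamma> w\<bar> \<noteq> \<infinity>"
    and sub: "\<And>v. v \<in> L2 L \<Longrightarrow> dirichlet_tv_energy bc L \<gamma> w + ereal (L2_inner L \<xi> (\<lambda>x. v x - w x)) \<le> dirichlet_tv_energy bc L \<gamma> v"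
    using \<xi> by (auto simp: L2_subdifferential_def)
  have w: "integrable (leb L) w" by (rule L2_imp_integrable[OF wL2])
  have vL2: "v \<in> L2 L" unfolding v_def by (rule L2_max_const[OF wL2])
  have v: "integrable (leb L) v" by (rule L2_imp_integrable[OF vL2])
  define P where "P = L2_inner L \<xi> f"
  have vf: "(\<lambda>x. v x - w x) = f" by (auto simp: v_def f_def fun_eq_iff)
  have wH: "w \<in> H1 bc L" using fin by (auto simp: dirichlet_tv_energy_def split: if_splits)
  define g where "g = weak_gradient bc L w"
  obtain q where "has_weak_gradient bc L w q" using wH by (auto simp: H1_def)
  then have g: "has_weak_gradient bc L w g" unfolding g_def weak_gradient_def by (rule someI[of "has_weak_gradient bc L w"])
  define G where "G = (\<lambda>x. \<chi> i. max_gradient c (w x) (g x $ i))"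
  have G: "has_weak_gradient bc L v G" unfolding v_def G_def by (rule has_weak_gradient_max[OF L wL2 g])
  then have vH: "v \<in> H1 bc L" using vL2 by (auto simp: H1_def)
  have G': "has_weak_gradient bc L v (weak_gradient bc L v)"
    unfolding weak_gradient_def using G by (rule someI[of "has_weak_gradient bc L v"])
  have L2c: "(\<lambda>x. q x $ i) \<in> L2 L" if "has_weak_gradient bc L u q" for u q i
    using that by (auto simp: has_weak_gradient_def)
  have i1: "integrable (leb L) (\<lambda>x. \<bar>q x $ i\<bar>)" if "has_weak_gradient bc L u q" for u q i
    using L2_imp_integrable[OF L2c[OF that]] by auto
  have nsq: "(norm (y :: real ^ 2))\<^sup>2 = (y $ 1)\<^sup>2 + (y $ 2)\<^sup>2" for y
    unfolding power2_norm_eq_inner inner_vec_def by (simp add: sum_2 power2_eq_square)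
  have i2: "integrable (leb L) (\<lambda>x. \<gamma> / 2 * (norm (q x))\<^sup>2)" if "has_weak_gradient bc L u q" for u q
    unfolding nsq using L2c[OF that, of 1] L2c[OF that, of 2] by (auto simp: L2_def)
  have E: "(LINT x|leb L. \<gamma> / 2 * (norm (q x))\<^sup>2 + \<bar>q x $ 1\<bar> + \<bar>q x $ 2\<bar>) =
     (LINT x|leb L. \<gamma> / 2 * (norm (q x))\<^sup>2) + (LINT x|leb L. \<bar>q x $ 1\<bar>) + (LINT x|leb L. \<bar>q x $ 2\<bar>)"
    if "has_weak_gradient bc L u q" for u q
    using i1[OF that] i2[OF that]
    by (subst Bochner_Integration.integral_add; (subst Bochner_Integration.integral_add)?; auto)
  have "(LINT x|leb L. \<gamma> / 2 * (norm (weak_gradient bc L v x))\<^sup>2 + \<bar>weak_gradient bc L v x $ 1\<bar> + \<bar>weak_gradient bc L v x $ 2\<bar>)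
    = (LINT x|leb L. \<gamma> / 2 * (norm (G x))\<^sup>2 + \<bar>G x $ 1\<bar> + \<bar>G x $ 2\<bar>)"
    by (rule integral_cong_AE)
       (use weak_gradient_unique[OF L G' G] i1[OF G] i2[OF G] i1[OF G'] i2[OF G'] in \<open>auto elim: eventually_mono\<close>)
  then have "(LINT x|leb L. \<gamma> / 2 * (norm (g x))\<^sup>2 + \<bar>g x $ 1\<bar> + \<bar>g x $ 2\<bar>) + P
    \<le> (LINT x|leb L. \<gamma> / 2 * (norm (G x))\<^sup>2 + \<bar>G x $ 1\<bar> + \<bar>G x $ 2\<bar>)"
    using sub[OF vL2] wH vH unfolding dirichlet_tv_energy_def vf P_def g_def[symmetric] by simp
  moreover have "(LINT x|leb L. \<gamma> / 2 * (norm (G x))\<^sup>2) \<le> (LINT x|leb L. \<gamma> / 2 * (norm (g x))\<^sup>2)"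
  proof (rule integral_mono[OF i2[OF G] i2[OF g]])
    fix x
    have "\<bar>G x $ i\<bar> \<le> \<bar>g x $ i\<bar>" for i by (simp add: G_def max_gradient_abs)
    then have "(norm (G x))\<^sup>2 \<le> (norm (g x))\<^sup>2" unfolding nsq by (intro add_mono) (simp_all add: abs_le_square_iff[symmetric])
    then show "\<gamma> / 2 * (norm (G x))\<^sup>2 \<le> \<gamma> / 2 * (norm (g x))\<^sup>2" using \<gamma> by (intro mult_left_mono) auto
  qed
  ultimately have diff: "((LINT x|leb L. \<bar>g x $ 1\<bar>) + (LINT x|leb L. \<bar>g x $ 2\<bar>))
     - ((LINT x|leb L. \<bar>G x $ 1\<bar>) + (LINT x|leb L. \<bar>G x $ 2\<bar>)) < - P + \<eta>"
    unfolding E[OF g] E[OF G] using \<eta> by linarith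
  let ?V = "\<lambda>i h u. LINT x|leb L. \<bar>incr bc L i h u x\<bar>"
  have lw: "((\<lambda>h. ?V i h w / h) \<longlongrightarrow> (LINT x|leb L. \<bar>g x $ i\<bar>)) (at_right 0)" for i
    by (rule variation_tendsto[OF L w L2_imp_integrable[OF L2c[OF g]] weak_gradient_test[OF g]])
  have lv: "((\<lambda>h. ?V i h v / h) \<longlongrightarrow> (LINT x|leb L. \<bar>G x $ i\<bar>)) (at_right 0)" for i
    by (rule variation_tendsto[OF L v L2_imp_integrable[OF L2c[OF G]] weak_gradient_test[OF G]])
  have ev: "\<forall>\<^sub>F h in at_right 0. (?V 1 h w / h + ?V 2 h w / h) - (?V 1 h v / h + ?V 2 h v / h) < - P + \<eta>"
    by (rule order_tendstoD(2)[OF tendsto_diff[OF tendsto_add[OF lw lw] tendsto_add[OF lv lv]] diff])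
  have L2: "0 < 2 * L" using L by simp
  show ?thesis using ev eventually_at_right_real[OF L2]
  proof eventually_elim
    case (elim h)
    then have h: "0 < h" "0 \<le> h" "h < 2 * L" by auto
    have split: "?V i h w = ?V i h v + ?V i h f" for i
      unfolding v_def f_def by (rule incr_max_split[OF h(2,3) w])
    have "(?V 1 h f + ?V 2 h f) / h < - P + \<eta>"
      using elim(1) unfolding split add_divide_distrib by linarith
    then show ?case using h unfolding P_def by (simp add: field_simps)
  qed
qed

section \<open>A minimum set of measure zero\<close>

lemma energy_subgradient_truncation:
  fixes c :: real
  assumes "L > 0" and "\<gamma> \<ge> 0" and "\<xi> \<in> L2_subdifferential L (energy bc L \<gamma>) w" and "\<eta> > 0"
  defines "f \<equiv> \<lambda>x. max (c - w x) 0"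
  shows "\<forall>\<^sub>F h in at_right 0. variation bc L 1 h f + variation bc L 2 h f
            \<le> h * (- L2_inner L \<xi> f + \<eta>)"
proof (cases "\<gamma> > 0")
  case True
  then have "energy bc L \<gamma> = dirichlet_tv_energy bc L \<gamma>" by (auto simp: energy_def)
  then show ?thesis unfolding f_def using dirichlet_subgradient_truncation[OF assms(1) True _ assms(4)] assms(3) by simp
next
  case False
  then have "energy bc L \<gamma> = anisotropic_tv bc L" by (auto simp: energy_def)
  then show ?thesis unfolding f_def using tv_subgradient_truncation[OF assms(1) _ assms(4)] assms(3) by simp
qed

lemma integral_Cauchy_Schwarz:
  assumes "integrable M (\<lambda>x. (f x)\<^sup>2)" "integrable M (\<lambda>x. (g x)\<^sup>2)" "integrable M (\<lambda>x. f x * g x :: real)"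
  shows "\<bar>LINT x|M. f x * g x\<bar> \<le> sqrt (LINT x|M. (f x)\<^sup>2) * sqrt (LINT x|M. (g x)\<^sup>2)"
proof -
  define A B C where "A = (LINT x|M. (f x)\<^sup>2)" and "B = (LINT x|M. (g x)\<^sup>2)" and "C = (LINT x|M. f x * g x)"
  have q: "0 \<le> A - 2 * s * C + s\<^sup>2 * B" for s
  proof -
    have "0 \<le> (LINT x|M. (f x - s * g x)\<^sup>2)" by simp
    also have "\<dots> = (LINT x|M. (f x)\<^sup>2 - 2 * s * (f x * g x) + s\<^sup>2 * (g x)\<^sup>2)"
      by (intro Bochner_Integration.integral_cong) (auto simp: power2_eq_square algebra_simps)
    also have "\<dots> = A - 2 * s * C + s\<^sup>2 * B"
      using assms by (simp add: A_def B_def C_def)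
    finally show ?thesis .
  qed
  have A: "0 \<le> A" and B: "0 \<le> B" by (simp_all add: A_def B_def)
  have "C\<^sup>2 \<le> A * B"
  proof (cases "B = 0")
    case True
    have "C = 0"
    proof (rule ccontr)
      assume "C \<noteq> 0"
      then show False using q[of "(A + 1) / (2 * C)"] A True by simp
    qed
    then show ?thesis using A B by simp
  next
    case False
    then show ?thesis using q[of "C / B"] B by (simp add: field_simps power2_eq_square)
  qed
  then have "\<bar>C\<bar> \<le> sqrt (A * B)" by (rule real_le_rsqrt[OF power2_abs[THEN ord_eq_le_trans]])
  then show ?thesis by (simp add: A_def B_def C_def real_sqrt_mult)
qed

text \<open>
  The increments in the Sobolev inequality do not cross the boundary of the square. They are among those counted by
  \<open>variation\<close>, which in the periodic case also counts increments across the boundary.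
\<close>

lemma sobolev_square_incr:
  assumes L: "L > 0" and f: "integrable (leb L) f"
    and nn: "\<And>x. x \<in> square L \<Longrightarrow> 0 \<le> f x" and B: "\<And>x. x \<in> square L \<Longrightarrow> f x \<le> B"
    and T: "\<And>i. \<forall>\<^sub>F h in at_right 0. variation bc L i h f \<le> h * T"
  shows "(LINT x|leb L. (f x)\<^sup>2) \<le> ((LINT x|leb L. f x) / (2 * L) + T)\<^sup>2"
proof -
  have f0: "integrable lebesgue (zext L f)" using f by (simp add: integrable_zext)
  have sq: "(zext L f x)\<^sup>2 = zext L (\<lambda>x. (f x)\<^sup>2) x" for x by (cases "x \<in> square L") auto
  have L2: "0 < 2 * L" using L by simp
  have "(LINT x|lebesgue. (zext L f x)\<^sup>2) \<le> ((LINT x|lebesgue. zext L f x) / (2 * L) + T)\<^sup>2"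
  proof (rule sobolev_square[OF L f0])
    show "0 \<le> zext L f x" for x using nn by (cases "x \<in> square L") auto
    show "zext L f x \<le> max B 0" for x using B[of x] by (cases "x \<in> square L") auto
    show "zext L f x = 0" if "x \<notin> square L" for x using that by simp
    fix i
    show "\<forall>\<^sub>F h in at_right 0. (LINT x|lebesgue. indicat_real {x \<in> square L. x + axis i h \<in> square L} x
        * \<bar>zext L f (x + axis i h) - zext L f x\<bar>) \<le> h * T"
      using T[of i] eventually_at_right_real[OF L2]
    proof eventually_elim
      case (elim h)
      have N: "{x \<in> square L. x + axis i h \<in> square L} = shiftable Neumann L i h"
        by (auto simp: shiftable_def)
      have fT: "integrable lebesgue (\<lambda>x. \<bar>zext L f (x + axis i h) - zext L f x\<bar>)"
        using integrable_translation[OF f0, of "axis i h"] f0 by auto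
      have "(LINT x|lebesgue. indicat_real (shiftable Neumann L i h) x * \<bar>zext L f (x + axis i h) - zext L f x\<bar>)
         \<le> (LINT x|lebesgue. zext L (\<lambda>x. \<bar>incr bc L i h f x\<bar>) x)"
      proof (rule integral_mono)
        show "integrable lebesgue (\<lambda>x. indicat_real (shiftable Neumann L i h) x * \<bar>zext L f (x + axis i h) - zext L f x\<bar>)"
          by (rule integrable_indicator_mult[OF shiftable_sets(2) fT])
        show "integrable lebesgue (zext L (\<lambda>x. \<bar>incr bc L i h f x\<bar>))"
          using integrable_incr[OF f] by (simp add: integrable_zext[symmetric])
        fix x
        show "indicat_real (shiftable Neumann L i h) x * \<bar>zext L f (x + axis i h) - zext L f x\<bar>
            \<le> zext L (\<lambda>x. \<bar>incr bc L i h f x\<bar>) x"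
        proof (cases "x \<in> shiftable Neumann L i h")
          case True
          then have x: "x \<in> square L" "x + axis i h \<in> square L" "x \<in> shiftable bc L i h"
            by (auto simp: shiftable_def)
          then have "(x + axis i h) $ i < L" unfolding square_def by blast
          then have "(x + axis i (h - 2 * L)) $ i < - L" by (simp add: axis_def)
          then have "x + axis i (h - 2 * L) \<notin> square L"
            unfolding square_def using less_asym by blast
          then show ?thesis using True x by (simp add: incr_def shift_def)
        next
          case False
          then show ?thesis by (cases "x \<in> square L") auto
        qed
      qed
      also have "\<dots> = variation bc L i h f" by (rule integral_zext[symmetric])
      finally show ?case using elim unfolding N by linarith
    qed
  qed
  then show ?thesis by (simp only: sq integral_zext[symmetric])
qed

lemma sublevel_integral_tendsto_0:
  fixes q w :: "real ^ 2 \<Rightarrow> real"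
  assumes q: "integrable (leb L) q" and w: "w \<in> borel_measurable (leb L)"
    and m: "\<And>x. x \<in> square L \<Longrightarrow> m \<le> w x" and ne: "AE x in leb L. w x \<noteq> m"
  shows "((\<lambda>e. LINT x|leb L. indicat_real {x. w x < m + e} x * q x) \<longlongrightarrow> 0) (at_right 0)"
proof -
  have meas: "(\<lambda>x. indicat_real {x. w x < m + e} x * q x) \<in> borel_measurable (leb L)" for e
  proof -
    have "{x \<in> space (leb L). w x < m + e} \<in> sets (leb L)" using w by measurable
    then have "(\<lambda>x. indicat_real {x \<in> space (leb L). w x < m + e} x * q x) \<in> borel_measurable (leb L)"
      using q by (intro borel_measurable_times borel_measurable_indicator) auto
    then show ?thesis by (rule measurable_cong[THEN iffD1, rotated]) (auto simp: indicator_def)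
  qed
  have "((\<lambda>e. LINT x|leb L. indicat_real {x. w x < m + e} x * q x) \<longlongrightarrow> (LINT x|leb L. 0)) (at_right 0)"
  proof (rule dominated_convergence_at_right[where w="\<lambda>x. \<bar>q x\<bar>"])
    show "AE x in leb L. ((\<lambda>e. indicat_real {x. w x < m + e} x * q x) \<longlongrightarrow> 0) (at_right 0)"
      using ne AE_leb_square
    proof eventually_elim
      case (elim x)
      then have "0 < w x - m" using m[of x] by simp
      from eventually_at_right_real[OF this]
      have "\<forall>\<^sub>F e in at_right 0. indicat_real {x. w x < m + e} x * q x = 0"
        by eventually_elim auto
      then show ?case by (rule tendsto_eventually)
    qed
    show "AE x in leb L. \<bar>indicat_real {x. w x < m + e} x * q x\<bar> \<le> \<bar>q x\<bar>" for e
      by (auto simp: indicator_def)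
  qed (use q meas in auto)
  then show ?thesis by simp
qed

text \<open>
  The main estimate. Let \<open>X\<close> be the \<open>L\<^sup>2\<close> norm of \<open>f = max (m + e - w) 0\<close>, let \<open>F\<close> be its integral and \<open>P = - \<langle>\<xi>, f\<rangle>\<close>. The
  Sobolev inequality says \<open>X \<le> F / (2L) + P\<close>. As \<open>f\<close> vanishes off \<open>{w < m + e}\<close>, the Cauchy-Schwarz inequality bounds
  \<open>F / (2L)\<close> and \<open>P\<close> by \<open>X / 4\<close> each, once the measure of that set is below \<open>L\<^sup>2 / 4\<close> and the integral of \<open>\<xi>\<^sup>2\<close> over it below
  \<open>1 / 16\<close>. Hence \<open>X \<le> X / 2\<close>, and \<open>X = 0\<close>.
\<close>

lemma null_minimum_set_gap:
  assumes L: "L > 0" and \<gamma>: "\<gamma> \<ge> 0" and \<xi>: "\<xi> \<in> L2_subdifferential L (energy bc L \<gamma>) w"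
    and m: "\<And>x. x \<in> square L \<Longrightarrow> m \<le> w x" and ne: "AE x in leb L. w x \<noteq> m"
  obtains e where "e > 0" "AE x in leb L. m + e \<le> w x"
proof -
  have wL2: "w \<in> L2 L" and \<xi>L2: "\<xi> \<in> L2 L" using \<xi> by (auto simp: L2_subdifferential_def)
  have w: "integrable (leb L) w" by (rule L2_imp_integrable[OF wL2])
  have wm: "w \<in> borel_measurable (leb L)" using w by auto
  have one: "integrable (leb L) (\<lambda>x. 1)" using finite_measure.integrable_const[OF finite_measure_square] .
  have \<xi>2: "integrable (leb L) (\<lambda>x. (\<xi> x)\<^sup>2)" and \<xi>m: "\<xi> \<in> borel_measurable (leb L)" using \<xi>L2 unfolding L2_def by blast+
  let ?S = "\<lambda>e. {x. w x < m + e}"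
  have "\<forall>\<^sub>F e in at_right 0. (LINT x|leb L. indicat_real (?S e) x * 1) < L\<^sup>2 / 4"
    by (rule order_tendstoD(2)[OF sublevel_integral_tendsto_0[OF one wm m ne]]) (use L in auto)
  moreover have "\<forall>\<^sub>F e in at_right 0. (LINT x|leb L. indicat_real (?S e) x * (\<xi> x)\<^sup>2) < 1 / 16"
    by (rule order_tendstoD(2)[OF sublevel_integral_tendsto_0[OF \<xi>2 wm m ne]]) auto
  ultimately have "\<forall>\<^sub>F e in at_right 0. 0 < e \<and> (LINT x|leb L. indicat_real (?S e) x * 1) < L\<^sup>2 / 4 \<and>
      (LINT x|leb L. indicat_real (?S e) x * (\<xi> x)\<^sup>2) < 1 / 16"
    by (intro eventually_conj eventually_at_right_less)
  then obtain e where e: "0 < e" "(LINT x|leb L. indicat_real (?S e) x * 1) < L\<^sup>2 / 4"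
      "(LINT x|leb L. indicat_real (?S e) x * (\<xi> x)\<^sup>2) < 1 / 16"
    using eventually_happens'[OF trivial_limit_at_right_real] by blast
  define f where "f = (\<lambda>x. max ((m + e) - w x) 0)"
  define X where "X = sqrt (LINT x|leb L. (f x)\<^sup>2)"
  define F where "F = (LINT x|leb L. f x)"
  define P where "P = - L2_inner L \<xi> f"
  have fL2: "f \<in> L2 L" unfolding f_def by (rule L2_max_const(2)[OF wL2])
  have f: "integrable (leb L) f" by (rule L2_imp_integrable[OF fL2])
  have f2: "integrable (leb L) (\<lambda>x. (f x)\<^sup>2)" and fm: "f \<in> borel_measurable (leb L)" using fL2 unfolding L2_def by blast+
  have fb: "f x \<le> e" if "x \<in> square L" for x using m[OF that] e by (simp add: f_def)
  have fnn: "0 \<le> f x" for x by (simp add: f_def)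
  have X0: "0 \<le> X" by (simp add: X_def)
  have X2: "(LINT x|leb L. (f x)\<^sup>2) = X\<^sup>2" by (simp add: X_def)
  have bd: "\<bar>LINT x|leb L. q x * f x\<bar> \<le> sqrt (LINT x|leb L. indicat_real (?S e) x * (q x)\<^sup>2) * X"
    if q: "q \<in> borel_measurable (leb L)" "integrable (leb L) (\<lambda>x. (q x)\<^sup>2)" for q
  proof -
    have i: "(\<lambda>x. indicat_real (?S e) x) \<in> borel_measurable (leb L)"
    proof -
      have "{x \<in> space (leb L). w x < m + e} \<in> sets (leb L)" using wm by measurable
      then have "(\<lambda>x. indicat_real {x \<in> space (leb L). w x < m + e} x) \<in> borel_measurable (leb L)"
        by (rule borel_measurable_indicator)
      then show ?thesis by (rule measurable_cong[THEN iffD1, rotated]) (auto simp: indicator_def)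
    qed
    have sq: "(indicat_real (?S e) x * q x)\<^sup>2 = indicat_real (?S e) x * (q x)\<^sup>2" for x
      by (simp add: indicator_def)
    have "integrable (leb L) (\<lambda>x. (indicat_real (?S e) x * q x)\<^sup>2)"
      by (rule Bochner_Integration.integrable_bound[OF q(2)]) (use i q(1) in \<open>auto simp: indicator_def\<close>)
    moreover have "integrable (leb L) (\<lambda>x. (indicat_real (?S e) x * q x) * f x)"
    proof (rule Bochner_Integration.integrable_bound[where f="\<lambda>x. (q x)\<^sup>2 + (f x)\<^sup>2"])
      show "integrable (leb L) (\<lambda>x. (q x)\<^sup>2 + (f x)\<^sup>2)" using q(2) f2 by auto
      show "AE x in leb L. norm ((indicat_real (?S e) x * q x) * f x) \<le> norm ((q x)\<^sup>2 + (f x)\<^sup>2)"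
      proof (intro AE_I2)
        fix x
        have "2 * (\<bar>q x\<bar> * \<bar>f x\<bar>) \<le> (q x)\<^sup>2 + (f x)\<^sup>2"
          using sum_squares_bound[of "\<bar>q x\<bar>" "\<bar>f x\<bar>"] by simp
        moreover have "0 \<le> \<bar>q x\<bar> * \<bar>f x\<bar>" by simp
        ultimately have "\<bar>q x\<bar> * \<bar>f x\<bar> \<le> (q x)\<^sup>2 + (f x)\<^sup>2" by linarith
        then show "norm ((indicat_real (?S e) x * q x) * f x) \<le> norm ((q x)\<^sup>2 + (f x)\<^sup>2)"
          by (auto simp: indicator_def abs_mult)
      qed
    qed (use i q(1) fm in auto)
    ultimately have "\<bar>LINT x|leb L. (indicat_real (?S e) x * q x) * f x\<bar>
        \<le> sqrt (LINT x|leb L. (indicat_real (?S e) x * q x)\<^sup>2) * sqrt (LINT x|leb L. (f x)\<^sup>2)"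
      by (rule integral_Cauchy_Schwarz[OF _ f2])
    moreover have "(indicat_real (?S e) x * q x) * f x = q x * f x" for x
      by (cases "w x < m + e") (auto simp: f_def)
    ultimately show ?thesis unfolding sq X_def by simp
  qed
  have "F \<le> \<bar>LINT x|leb L. 1 * f x\<bar>" by (simp add: F_def)
  also have "\<dots> \<le> sqrt (LINT x|leb L. indicat_real (?S e) x * 1\<^sup>2) * X"
    using one by (intro bd) auto
  also have "\<dots> \<le> L / 2 * X"
    using e(2) L X0 by (intro mult_right_mono real_le_lsqrt) (auto simp: power_divide less_imp_le)
  finally have FX: "F / (2 * L) \<le> X / 4" using L by (simp add: field_simps)
  have "P \<le> sqrt (LINT x|leb L. indicat_real (?S e) x * (\<xi> x)\<^sup>2) * X"
    using bd[OF \<xi>m \<xi>2] by (simp add: P_def L2_inner_def)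
  also have "\<dots> \<le> 1 / 4 * X"
    using e(3) X0 by (intro mult_right_mono real_le_lsqrt) (auto simp: power_divide less_imp_le)
  finally have PX: "P \<le> X / 4" by simp
  have F0: "0 \<le> F" using fnn by (simp add: F_def)
  \<comment> \<open>The variation of \<open>f\<close> is controlled only up to an error \<open>\<eta> > 0\<close>, which is carried along to the end.\<close>
  have XT: "X \<le> 2 * \<eta>" if \<eta>: "\<eta> > 0" for \<eta>
  proof -
    have V: "\<forall>\<^sub>F h in at_right 0. variation bc L 1 h f + variation bc L 2 h f \<le> h * (P + \<eta>)"
      unfolding f_def P_def by (rule energy_subgradient_truncation[OF L \<gamma> \<xi> \<eta>])
    have "\<forall>\<^sub>F h in at_right 0. variation bc L i h f \<le> h * (P + \<eta>)" for i
      using V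
    proof eventually_elim
      case (elim h)
      have "0 \<le> variation bc L j h f" for j by simp
      from this[of 1] this[of 2] elim have "variation bc L 1 h f \<le> h * (P + \<eta>)"
        "variation bc L 2 h f \<le> h * (P + \<eta>)" by linarith+
      then show ?case using exhaust_2[of i] by auto
    qed
    from sobolev_square_incr[OF L f fnn fb this]
    have sq: "X\<^sup>2 \<le> (F / (2 * L) + (P + \<eta>))\<^sup>2" unfolding X2 F_def .
    have "0 \<le> P + \<eta>"
    proof -
      have "\<forall>\<^sub>F h in at_right 0. 0 < h \<and> 0 \<le> h * (P + \<eta>)"
        using V eventually_at_right_less[of "0::real"]
      proof eventually_elim
        case (elim h)
        have "0 \<le> variation bc L j h f" for j by simp
        from this[of 1] this[of 2] elim have "0 \<le> h * (P + \<eta>)" by linarith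
        with elim show ?case by simp
      qed
      then obtain h where "0 < h" "0 \<le> h * (P + \<eta>)"
        using eventually_happens'[OF trivial_limit_at_right_real] by blast
      then show ?thesis by (simp add: zero_le_mult_iff)
    qed
    moreover have "0 \<le> F / (2 * L)" using F0 L by simp
    ultimately have "X \<le> F / (2 * L) + (P + \<eta>)"
      using power2_le_imp_le[OF sq] by simp
    then show ?thesis using FX PX by linarith
  qed
  have "X = 0" using XT[of "X / 4"] X0 by (cases "X = 0") auto
  then have "(LINT x|leb L. (f x)\<^sup>2) = 0" using X2 by simp
  then have "AE x in leb L. (f x)\<^sup>2 = 0"
    using integral_nonneg_eq_0_iff_AE[OF f2] by simp
  then have "AE x in leb L. m + e \<le> w x"
    by eventually_elim (simp add: f_def)
  then show thesis by (rule that[OF e(1)])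
qed

lemma energy_cong_AE:
  assumes u: "u \<in> L2 L" and w: "w \<in> L2 L" and eq: "AE x in leb L. u x = w x"
  shows "energy bc L \<gamma> u = energy bc L \<gamma> w"
proof -
  have m: "u \<in> borel_measurable (leb L)" "w \<in> borel_measurable (leb L)" using u w unfolding L2_def by blast+
  have inner: "(LINT x|leb L. u x * q x) = (LINT x|leb L. w x * q x)" if "continuous_on UNIV q" for q
    using eq by (intro integral_cong_AE borel_measurable_times m measurable_leb_continuous that) (auto elim: eventually_mono)
  have "(LINT x|leb L. u x * divergence z x) = (LINT x|leb L. w x * divergence z x)"
    if "\<forall>i. (\<lambda>x. z x $ i) \<in> test_functions bc L" for z
    unfolding divergence_def sum_2 using that
    by (intro inner continuous_on_add C1_partial_continuous test_functions_C1[of _ bc L]) auto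
  then have tv: "anisotropic_tv bc L u = anisotropic_tv bc L w"
    unfolding anisotropic_tv_def by (intro SUP_cong refl) auto
  have "L2_inner L u (partial i \<phi>) = L2_inner L w (partial i \<phi>)" if "\<phi> \<in> test_functions bc L" for \<phi> i
    unfolding L2_inner_def by (rule inner[OF C1_partial_continuous[OF test_functions_C1[OF that]]])
  then have "has_weak_gradient bc L u = has_weak_gradient bc L w"
    unfolding has_weak_gradient_def by (intro ext) auto
  then have "dirichlet_tv_energy bc L \<gamma> u = dirichlet_tv_energy bc L \<gamma> w"
    using u w by (simp add: dirichlet_tv_energy_def H1_def weak_gradient_def)
  then show ?thesis using tv by (simp add: energy_def)
qed

lemma L2_subdifferential_energy_cong_AE:
  assumes \<xi>: "\<xi> \<in> L2_subdifferential L (energy bc L \<gamma>) u" and w: "w \<in> L2 L" and eq: "AE x in leb L. u x = w x"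
  shows "\<xi> \<in> L2_subdifferential L (energy bc L \<gamma>) w"
proof -
  have u: "u \<in> L2 L" and \<xi>L2: "\<xi> \<in> L2 L" using \<xi> by (auto simp: L2_subdifferential_def)
  have m: "u \<in> borel_measurable (leb L)" "w \<in> borel_measurable (leb L)" "\<xi> \<in> borel_measurable (leb L)"
    using u w \<xi>L2 unfolding L2_def by blast+
  have "L2_inner L \<xi> (\<lambda>x. v x - u x) = L2_inner L \<xi> (\<lambda>x. v x - w x)" if "v \<in> L2 L" for v
  proof -
    have "v \<in> borel_measurable (leb L)" using that unfolding L2_def by blast
    then show ?thesis unfolding L2_inner_def
      using eq by (intro integral_cong_AE borel_measurable_times borel_measurable_diff m) (auto elim: eventually_mono)
  qed
  then show ?thesis using \<xi> w energy_cong_AE[OF u w eq, of bc \<gamma>]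
    by (simp add: L2_subdifferential_def)
qed

section \<open>Minimum sets of solutions\<close>

theorem proposition4p1:
  fixes bc :: boundary_condition
    and L \<gamma> t :: real
    and u0 w :: "real ^ 2 \<Rightarrow> real"
    and u :: "real \<Rightarrow> real ^ 2 \<Rightarrow> real"
    and x0 :: "real ^ 2"
    and N :: "(real ^ 2) set"
  assumes "L > 0" and "\<gamma> \<ge> 0"
    and "u0 \<in> L2 L"
    and "gradient_flow_solution bc L \<gamma> u0 u"
    and "t > 0"
    (* w is a pointwise representative of u(.,t), continuous on N *)
    and "AE x in lebesgue_on (square L). w x = u t x"
    and "x0 \<in> square L"
    and "\<forall>x \<in> square L. w x0 \<le> w x"
    and "open N" and "convex N" and "N \<subseteq> square L"
    and "{x \<in> square L. w x = w x0} \<subseteq> N"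
    and "continuous_on N w"
    and "convex_on N w"
    and "\<not> w constant_on N"
  shows "closedin (top_of_set N) ({x. w x = w x0} \<inter> N) \<and>
         interior ({x. w x = w x0} \<inter> N) \<noteq> {}"
proof
  let ?m = "w x0"
  let ?M = "{x. w x = ?m} \<inter> N"
  have "?M = {x \<in> N. w x = ?m}" by (simp add: Int_def conj_commute)
  then show "closedin (top_of_set N) ?M"
    by (simp only: continuous_closedin_preimage_constant[OF assms(13)])
  have x0: "x0 \<in> N" using assms(7,12) by blast
  obtain \<xi> where \<xi>: "\<xi> \<in> L2_subdifferential L (energy bc L \<gamma>) (u t)"
    using assms(4,5) unfolding gradient_flow_solution_def by blast
  show "interior ?M \<noteq> {}"
  proof
    assume int: "interior ?M = {}"
    \<comment> \<open>As \<open>?m\<close> is the minimum, the level set is a sublevel set of a convex function.\<close>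
    have "?M = {x \<in> N. w x \<le> ?m}" using assms(8,11) by force
    moreover have "convex {x \<in> N. w x \<le> ?m}"
    proof (rule convexI)
      fix x y and a b :: real
      assume xy: "x \<in> {x \<in> N. w x \<le> ?m}" "y \<in> {x \<in> N. w x \<le> ?m}" and ab: "0 \<le> a" "0 \<le> b" "a + b = 1"
      have "w (a *\<^sub>R x + b *\<^sub>R y) \<le> a * w x + b * w y"
        using assms(14) xy ab unfolding convex_on_def by auto
      also have "\<dots> \<le> ?m" using xy ab by (intro convex_bound_le) auto
      finally show "a *\<^sub>R x + b *\<^sub>R y \<in> {x \<in> N. w x \<le> ?m}"
        using convexD[OF assms(10) _ _ ab] xy by auto
    qed
    ultimately have "convex ?M" by simp
    then have "?M \<in> null_sets lebesgue"
      using negligible_convex_interior int unfolding negligible_iff_null_sets by blast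
    from AE_not_in[OF this] have notM: "AE x in leb L. x \<notin> ?M" by (rule AE_leb_I)
    \<comment> \<open>The representative \<open>w\<close> is not known to be measurable, and \<open>u t\<close> may lie below the minimum on a null set. The
        function \<open>v\<close> is measurable, at least \<open>?m\<close> everywhere, and equal to both almost everywhere.\<close>
    define v where "v = (\<lambda>x. max (u t x) ?m)"
    have vw: "AE x in leb L. w x = u t x \<and> v x = w x"
      using assms(6) AE_leb_square by eventually_elim (use assms(8) in \<open>auto simp: v_def max_absorb1\<close>)
    have "v \<in> L2 L" unfolding v_def
      using \<xi> by (intro L2_max_const) (auto simp: L2_subdifferential_def)
    moreover have "AE x in leb L. u t x = v x" using vw by eventually_elim simp
    ultimately have \<xi>v: "\<xi> \<in> L2_subdifferential L (energy bc L \<gamma>) v"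
      by (rule L2_subdifferential_energy_cong_AE[OF \<xi>])
    have "AE x in leb L. v x \<noteq> ?m"
      using notM vw AE_leb_square by eventually_elim (use assms(12) in auto)
    then obtain e where e: "e > 0" "AE x in leb L. ?m + e \<le> v x"
      using null_minimum_set_gap[OF assms(1,2) \<xi>v, of ?m thesis] by (auto simp: v_def)
    have "continuous (at x0) w"
      using assms(9,13) x0 by (simp add: continuous_on_eq_continuous_at)
    then have "\<forall>\<^sub>F x in nhds x0. w x < ?m + e"
      using e(1) by (intro order_tendstoD(2)) (auto simp: continuous_at tendsto_at_iff_tendsto_nhds)
    then have "\<forall>\<^sub>F x in nhds x0. w x < ?m + e \<and> x \<in> N"
      using eventually_nhds_in_open[OF assms(9) x0] by (rule eventually_conj)
    then obtain U where U: "open U" "x0 \<in> U" "\<And>x. x \<in> U \<Longrightarrow> w x < ?m + e \<and> x \<in> N"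
      unfolding eventually_nhds by blast
    have "AE x in leb L. x \<notin> U"
      using e(2) vw by eventually_elim (use U(3) in force)
    then have "AE x in lebesgue. x \<notin> U"
      unfolding AE_leb_iff by eventually_elim (use U(3) assms(11) in blast)
    then have "negligible U"
      using U(1) by (subst negligible_iff_null_sets, subst AE_iff_null_sets) auto
    then show False using U(1,2) open_not_negligible by blast
  qed
qed

end
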